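(* Let $\Gamma=(X,\mathcal{R})$ be a non-bipartite distance-regular graph with classical parameters $(D,q,\alpha,\beta)$, where $D\ge 4$ and $q\ge 2$, with intersection numbers $b_i,c_i,a_i$, and fix $x\in X$. Let $T=T(x)$ be the Terwilliger algebra and $\Delta$ the local graph of $\Gamma$ at $x$. Assume that every irreducible $T$-module with endpoint $1$ is thin, that $\Gamma$ supports a uniform structure with respect to $x$, and that $\alpha\neq0$. Let $(n=b_0,k=a_1,\lambda,\mu)$ denote the parameters of $\Delta$ (as a strongly regular graph). Then: (i) $\Delta$ is a connected strongly regular graph with eigenvalues $a_1$, $\alpha q\frac{q^{D-1}-1}{q-1}-1$, and $-q-1$; (ii) $\beta=\alpha\frac{q^{D+1}-1}{q-1}-q$, and in particular $n=b_0=\frac{(q^D-1)(\alpha q^{D+1}-q^2+q-\alpha)}{(q-1)^2}$, $k=a_1=\frac{(q+1)(\alpha q^D-q-\alpha+1)}{q-1}$, $\lambda=\frac{\alpha q^D+\alpha q^2-q^2-\alpha q-q-\alpha+2}{q-1}$, $\mu=\alpha(q+1)$.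
   Context: All graphs are finite, simple, connected, undirected; $\partial$ denotes path-length distance. $\Gamma$ is distance-regular with diameter $D$ if for all $0\le h,i,j\le D$ and all $y,z$ with $\partial(y,z)=h$ the number $p^h_{ij}=|\{w:\partial(y,w)=i,\ \partial(z,w)=j\}|$ depends only on $h,i,j$; write $c_i=p^i_{1,i-1}$, $a_i=p^i_{1,i}$, $b_i=p^i_{1,i+1}$, $k=b_0$. $\Gamma$ has classical parameters $(D,q,\alpha,\beta)$ if $c_i=[i](1+\alpha[i-1])$ for $1\le i\le D$ and $b_i=([D]-[i])(\beta-\alpha[i])$ for $0\le i\le D-1$, where $[j]=1+q+\cdots+q^{j-1}$. Let $V=\mathbb{C}^X$ and $A$ the adjacency matrix. For fixed $x$ and $0\le i\le D$, $E_i^*$ is the diagonal matrix with $(y,y)$-entry $1$ if $\partial(x,y)=i$ and $0$ otherwise. $T=T(x)$ is the algebra generated by $A$ and $E_0^*,\dots,E_D^*$. A $T$-module is a subspace $W\subseteq V$ with $TW\subseteq W$; irreducible if $W\ne0$ with only submodules $0,W$; its endpoint is $\min\{i:E_i^*W\ne0\}$; thin if $\dim E_i^*W\le1$ for all $i$. $L=\sum_{i=1}^{D}E^*_{i-1}AE^*_i$, $R=\sum_{i=0}^{D-1}E^*_{i+1}AE^*_i$. $\Gamma$ supports a uniform structure with respect to $x$ if there exist a tridiagonal complex matrix $U=(e_{ij})_{1\le i,j\le D}$ with $e_{ii}=1$, such that either $e_{i,i-1}\ne0$ for all $2\le i\le D$ or $e_{i-1,i}\ne0$ for all $2\le i\le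 D$, and every principal submatrix $(e_{ij})_{s\le i,j\le t}$ is nonsingular, and scalars $f_1,\dots,f_D$ such that, with $e_i^-=e_{i,i-1}$ ($e_1^-=0$) and $e_i^+=e_{i,i+1}$ ($e_D^+=0$), $e_i^-RL^2+LRL+e_i^+L^2R=f_iL$ holds on $E_i^*V$ for $1\le i\le D$. The local graph $\Delta$ at $x$ is the subgraph induced on the neighbours of $x$. A graph is strongly regular with parameters $(n,k,\lambda,\mu)$ if it has $n$ vertices, is $k$-regular, adjacent vertices have $\lambda$ common neighbours and distinct non-adjacent vertices have $\mu$ common neighbours; eigenvalues are those of its adjacency matrix. *)

theory Defs
  imports "HOL-Analysis.Analysis" "HOL-Combinatorics.Permutations"
begin

text \<open>
  A graph is a vertex set \<open>V\<close> with an edge relation \<open>E\<close>. The ambient graph lives on all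
  of a finite type \<open>'a\<close>; the set \<open>V\<close> is needed because the local graph lives on a proper
  subset.
\<close>

definition simple_graph :: "'a set \<Rightarrow> 'a rel \<Rightarrow> bool" where
  "simple_graph V E \<longleftrightarrow> finite V \<and> E \<subseteq> V \<times> V \<and> sym E \<and> irrefl E"

definition connected_graph :: "'a set \<Rightarrow> 'a rel \<Rightarrow> bool" where
  "connected_graph V E \<longleftrightarrow> V \<noteq> {} \<and> (\<forall>y\<in>V. \<forall>z\<in>V. (y, z) \<in> E\<^sup>*)"

definition bipartite_graph :: "'a set \<Rightarrow> 'a rel \<Rightarrow> bool" where
  "bipartite_graph V E \<longleftrightarrow> (\<exists>S \<subseteq> V. \<forall>(y, z) \<in> E. y \<in> S \<longleftrightarrow> z \<notin> S)"

text \<open>Only meaningful for connected pairs; elsewhere the value is unspecified.\<close>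

definition gdist :: "'a rel \<Rightarrow> 'a \<Rightarrow> 'a \<Rightarrow> nat" where
  "gdist E y z = (LEAST n. (y, z) \<in> E ^^ n)"

definition gdiam :: "('a::finite) rel \<Rightarrow> nat" where
  "gdiam E = Max {gdist E y z | y z. True}"

definition strongly_regular ::
    "'a set \<Rightarrow> 'a rel \<Rightarrow> nat \<Rightarrow> nat \<Rightarrow> nat \<Rightarrow> nat \<Rightarrow> bool" where
  "strongly_regular V E n k l m \<longleftrightarrow>
     simple_graph V E \<and> card V = n \<and>
     (\<forall>y\<in>V. card {w\<in>V. (y, w) \<in> E} = k) \<and>
     (\<forall>y\<in>V. \<forall>z\<in>V. (y, z) \<in> E \<longrightarrow> card {w\<in>V. (y, w) \<in> E \<and> (z, w) \<in> E} = l) \<and>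
     (\<forall>y\<in>V. \<forall>z\<in>V. y \<noteq> z \<and> (y, z) \<notin> E \<longrightarrow>
        card {w\<in>V. (y, w) \<in> E \<and> (z, w) \<in> E} = m)"

text \<open>
  Eigenvalues of the adjacency matrix of \<open>(V, E)\<close>, a matrix with rows and columns indexed by
  \<open>V\<close>; vectors are functions of which only the values on \<open>V\<close> matter.
\<close>

definition graph_eigenvalues :: "'a set \<Rightarrow> 'a rel \<Rightarrow> complex set" where
  "graph_eigenvalues V E =
     {\<theta>. \<exists>v :: 'a \<Rightarrow> complex. (\<exists>y\<in>V. v y \<noteq> 0) \<and>
        (\<forall>y\<in>V. (\<Sum>z\<in>V. (if (y, z) \<in> E then 1 else 0) * v z) = \<theta> * v y)}"

definition local_verts :: "'a rel \<Rightarrow> 'a \<Rightarrow> 'a set" where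
  "local_verts E x = {y. (x, y) \<in> E}"

definition local_edges :: "'a rel \<Rightarrow> 'a \<Rightarrow> 'a rel" where
  "local_edges E x = E \<inter> local_verts E x \<times> local_verts E x"


section \<open>Distance-regular graphs\<close>

definition distance_regular :: "('a::finite) rel \<Rightarrow> nat \<Rightarrow> bool" where
  "distance_regular E D \<longleftrightarrow>
     simple_graph UNIV E \<and> connected_graph UNIV E \<and> gdiam E = D \<and>
     (\<forall>h\<le>D. \<forall>i\<le>D. \<forall>j\<le>D. \<exists>n. \<forall>y z. gdist E y z = h \<longrightarrow>
        card {w. gdist E y w = i \<and> gdist E z w = j} = n)"

text \<open>
  \<open>inter_num E h i j\<close> is $p^h_{ij}$; the description is proper for a distance-regular graph
  and \<open>h, i, j \<le> D\<close>.
\<close>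

definition inter_num :: "('a::finite) rel \<Rightarrow> nat \<Rightarrow> nat \<Rightarrow> nat \<Rightarrow> nat" where
  "inter_num E h i j =
     (THE n. \<forall>y z. gdist E y z = h \<longrightarrow> card {w. gdist E y w = i \<and> gdist E z w = j} = n)"

definition c_num :: "('a::finite) rel \<Rightarrow> nat \<Rightarrow> nat" where
  "c_num E i = inter_num E i 1 (i - 1)"

definition a_num :: "('a::finite) rel \<Rightarrow> nat \<Rightarrow> nat" where
  "a_num E i = inter_num E i 1 i"

definition b_num :: "('a::finite) rel \<Rightarrow> nat \<Rightarrow> nat" where
  "b_num E i = inter_num E i 1 (i + 1)"

definition gauss :: "real \<Rightarrow> nat \<Rightarrow> real" where
  "gauss q j = (\<Sum>i<j. q ^ i)"

definition classical_parameters ::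
    "('a::finite) rel \<Rightarrow> nat \<Rightarrow> real \<Rightarrow> real \<Rightarrow> real \<Rightarrow> bool" where
  "classical_parameters E D q \<alpha> \<beta> \<longleftrightarrow>
     distance_regular E D \<and>
     (\<forall>i. 1 \<le> i \<and> i \<le> D \<longrightarrow>
        real (c_num E i) = gauss q i * (1 + \<alpha> * gauss q (i - 1))) \<and>
     (\<forall>i<D. real (b_num E i) = (gauss q D - gauss q i) * (\<beta> - \<alpha> * gauss q i))"


section \<open>The Terwilliger algebra and its modules\<close>

definition adj_mat :: "('a::finite) rel \<Rightarrow> complex^'a^'a" where
  "adj_mat E = (\<chi> y z. if (y, z) \<in> E then 1 else 0)"

definition Estar :: "('a::finite) rel \<Rightarrow> 'a \<Rightarrow> nat \<Rightarrow> complex^'a^'a" where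
  "Estar E x i = (\<chi> y z. if y = z \<and> gdist E x y = i then 1 else 0)"

text \<open>
  The generated complex algebra; \<open>mat c ** B\<close> is the scalar multiple \<open>c B\<close>. The identity need
  not be added, being the sum of the \<open>Estar E x i\<close>.
\<close>

inductive_set terwilliger :: "('a::finite) rel \<Rightarrow> 'a \<Rightarrow> (complex^'a^'a) set"
  for E :: "('a::finite) rel" and x :: 'a where
  adj: "adj_mat E \<in> terwilliger E x"
| dual: "i \<le> gdiam E \<Longrightarrow> Estar E x i \<in> terwilliger E x"
| add: "B \<in> terwilliger E x \<Longrightarrow> C \<in> terwilliger E x \<Longrightarrow> B + C \<in> terwilliger E x"
| scale: "B \<in> terwilliger E x \<Longrightarrow> mat c ** B \<in> terwilliger E x"
| mult: "B \<in> terwilliger E x \<Longrightarrow> C \<in> terwilliger E x \<Longrightarrow> B ** C \<in> terwilliger E x"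

text \<open>
  \<open>vec.subspace\<close> and \<open>vec.dim\<close> are the complex-linear notions on \<open>complex^'a\<close>; the unqualified
  \<open>subspace\<close> and \<open>dim\<close> would be real-linear.
\<close>

definition T_module :: "('a::finite) rel \<Rightarrow> 'a \<Rightarrow> (complex^'a) set \<Rightarrow> bool" where
  "T_module E x W \<longleftrightarrow>
     vec.subspace W \<and> (\<forall>B \<in> terwilliger E x. \<forall>w \<in> W. B *v w \<in> W)"

definition irreducible_T_module :: "('a::finite) rel \<Rightarrow> 'a \<Rightarrow> (complex^'a) set \<Rightarrow> bool" where
  "irreducible_T_module E x W \<longleftrightarrow>
     T_module E x W \<and> W \<noteq> {0} \<and>
     (\<forall>W'. T_module E x W' \<and> W' \<subseteq> W \<longrightarrow> W' = {0} \<or> W' = W)"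

definition endpoint :: "('a::finite) rel \<Rightarrow> 'a \<Rightarrow> (complex^'a) set \<Rightarrow> nat" where
  "endpoint E x W = (LEAST i. (\<lambda>w. Estar E x i *v w) ` W \<noteq> {0})"

definition thin :: "('a::finite) rel \<Rightarrow> 'a \<Rightarrow> (complex^'a) set \<Rightarrow> bool" where
  "thin E x W \<longleftrightarrow> (\<forall>i \<le> gdiam E. vec.dim ((\<lambda>w. Estar E x i *v w) ` W) \<le> 1)"


section \<open>Uniform structures\<close>

definition lower_mat :: "('a::finite) rel \<Rightarrow> 'a \<Rightarrow> complex^'a^'a" where
  "lower_mat E x = (\<Sum>i=1..gdiam E. Estar E x (i - 1) ** adj_mat E ** Estar E x i)"

definition raise_mat :: "('a::finite) rel \<Rightarrow> 'a \<Rightarrow> complex^'a^'a" where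
  "raise_mat E x = (\<Sum>i<gdiam E. Estar E x (i + 1) ** adj_mat E ** Estar E x i)"

text \<open>
  The Leibniz determinant of a square matrix with rows and columns indexed by a finite set; it
  has the same form as the library's \<open>det\<close>, whose index set must be a whole type.
\<close>

definition det_on :: "'i set \<Rightarrow> ('i \<Rightarrow> 'i \<Rightarrow> complex) \<Rightarrow> complex" where
  "det_on S M = (\<Sum>p | p permutes S. of_int (sign p) * (\<Prod>i\<in>S. M i (p i)))"

text \<open>Matrices with index set \<open>{1..D}\<close> are functions whose other values are ignored.\<close>

definition parameter_matrix :: "nat \<Rightarrow> (nat \<Rightarrow> nat \<Rightarrow> complex) \<Rightarrow> bool" where
  "parameter_matrix D e \<longleftrightarrow>
     (\<forall>i\<in>{1..D}. \<forall>j\<in>{1..D}. i + 1 < j \<or> j + 1 < i \<longrightarrow> e i j = 0) \<and>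
     (\<forall>i\<in>{1..D}. e i i = 1) \<and>
     ((\<forall>i\<in>{2..D}. e i (i - 1) \<noteq> 0) \<or> (\<forall>i\<in>{2..D}. e (i - 1) i \<noteq> 0)) \<and>
     (\<forall>s t. 1 \<le> s \<and> s \<le> t \<and> t \<le> D \<longrightarrow> det_on {s..t} e \<noteq> 0)"

definition e_minus :: "(nat \<Rightarrow> nat \<Rightarrow> complex) \<Rightarrow> nat \<Rightarrow> complex" where
  "e_minus e i = (if i = 1 then 0 else e i (i - 1))"

definition e_plus :: "nat \<Rightarrow> (nat \<Rightarrow> nat \<Rightarrow> complex) \<Rightarrow> nat \<Rightarrow> complex" where
  "e_plus D e i = (if i = D then 0 else e i (i + 1))"

definition supports_uniform_structure :: "('a::finite) rel \<Rightarrow> 'a \<Rightarrow> bool" where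
  "supports_uniform_structure E x \<longleftrightarrow>
     (\<exists>e f. parameter_matrix (gdiam E) e \<and>
        (let L = lower_mat E x; R = raise_mat E x in
         \<forall>i\<in>{1..gdiam E}. \<forall>v \<in> range (\<lambda>u. Estar E x i *v u).
           e_minus e i *s ((R ** L ** L) *v v) + (L ** R ** L) *v v
             + e_plus (gdiam E) e i *s ((L ** L ** R) *v v)
           = f i *s (L *v v)))"

end

theory Submission
  imports Defs
begin

text \<open>
  Write \<open>h = [D]\<close>. A thin irreducible module of endpoint one is generated by an eigenvector \<open>v\<close> of
  the local graph that is orthogonal to the all-ones vector; let \<open>\<theta> - 1\<close> be the eigenvalue. The
  classical parameters make the graph Q-polynomial, and the vanishing of the Krein parameters
  \<open>q\<^sup>1\<^sub>1\<^sub>j\<close> for \<open>j \<ge> 3\<close> turns thinness on the second subconstituent into a polynomial equation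
  for \<open>\<theta>\<close> with the four roots \<open>0\<close>, \<open>\<alpha> (h - 1)\<close>, \<open>\<beta> - \<alpha>\<close>, \<open>- q\<close>. For each root the action of the
  lowering and raising maps on the module is explicit. If two modules of the same diameter occur,
  then the uniform structure puts the difference of their data in the kernel of a principal
  submatrix of the parameter matrix, so that the data agree; this excludes the pairs
  \<open>- q\<close>, \<open>\<beta> - \<alpha>\<close> and \<open>0\<close>, \<open>\<alpha> (h - 1)\<close>. Whenever only two roots \<open>r\<close>, \<open>s\<close> occur, the shifted local
  adjacency matrix \<open>N = A + I\<close> satisfies \<open>(N - r) (N - s) = c J\<close>, and comparing diagonal entries and row
  sums leaves only the roots \<open>- q\<close>, \<open>\<alpha> (h - 1)\<close>, together with the value of \<open>\<beta>\<close>.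
\<close>

section \<open>Distance-regular graphs\<close>

text \<open>No primitive idempotent is constructed. The classical parameters make the adjacency
  action triangular on the three functions \<open>1\<close>, \<open>q^-i\<close>,
  \<open>q^-2i\<close> of the distance, and their span contains the square of the cosine sequence of
  \<open>th1\<close>. The root \<open>- q\<close> stands apart: it is the only value at which the
  projection of \<open>v\<close> to the eigenspace of \<open>th1\<close> can vanish. At every other
  value this projection is the nonzero vector in which scalars are compared. The explicit data run
  up to level \<open>D - 1\<close> for \<open>- q\<close> and \<open>\<beta> - \<alpha>\<close>, and
  up to level \<open>D\<close> for \<open>0\<close> and \<open>\<alpha> (h - 1)\<close>. A
  comparison through the uniform structure needs a common last level, which is why it excludes
  exactly these two pairs. The roots \<open>\<alpha> (h - 1)\<close> and
  \<open>\<beta> - \<alpha>\<close> collide when \<open>\<beta> = \<alpha> h\<close>; the data of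
  the former then break down at level \<open>D\<close>, and the quadratic equation settles this
  case. In place of a decomposition of the whole space into irreducible modules, a submodule of
  minimal dimension shows that the modules of endpoint one account for all zero-sum vectors on the
  neighbours of \<open>x\<close>.\<close>

locale finite_connected_graph =
  fixes E :: "('a::finite) rel"
  assumes simple: "simple_graph UNIV E" and conn: "connected_graph UNIV E"
begin

lemma edge_sym: "(y, z) \<in> E \<Longrightarrow> (z, y) \<in> E"
  using simple by (auto simp: simple_graph_def sym_def)

lemma edge_irrefl: "(y, y) \<notin> E"
  using simple by (auto simp: simple_graph_def irrefl_def)

lemma gdist_walk: "(y, z) \<in> E ^^ gdist E y z"
proof -
  have "(y, z) \<in> E\<^sup>*" using conn by (auto simp: connected_graph_def)
  then show ?thesis unfolding gdist_def by (metis LeastI_ex rtrancl_imp_relpow)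
qed

lemma gdist_le: "(y, z) \<in> E ^^ n \<Longrightarrow> gdist E y z \<le> n"
  unfolding gdist_def by (rule Least_le)

lemma relpow_sym: "(y, z) \<in> E ^^ n \<Longrightarrow> (z, y) \<in> E ^^ n"
proof (induction n arbitrary: y z)
  case (Suc n)
  then obtain w where "(y, w) \<in> E ^^ n" "(w, z) \<in> E" by auto
  then show ?case using Suc.IH edge_sym relpow_Suc_I2 by metis
qed auto

lemma gdist_sym: "gdist E y z = gdist E z y"
  by (intro antisym; rule gdist_le, rule relpow_sym, rule gdist_walk)

lemma gdist_self [simp]: "gdist E y y = 0"
  using gdist_le[of y y 0] by simp

lemma gdist_eq_0_iff [simp]: "gdist E y z = 0 \<longleftrightarrow> y = z"
  using gdist_walk[of y z] by auto

lemma gdist_edge: "gdist E y z = 1 \<longleftrightarrow> (y, z) \<in> E"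
proof
  show "(y, z) \<in> E" if "gdist E y z = 1" using gdist_walk[of y z] that by simp
  show "gdist E y z = 1" if "(y, z) \<in> E"
  proof -
    have "y \<noteq> z" using that edge_irrefl by blast
    then have "gdist E y z \<noteq> 0" by simp
    moreover have "gdist E y z \<le> 1" using that by (intro gdist_le) simp
    ultimately show ?thesis by linarith
  qed
qed

lemma gdist_triangle: "gdist E y z \<le> gdist E y w + gdist E w z"
  by (rule gdist_le) (metis gdist_walk relpow_trans)

lemma gdist_step:
  assumes "(y, w) \<in> E"
  shows "gdist E w z \<le> Suc (gdist E y z)" "gdist E y z \<le> Suc (gdist E w z)"
  using gdist_triangle[of w z y] gdist_triangle[of y z w] gdist_edge[of y w] gdist_edge[of w y]
    assms edge_sym by auto

lemma finite_gdists: "finite {gdist E y z | y z. True}"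
proof -
  have "{gdist E y z | y z. True} = (\<lambda>(y, z). gdist E y z) ` UNIV" by auto
  then show ?thesis by (metis finite finite_imageI)
qed

lemma gdist_le_gdiam: "gdist E y z \<le> gdiam E"
  unfolding gdiam_def using finite_gdists by (intro Max_ge) auto

lemma ex_gdist:
  assumes "h \<le> gdiam E"
  shows "\<exists>y z. gdist E y z = h"
proof -
  have "gdiam E \<in> {gdist E y z | y z. True}"
    unfolding gdiam_def using finite_gdists by (intro Max_in) auto
  then obtain y z where yz: "gdist E y z = gdiam E" by auto
  then have "(y, z) \<in> E ^^ (h + (gdiam E - h))" using gdist_walk[of y z] assms by simp
  then obtain w where w: "(y, w) \<in> E ^^ h" "(w, z) \<in> E ^^ (gdiam E - h)"
    by (auto simp: relpow_add)
  have "gdist E y w = h"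
    using gdist_le[OF w(1)] gdist_le[OF w(2)] gdist_triangle[of y z w] yz assms by linarith
  then show ?thesis by blast
qed

end

lemma inter_num_eq:
  fixes E :: "('a::finite) rel"
  assumes "distance_regular E D" "gdist E y z = h" "h \<le> D" "i \<le> D" "j \<le> D"
  shows "card {w. gdist E y w = i \<and> gdist E z w = j} = inter_num E h i j"
proof -
  have "\<exists>n. \<forall>y z. gdist E y z = h \<longrightarrow> card {w. gdist E y w = i \<and> gdist E z w = j} = n"
    using assms(1,3-5) unfolding distance_regular_def by simp
  then obtain n where n: "\<And>y z. gdist E y z = h \<Longrightarrow> card {w. gdist E y w = i \<and> gdist E z w = j} = n"
    by auto
  have "inter_num E h i j = n"
    unfolding inter_num_def
    by (rule the_equality) (use n assms(2) in blast)+
  then show ?thesis using n assms(2) by blast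
qed

lemma gauss_0 [simp]: "gauss q 0 = 0" and gauss_Suc_left: "gauss q (Suc i) = 1 + q * gauss q i"
  and gauss_1 [simp]: "gauss q (Suc 0) = 1"
  unfolding gauss_def by (simp_all add: sum.lessThan_Suc_shift sum_distrib_left del: sum.lessThan_Suc)

lemma power_gauss: "q ^ i = 1 + (q - 1) * gauss q i"
proof (induction i)
  case (Suc i)
  then have "q ^ Suc i = q * (1 + (q - 1) * gauss q i)" by simp
  then show ?case by (simp add: gauss_Suc_left algebra_simps)
qed simp

locale classical_drg = finite_connected_graph E for E :: "('a::finite) rel" +
  fixes D :: nat and q \<alpha> \<beta> :: real
  assumes classical: "classical_parameters E D q \<alpha> \<beta>" and D3: "3 \<le> D" and q2: "2 \<le> q"
begin

abbreviation g :: "nat \<Rightarrow> real" where "g \<equiv> gauss q"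

text \<open>Closed forms as total real functions: \<open>cc 0\<close> and \<open>bb D\<close>
  vanish, so recurrences need no separate cases at the two ends of the index range.\<close>

definition cc :: "nat \<Rightarrow> real" where "cc i = g i * (1 + \<alpha> * g (i - 1))"
definition bb :: "nat \<Rightarrow> real" where "bb i = (g D - g i) * (\<beta> - \<alpha> * g i)"
definition aa :: "nat \<Rightarrow> real" where "aa i = bb 0 - bb i - cc i"

lemma drg: "distance_regular E D" and diam: "gdiam E = D"
  using classical by (auto simp: classical_parameters_def distance_regular_def)

lemma gdist_le_D: "gdist E y z \<le> D"
  using gdist_le_gdiam diam by metis

lemma cc_0 [simp]: "cc 0 = 0" and cc_1 [simp]: "cc (Suc 0) = 1" and bb_D [simp]: "bb D = 0"
  and aa_0 [simp]: "aa 0 = 0"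
  by (simp_all add: cc_def bb_def aa_def)

lemma card_nbr_c:
  assumes "gdist E y z = Suc i"
  shows "real (card {w. (y, w) \<in> E \<and> gdist E w z = i}) = cc (Suc i)"
proof -
  have le: "Suc i \<le> D" using gdist_le_D[of y z] assms by simp
  have "card {w. gdist E y w = 1 \<and> gdist E z w = i} = inter_num E (Suc i) 1 i"
    by (rule inter_num_eq[OF drg assms]) (use le in auto)
  also have "{w. gdist E y w = 1 \<and> gdist E z w = i} = {w. (y, w) \<in> E \<and> gdist E w z = i}"
    using gdist_edge[of y] gdist_sym[of z] by auto
  finally show ?thesis
    using classical le unfolding classical_parameters_def c_num_def cc_def by auto
qed

lemma card_nbr_b:
  assumes "gdist E y z = i"
  shows "real (card {w. (y, w) \<in> E \<and> gdist E w z = Suc i}) = bb i"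
proof (cases "i = D")
  case True
  then have "{w. (y, w) \<in> E \<and> gdist E w z = Suc i} = {}"
    using gdist_le_D[of _ z] by (auto simp: Suc_n_not_le_n) (metis Suc_n_not_le_n)
  then show ?thesis using True by simp
next
  case False
  then have le: "i < D" using gdist_le_D[of y z] assms by simp
  have "card {w. gdist E y w = 1 \<and> gdist E z w = Suc i} = inter_num E i 1 (Suc i)"
    by (rule inter_num_eq[OF drg assms]) (use le in auto)
  also have "{w. gdist E y w = 1 \<and> gdist E z w = Suc i} = {w. (y, w) \<in> E \<and> gdist E w z = Suc i}"
    using gdist_edge[of y] gdist_sym[of z] by auto
  finally show ?thesis
    using classical le unfolding classical_parameters_def b_num_def bb_def by auto
qed

lemma card_nbr: "real (card {w. (y, w) \<in> E}) = bb 0"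
proof -
  have "{w. (y, w) \<in> E} = {w. (y, w) \<in> E \<and> gdist E w y = Suc 0}"
    using gdist_edge[of _ y] edge_sym by auto
  then show ?thesis using card_nbr_b[of y y 0] by simp
qed

lemma nbr_dist_cases:
  assumes "(y, w) \<in> E"
  shows "gdist E w z = gdist E y z \<or> gdist E w z = Suc (gdist E y z) \<or> Suc (gdist E w z) = gdist E y z"
  using gdist_step[OF assms, of z] by linarith

lemma card_nbr_a:
  assumes h: "gdist E y z = i"
  shows "real (card {w. (y, w) \<in> E \<and> gdist E w z = i}) = aa i"
proof -
  let ?S = "\<lambda>j. {w. (y, w) \<in> E \<and> gdist E w z = j}"
  let ?C = "{w. (y, w) \<in> E \<and> Suc (gdist E w z) = i}"
  have split: "{w. (y, w) \<in> E} = ?S i \<union> (?S (Suc i) \<union> ?C)"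
    using nbr_dist_cases[of y _ z] h by auto
  then have "card {w. (y, w) \<in> E} = card (?S i) + (card (?S (Suc i)) + card ?C)"
    by (subst split, subst card_Un_disjoint, simp, simp, force, subst card_Un_disjoint) auto
  moreover have "real (card ?C) = cc i"
    using card_nbr_c[of y z "i - 1"] h by (cases i) auto
  ultimately show ?thesis using card_nbr[of y] card_nbr_b[OF h] unfolding aa_def by simp
qed

text \<open>The tridiagonal action of the adjacency matrix on functions of the distance to a fixed vertex.\<close>

definition Mop :: "(nat \<Rightarrow> real) \<Rightarrow> nat \<Rightarrow> real" where
  "Mop f i = cc i * f (i - 1) + aa i * f i + bb i * f (Suc i)"

lemma sum_nbr_dist: "(\<Sum>w | (y, w) \<in> E. f (gdist E w z)) = Mop f (gdist E y z)"
proof -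
  define h where "h = gdist E y z"
  have "f (gdist E w z) = (if Suc (gdist E w z) = h then f (h - 1) else 0)
      + (if gdist E w z = h then f h else 0) + (if gdist E w z = Suc h then f (Suc h) else 0)"
    if "(y, w) \<in> E" for w
  proof -
    consider "gdist E w z = h" | "gdist E w z = Suc h" | i where "gdist E w z = i" "h = Suc i"
      using nbr_dist_cases[OF \<open>(y, w) \<in> E\<close>, of z] unfolding h_def by metis
    then show ?thesis by cases auto
  qed
  then have "(\<Sum>w | (y, w) \<in> E. f (gdist E w z)) =
      (\<Sum>w | (y, w) \<in> E. if Suc (gdist E w z) = h then f (h - 1) else 0)
      + (\<Sum>w | (y, w) \<in> E. if gdist E w z = h then f h else 0)
      + (\<Sum>w | (y, w) \<in> E. if gdist E w z = Suc h then f (Suc h) else 0)"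
    by (simp add: sum.distrib)
  also have "(\<Sum>w | (y, w) \<in> E. if gdist E w z = h then f h else 0) = aa h * f h"
    using card_nbr_a[of y z h] by (simp add: h_def sum.If_cases Int_def conj_commute)
  also have "(\<Sum>w | (y, w) \<in> E. if gdist E w z = Suc h then f (Suc h) else 0) = bb h * f (Suc h)"
    using card_nbr_b[of y z h] by (simp add: h_def sum.If_cases Int_def conj_commute)
  \<comment> \<open>For \<open>h = 0\<close> both sides vanish, the right one because
    \<open>cc 0 = 0\<close>; the truncated \<open>h - 1\<close> is harmless.\<close>
  also have "(\<Sum>w | (y, w) \<in> E. if Suc (gdist E w z) = h then f (h - 1) else 0) = cc h * f (h - 1)"
  proof (cases h)
    case (Suc i)
    then show ?thesis
      using card_nbr_c[of y z i] by (simp add: h_def sum.If_cases Int_def conj_commute)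
  qed simp
  finally show ?thesis unfolding Mop_def h_def by simp
qed

end

section \<open>Operators on vectors\<close>

locale based_drg = classical_drg E D q \<alpha> \<beta> for E :: "('a::finite) rel" and D q \<alpha> \<beta> +
  fixes x :: 'a
begin

definition lev :: "nat \<Rightarrow> complex^'a \<Rightarrow> complex^'a" where
  "lev i v = (\<chi> z. if gdist E x z = i then v $ z else 0)"

definition adj :: "complex^'a \<Rightarrow> complex^'a" where
  "adj v = (\<chi> z. \<Sum>w | (z, w) \<in> E. v $ w)"

text \<open>The elements of the Bose--Mesner algebra.\<close>

definition bm :: "(nat \<Rightarrow> real) \<Rightarrow> complex^'a \<Rightarrow> complex^'a" where
  "bm f v = (\<chi> y. \<Sum>z\<in>UNIV. f (gdist E y z) *\<^sub>R v $ z)"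

abbreviation act :: "nat \<Rightarrow> complex^'a \<Rightarrow> complex^'a" where
  "act j \<equiv> bm (\<lambda>i. if i = j then 1 else 0)"

lemma lev_nth [simp]: "lev i v $ z = (if gdist E x z = i then v $ z else 0)"
  by (simp add: lev_def)

lemma Estar_mult: "Estar E x i *v v = lev i v"
  by (simp add: vec_eq_iff matrix_vector_mult_def Estar_def if_distrib[of "\<lambda>t. t * _"] cong: if_cong)

lemma adj_mult: "adj_mat E *v v = adj v"
  by (simp add: vec_eq_iff matrix_vector_mult_def adj_mat_def adj_def if_distrib[of "\<lambda>t. t * _"]
      sum.If_cases cong: if_cong)

lemma lev_add: "lev i (v + w) = lev i v + lev i w"
  and lev_diff: "lev i (v - w) = lev i v - lev i w"
  and lev_minus: "lev i (- v) = - lev i v"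
  and lev_scaleR: "lev i (r *\<^sub>R v) = r *\<^sub>R lev i v"
  and lev_smult: "lev i (c *s v) = c *s lev i v"
  and lev_0 [simp]: "lev i 0 = 0"
  by (simp_all add: vec_eq_iff)

lemma adj_add: "adj (v + w) = adj v + adj w"
  and adj_diff: "adj (v - w) = adj v - adj w"
  and adj_minus: "adj (- v) = - adj v"
  and adj_scaleR: "adj (r *\<^sub>R v) = r *\<^sub>R adj v"
  and adj_smult: "adj (c *s v) = c *s adj v"
  and adj_0 [simp]: "adj 0 = 0"
  by (simp_all add: vec_eq_iff adj_def sum.distrib sum_subtractf sum_negf scaleR_sum_right
      sum_distrib_left)

lemma bm_add: "bm f (v + w) = bm f v + bm f w"
  and bm_diff: "bm f (v - w) = bm f v - bm f w"
  and bm_minus: "bm f (- v) = - bm f v"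
  and bm_scaleR: "bm f (r *\<^sub>R v) = r *\<^sub>R bm f v"
  and bm_smult: "bm f (c *s v) = c *s bm f v"
  and bm_0 [simp]: "bm f 0 = 0"
  by (simp_all add: vec_eq_iff bm_def sum.distrib sum_subtractf sum_negf scaleR_sum_right
      sum_distrib_left algebra_simps)

lemmas op_linear = lev_add lev_diff lev_minus lev_scaleR adj_add adj_diff adj_minus adj_scaleR
  bm_add bm_diff bm_minus bm_scaleR

lemma lev_lev [simp]: "lev i (lev j v) = (if i = j then lev i v else 0)"
  by (auto simp: vec_eq_iff)

lemma sum_lev: "(\<Sum>i\<le>D. lev i v) = v"
proof -
  have "(\<Sum>i\<le>D. lev i v $ z) = v $ z" for z
    using gdist_le_D[of x z] by simp
  then show ?thesis by (simp add: vec_eq_iff)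
qed

lemma lev_gt_D: "D < i \<Longrightarrow> lev i v = 0"
  using gdist_le_D[of x] by (auto simp: vec_eq_iff) (meson not_le)

lemma lev_adj_far: "Suc j < i \<or> Suc i < j \<Longrightarrow> lev i (adj (lev j w)) = 0"
  unfolding vec_eq_iff
proof (intro allI)
  fix z assume far: "Suc j < i \<or> Suc i < j"
  show "lev i (adj (lev j w)) $ z = 0 $ z"
  proof -
    have "gdist E x u \<noteq> j" if "(z, u) \<in> E" "gdist E x z = i" for u
      using gdist_step[OF that(1), of x] that(2) far gdist_sym[of x] by auto
    then show ?thesis by (auto simp: adj_def intro!: sum.neutral)
  qed
qed

lemma adj_lev: "adj w = (\<Sum>j\<le>D. adj (lev j w))"
proof -
  have "adj (\<Sum>j\<in>S. lev j w) = (\<Sum>j\<in>S. adj (lev j w))" if "finite S" for S :: "nat set"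
    using that by induction (simp_all add: adj_add)
  from this[of "{..D}"] show ?thesis by (simp add: sum_lev)
qed

text \<open>The adjacency operator is block tridiagonal with respect to the levels.\<close>

lemma lev_adj:
  "lev (Suc i) (adj w) = lev (Suc i) (adj (lev i w)) + lev (Suc i) (adj (lev (Suc i) w))
    + lev (Suc i) (adj (lev (Suc (Suc i)) w))"
  "lev 0 (adj w) = lev 0 (adj (lev 0 w)) + lev 0 (adj (lev (Suc 0) w))"
proof -
  \<comment> \<open>\<open>S\<close> may reach past \<open>D\<close>, where levels are zero, so
    \<open>i = D\<close> is no special case.\<close>
  have *: "lev k (adj w) = (\<Sum>j\<in>S. lev k (adj (lev j w)))"
    if S: "finite S" "\<And>j. j \<notin> S \<Longrightarrow> Suc j < k \<or> Suc k < j" for k S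
  proof -
    have "lev k (\<Sum>j\<in>A. adj (lev j w)) = (\<Sum>j\<in>A. lev k (adj (lev j w)))" if "finite A" for A :: "nat set"
      using that by induction (simp_all add: lev_add)
    then have "lev k (adj w) = (\<Sum>j\<le>D. lev k (adj (lev j w)))" by (subst adj_lev) simp
    also have "\<dots> = (\<Sum>j\<in>{..D} \<union> S. lev k (adj (lev j w)))"
      using S(1) lev_gt_D by (intro sum.mono_neutral_left) auto
    also have "\<dots> = (\<Sum>j\<in>S. lev k (adj (lev j w)))"
      using S lev_adj_far by (intro sum.mono_neutral_right) auto
    finally show ?thesis .
  qed
  have "lev (Suc i) (adj w) = (\<Sum>j\<in>{i, Suc i, Suc (Suc i)}. lev (Suc i) (adj (lev j w)))"
    by (rule *) auto
  then show "lev (Suc i) (adj w) = lev (Suc i) (adj (lev i w)) + lev (Suc i) (adj (lev (Suc i) w))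
    + lev (Suc i) (adj (lev (Suc (Suc i)) w))" by (simp add: add.assoc)
  have "lev 0 (adj w) = (\<Sum>j\<in>{0, Suc 0}. lev 0 (adj (lev j w)))"
    by (rule *) auto
  then show "lev 0 (adj w) = lev 0 (adj (lev 0 w)) + lev 0 (adj (lev (Suc 0) w))" by simp
qed

lemma adj_bm: "adj (bm f v) = bm (Mop f) v"
proof -
  have "(\<Sum>w | (y, w) \<in> E. \<Sum>z\<in>UNIV. f (gdist E w z) *\<^sub>R v $ z)
      = (\<Sum>z\<in>UNIV. Mop f (gdist E y z) *\<^sub>R v $ z)" for y
    by (subst sum.swap) (simp add: scaleR_sum_left[symmetric] sum_nbr_dist)
  then show ?thesis by (simp add: vec_eq_iff adj_def bm_def)
qed

text \<open>Symmetry of the distance makes \<open>Mop\<close> describe multiplication by the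
  adjacency operator from either side; with \<open>adj_bm\<close> this is commutativity of the
  Bose-Mesner algebra.\<close>

lemma bm_adj: "bm f (adj v) = bm (Mop f) v"
proof -
  have "(\<Sum>z\<in>UNIV. f (gdist E y z) *\<^sub>R (\<Sum>w | (z, w) \<in> E. v $ w))
      = (\<Sum>w\<in>UNIV. Mop f (gdist E y w) *\<^sub>R v $ w)" for y
  proof -
    have "(\<Sum>z\<in>UNIV. f (gdist E y z) *\<^sub>R (\<Sum>w | (z, w) \<in> E. v $ w))
        = (\<Sum>z\<in>UNIV. \<Sum>w\<in>UNIV. if (z, w) \<in> E then f (gdist E y z) *\<^sub>R v $ w else 0)"
      by (simp add: scaleR_sum_right sum.If_cases)
    also have "\<dots> = (\<Sum>w\<in>UNIV. \<Sum>z | (w, z) \<in> E. f (gdist E z y) *\<^sub>R v $ w)"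
      by (subst sum.swap) (use edge_sym gdist_sym in \<open>auto simp: sum.If_cases intro!: sum.cong\<close>)
    also have "\<dots> = (\<Sum>w\<in>UNIV. Mop f (gdist E y w) *\<^sub>R v $ w)"
      by (simp add: scaleR_sum_left[symmetric] sum_nbr_dist gdist_sym[of y])
    finally show ?thesis .
  qed
  then show ?thesis by (simp add: vec_eq_iff adj_def bm_def)
qed

lemma bm_cong: "(\<And>i. i \<le> D \<Longrightarrow> f i = f' i) \<Longrightarrow> bm f v = bm f' v"
  using gdist_le_D by (simp add: vec_eq_iff bm_def)

lemma bm_fun_add: "bm (\<lambda>i. f i + f' i) v = bm f v + bm f' v"
  and bm_fun_diff: "bm (\<lambda>i. f i - f' i) v = bm f v - bm f' v"
  and bm_fun_const: "(\<Sum>z\<in>UNIV. v $ z) = 0 \<Longrightarrow> bm (\<lambda>i. r) v = 0"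
  by (simp_all add: vec_eq_iff bm_def sum.distrib sum_subtractf scaleR_sum_right
      scaleR_sum_right[symmetric] algebra_simps)

lemma bm_fun_scale: "bm (\<lambda>i. r * f i) v = r *\<^sub>R bm f v"
  by (simp add: vec_eq_iff bm_def scaleR_sum_right)

lemma act_0 [simp]: "act 0 v = v"
  by (simp add: vec_eq_iff bm_def if_distrib[of "\<lambda>t. t *\<^sub>R _"] cong: if_cong)

lemma act_1: "act (Suc 0) v = adj v"
proof -
  have "(\<Sum>z\<in>UNIV. (if gdist E y z = Suc 0 then 1 else 0) *\<^sub>R v $ z) = (\<Sum>w | (y, w) \<in> E. v $ w)" for y
    using gdist_edge[of y] by (simp add: if_distrib[of "\<lambda>t. t *\<^sub>R _"] sum.If_cases cong: if_cong)
  then show ?thesis by (simp add: vec_eq_iff bm_def adj_def)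
qed

text \<open>The three-term recurrence of the distance matrices, from which all relations between
  \<open>P\<close>, \<open>M\<close> and \<open>N\<close> below are projected.\<close>

lemma adj_act:
  "adj (act j v) = cc (Suc j) *\<^sub>R act (Suc j) v + aa j *\<^sub>R act j v
     + (if j = 0 then 0 else bb (j - 1) *\<^sub>R act (j - 1) v)"
proof -
  have "Mop (\<lambda>i. if i = j then 1 else 0) = (\<lambda>i. cc (Suc j) * (if i = Suc j then 1 else 0)
      + aa j * (if i = j then 1 else 0) + (if j = 0 then 0 else bb (j - 1)) * (if i = j - 1 then 1 else 0))"
  proof
    fix i show "Mop (\<lambda>i. if i = j then 1 else 0) i = cc (Suc j) * (if i = Suc j then 1 else 0)
      + aa j * (if i = j then 1 else 0) + (if j = 0 then 0 else bb (j - 1)) * (if i = j - 1 then 1 else 0)"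
      by (cases i; cases j) (auto simp: Mop_def)
  qed
  then show ?thesis unfolding adj_bm by (simp only:) (simp add: bm_fun_add bm_fun_scale)
qed

lemma act_gt_D: "D < j \<Longrightarrow> act j v = 0"
  using bm_cong[of "\<lambda>i. if i = j then 1 else 0" "\<lambda>i. 0" v] by (simp add: bm_def vec_eq_iff)

lemma bm_sum_act: "bm f v = (\<Sum>j\<le>D. f j *\<^sub>R act j v)"
proof -
  have "f (gdist E y z) *\<^sub>R v $ z
      = (\<Sum>j\<le>D. f j *\<^sub>R ((if gdist E y z = j then 1 else 0) *\<^sub>R v $ z))" for y z
  proof -
    have "(\<Sum>j\<le>D. f j *\<^sub>R ((if gdist E y z = j then 1 else 0) *\<^sub>R v $ z))
        = (\<Sum>j\<le>D. if j = gdist E y z then f j *\<^sub>R v $ z else 0)"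
      by (intro sum.cong) auto
    then show ?thesis using gdist_le_D by simp
  qed
  then show ?thesis
    by (simp add: vec_eq_iff bm_def scaleR_sum_right sum.swap[of _ "{..D}"] del: scaleR_scaleR)
qed

end

lemma sum_swap_pairs:
  "(\<Sum>a\<in>A. \<Sum>b\<in>B. \<Sum>c\<in>C. \<Sum>d\<in>D. f a b c d) = (\<Sum>c\<in>C. \<Sum>d\<in>D. \<Sum>a\<in>A. \<Sum>b\<in>B. f a b c d)"
proof -
  have *: "(\<Sum>b\<in>B. \<Sum>c\<in>C. \<Sum>d\<in>D. h b c d) = (\<Sum>c\<in>C. \<Sum>d\<in>D. \<Sum>b\<in>B. h b c d)" for h B
    by (subst sum.swap) (intro sum.cong refl sum.swap)
  show ?thesis by (simp only: *[of _ B]) (rule *)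
qed

section \<open>Positivity and the functions \<open>q^-i\<close> and \<open>q^-2i\<close>\<close>

context classical_drg
begin

lemma ex_nbr_closer:
  assumes "gdist E y z = Suc i"
  shows "\<exists>w. (y, w) \<in> E \<and> gdist E w z = i"
proof -
  obtain w where w: "(y, w) \<in> E" "(w, z) \<in> E ^^ i"
    using gdist_walk[of y z] assms by (metis relpow_Suc_D2)
  then have "gdist E w z = i" using gdist_le[OF w(2)] gdist_step[OF w(1), of z] assms by linarith
  then show ?thesis using w by blast
qed

text \<open>Since \<alpha> may be negative, signs are read off from actual pairs of vertices and
  then transferred to the factors of the closed forms.\<close>

lemma cc_pos: "1 \<le> i \<Longrightarrow> i \<le> D \<Longrightarrow> 0 < cc i"
proof -
  assume i: "1 \<le> i" "i \<le> D"
  then obtain k where k: "i = Suc k" by (cases i) auto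
  obtain y z where yz: "gdist E y z = Suc k" using ex_gdist[of i] i diam k by auto
  have "{w. (y, w) \<in> E \<and> gdist E w z = k} \<noteq> {}" using ex_nbr_closer[OF yz] by auto
  then have "0 < card {w. (y, w) \<in> E \<and> gdist E w z = k}" by (simp add: card_gt_0_iff)
  then show ?thesis using card_nbr_c[OF yz] k by (metis of_nat_0_less_iff)
qed

lemma bb_pos: "i < D \<Longrightarrow> 0 < bb i"
proof -
  assume i: "i < D"
  obtain y z where yz: "gdist E y z = Suc i" using ex_gdist[of "Suc i"] i diam by auto
  then obtain w where w: "(y, w) \<in> E" "gdist E w z = i" using ex_nbr_closer by blast
  then have "{u. (w, u) \<in> E \<and> gdist E u z = Suc i} \<noteq> {}" using yz edge_sym by auto
  then have "0 < card {u. (w, u) \<in> E \<and> gdist E u z = Suc i}" by (simp add: card_gt_0_iff)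
  then show ?thesis using card_nbr_b[OF w(2)] by (metis of_nat_0_less_iff)
qed

lemma aa_nonneg: "i \<le> D \<Longrightarrow> 0 \<le> aa i"
  using ex_gdist[of i] card_nbr_a diam by (metis of_nat_0_le_iff)

lemma g_strict: "i < j \<Longrightarrow> g i < g j"
  unfolding gauss_def using q2 by (intro sum_strict_mono2[of "{..<j}" "{..<i}" i]) auto

lemma bb_factor_pos: "i < D \<Longrightarrow> 0 < \<beta> - \<alpha> * g i"
  using bb_pos[of i] g_strict[of i D] by (simp add: bb_def zero_less_mult_iff)

lemma cc_factor_pos: "i < D \<Longrightarrow> 0 < 1 + \<alpha> * g i"
  using cc_pos[of "Suc i"] g_strict[of 0 "Suc i"] by (simp add: cc_def zero_less_mult_iff)

text \<open>Two of the eigenvalues \<open>b_i / q^i - [i]\<close> of a graph with classical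
  parameters.\<close>

definition th1 :: real where "th1 = bb 1 / q - 1"
definition th2 :: real where "th2 = bb 2 / q\<^sup>2 - g 2"

abbreviation u1 :: "nat \<Rightarrow> real" where "u1 i \<equiv> inverse q ^ i"
abbreviation u2 :: "nat \<Rightarrow> real" where "u2 i \<equiv> inverse q ^ (2 * i)"

text \<open>\<open>Mop\<close> is triangular on the span of \<open>1\<close>, \<open>u1\<close>,
  \<open>u2\<close>, with diagonal entries \<open>bb 0\<close>, \<open>th1\<close>,
  \<open>th2\<close>; this is the form in which the Q-polynomial property enters.\<close>

lemma Mop_u1: "Mop u1 i = th1 * u1 i + (bb 0 / q - th1)"
proof (cases i)
  case 0
  then show ?thesis using q2 by (simp add: Mop_def th1_def field_simps)
next
  case (Suc k)
  define \<gamma> where "\<gamma> = g k"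
  define X where "X = q ^ k"
  \<comment> \<open>Powers of \<open>q\<close> are traded for Gaussian numbers, so that only a
    polynomial identity remains.\<close>
  have X: "X = 1 + (q - 1) * \<gamma>" and X0: "X \<noteq> 0"
    using q2 by (simp_all add: X_def \<gamma>_def power_gauss[symmetric])
  define H where "H = g D"
  have c: "cc i = (1 + q * \<gamma>) * (1 + \<alpha> * \<gamma>)" and b: "bb i = (H - (1 + q * \<gamma>)) * (\<beta> - \<alpha> * (1 + q * \<gamma>))"
    and a: "aa i = H * \<beta> - bb i - cc i"
    by (simp_all add: Suc cc_def bb_def aa_def gauss_Suc_left \<gamma>_def H_def)
  have t: "q * th1 = (H - 1) * (\<beta> - \<alpha>) - q" using q2 by (simp add: th1_def bb_def H_def field_simps)
  have b0: "bb 0 = H * \<beta>" by (simp add: bb_def H_def)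
  have "q * (cc i * q\<^sup>2 + aa i * q + bb i) = q * (q * th1) + (q * (H * \<beta>) - q * (q * th1)) * q * X"
    unfolding t a b c X by algebra
  then have "cc i * q\<^sup>2 + aa i * q + bb i = q * th1 + (H * \<beta> / q - th1) * q\<^sup>2 * X"
    using q2 by (simp add: field_simps power2_eq_square)
  moreover have "c * (1 / X) + a * (1 / (q * X)) + b * (1 / (q\<^sup>2 * X)) = (c * q\<^sup>2 + a * q + b) / (q\<^sup>2 * X)"
    for a b c using q2 X0 by (simp add: field_simps power2_eq_square)
  moreover have "(q * c + r * q\<^sup>2 * X) / (q\<^sup>2 * X) = c * (1 / (q * X)) + r" for c r
    using q2 X0 by (simp add: field_simps power2_eq_square)
  moreover have "u1 k = 1 / X" "u1 i = 1 / (q * X)" "u1 (Suc i) = 1 / (q\<^sup>2 * X)"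
    by (simp_all add: Suc X_def inverse_eq_divide power_divide power2_eq_square)
  ultimately show ?thesis unfolding Mop_def b0 by (simp add: Suc)
qed

text \<open>The two lower coefficients come from matching powers of \<open>X\<close>; later only the
  shape of the right hand side matters.\<close>

lemma Mop_u2:
  "Mop u2 i = th2 * u2 i + (q + 1) * (q\<^sup>2 + \<beta> + \<alpha> * g D - \<alpha> * (q + 2)) / q\<^sup>2 * u1 i + \<alpha> * (q + 1) / q\<^sup>2"
proof -
  define H where "H = g D"
  define K where "K = (q + 1) * (q\<^sup>2 + \<beta> + \<alpha> * H - \<alpha> * (q + 2))"
  have t: "q\<^sup>2 * th2 = (H - 1 - q) * (\<beta> - \<alpha> * (1 + q)) - q\<^sup>2 * (1 + q)"
    using q2 by (simp add: th2_def bb_def H_def numeral_2_eq_2 gauss_Suc_left field_simps)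
  have "Mop u2 i = th2 * u2 i + K / q\<^sup>2 * u1 i + \<alpha> * (q + 1) / q\<^sup>2"
  proof (cases i)
    case 0
    have "H * \<beta> = q\<^sup>2 * th2 + K + \<alpha> * (q + 1)" unfolding t K_def by algebra
    then show ?thesis using 0 q2 by (simp add: Mop_def bb_def H_def field_simps power2_eq_square)
  next
    case (Suc k)
    define \<gamma> where "\<gamma> = g k"
    define X where "X = q ^ k"
    have X: "X = 1 + (q - 1) * \<gamma>" and X0: "X \<noteq> 0"
      using q2 by (simp_all add: X_def \<gamma>_def power_gauss[symmetric])
    have c: "cc i = (1 + q * \<gamma>) * (1 + \<alpha> * \<gamma>)" and b: "bb i = (H - (1 + q * \<gamma>)) * (\<beta> - \<alpha> * (1 + q * \<gamma>))"
      and a: "aa i = H * \<beta> - bb i - cc i"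
      by (simp_all add: Suc cc_def bb_def aa_def gauss_Suc_left \<gamma>_def H_def)
    have "cc i * q^4 + aa i * q\<^sup>2 + bb i = (q\<^sup>2 * th2) + K * q * X + \<alpha> * (q + 1) * q\<^sup>2 * X\<^sup>2"
      unfolding t a b c X K_def by algebra
    moreover have "c * (1 / X\<^sup>2) + a * (1 / (q\<^sup>2 * X\<^sup>2)) + b * (1 / (q^4 * X\<^sup>2))
        = (c * q^4 + a * q\<^sup>2 + b) / (q^4 * X\<^sup>2)"
      for a b c using q2 X0 by (simp add: field_simps)
    moreover have "(q\<^sup>2 * c + a * q * X + r * q\<^sup>2 * X\<^sup>2) / (q^4 * X\<^sup>2)
        = c * (1 / (q\<^sup>2 * X\<^sup>2)) + a / q\<^sup>2 * (1 / (q * X)) + r / q\<^sup>2" for a c r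
      using q2 X0 by (simp add: divide_simps power2_eq_square power4_eq_xxxx) (simp add: algebra_simps)
    moreover have "u2 k = 1 / X\<^sup>2" "u2 i = 1 / (q\<^sup>2 * X\<^sup>2)" "u2 (Suc i) = 1 / (q^4 * X\<^sup>2)" "u1 i = 1 / (q * X)"
      by (simp_all add: Suc X_def inverse_eq_divide power_divide power2_eq_square power4_eq_xxxx mult_2 power_add)
    ultimately show ?thesis unfolding Mop_def by (simp add: Suc)
  qed
  then show ?thesis by (simp add: K_def H_def)
qed

end

section \<open>The first eigenspace and a vanishing Krein parameter\<close>

context based_drg
begin

lemma sum_adj: "(\<Sum>z\<in>UNIV. adj v $ z) = bb 0 *\<^sub>R (\<Sum>z\<in>UNIV. v $ z)"
proof -
  have "(\<Sum>z\<in>UNIV. adj v $ z) = bm (\<lambda>_. 1) (adj v) $ x" by (simp add: bm_def)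
  also have "\<dots> = bm (\<lambda>i. bb 0) v $ x"
    unfolding bm_adj by (intro arg_cong[of _ _ "\<lambda>t. t $ x"] bm_cong) (simp add: Mop_def aa_def)
  finally show ?thesis by (simp add: bm_def scaleR_sum_right)
qed

lemma bm_u1_adj: "(\<Sum>z\<in>UNIV. v $ z) = 0 \<Longrightarrow> bm u1 (adj v) = th1 *\<^sub>R bm u1 v"
  unfolding bm_adj Mop_u1 by (simp add: bm_fun_add bm_fun_scale bm_fun_const)

lemma bm_u2_adj:
  assumes "(\<Sum>z\<in>UNIV. v $ z) = 0"
  obtains \<kappa> where "bm u2 (adj v) = th2 *\<^sub>R bm u2 v + \<kappa> *\<^sub>R bm u1 v"
  using that unfolding bm_adj Mop_u2
  by (simp only: bm_fun_add bm_fun_scale bm_fun_const[OF assms] add_0_right)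

text \<open>
  A multiple of the first primitive idempotent: \<open>\<omega>\<close> is proportional to the cosine sequence of
  the eigenvalue \<open>th1\<close>.
\<close>

definition \<omega> :: "nat \<Rightarrow> real" where "\<omega> i = (bb 0 - th1) * u1 i - (bb 0 / q - th1)"

text \<open>This keeps the coefficient of \<open>u1\<close> in \<omega> nonzero, so that \<omega> is
  not constant.\<close>

lemma bb_0_gt_th1: "th1 < bb 0"
proof -
  have "aa 1 = bb 0 - bb 1 - 1" by (simp add: aa_def)
  then have "bb 1 < bb 0" using aa_nonneg[of 1] D3 by simp
  moreover have "bb 1 / q \<le> bb 1 / 1" using bb_pos[of 1] D3 q2 by (intro divide_left_mono) auto
  ultimately show ?thesis unfolding th1_def by simp
qed

lemma Mop_\<omega>: "Mop \<omega> i = th1 * \<omega> i"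
proof -
  have "Mop \<omega> i = (bb 0 - th1) * Mop u1 i - bb 0 * (bb 0 / q - th1)"
    by (simp add: Mop_def \<omega>_def aa_def algebra_simps)
  then show ?thesis unfolding Mop_u1 by (simp add: \<omega>_def algebra_simps)
qed

lemma \<omega>_0: "\<omega> 0 \<noteq> 0"
  using bb_pos[of 0] D3 q2 by (simp add: \<omega>_def field_simps)

text \<open>The eigenvalue equation can be solved for the next value because \<open>bb k\<close> is
  nonzero below \<open>D\<close>, so the value at \<open>0\<close> determines the rest.\<close>

lemma Mop_eigen_unique:
  assumes "\<And>i. i \<le> D \<Longrightarrow> Mop f i = th1 * f i" "i \<le> D"
  shows "f i * \<omega> 0 = f 0 * \<omega> i"
  using assms(2)
proof (induction i rule: less_induct)
  case (less i)
  show ?case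
  proof (cases i)
    case (Suc k)
    then have IH: "f k * \<omega> 0 = f 0 * \<omega> k" "f (k - 1) * \<omega> 0 = f 0 * \<omega> (k - 1)" using less by auto
    have f: "bb k * f i = (th1 - aa k) * f k - cc k * f (k - 1)"
      using assms(1)[of k] less.prems Suc by (simp add: Mop_def algebra_simps)
    have w: "bb k * \<omega> i = (th1 - aa k) * \<omega> k - cc k * \<omega> (k - 1)"
      using Mop_\<omega>[of k] Suc by (simp add: Mop_def algebra_simps)
    have "bb k * (f i * \<omega> 0) = (th1 - aa k) * (f k * \<omega> 0) - cc k * (f (k - 1) * \<omega> 0)"
      unfolding mult.assoc[symmetric] f by (simp add: algebra_simps)
    also have "\<dots> = f 0 * (bb k * \<omega> i)" unfolding IH w by (simp add: algebra_simps)
    also have "\<dots> = bb k * (f 0 * \<omega> i)" by simp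
    finally show ?thesis using bb_pos[of k] less.prems Suc by simp
  qed simp
qed

text \<open>The matrix with entries \<omega> of the distance has a square that is again a function
  \<open>F\<close> of the distance, by distance-regularity. \<open>F\<close> satisfies the same
  eigenvalue equation, hence is proportional to \<omega>: up to scaling the matrix is
  idempotent.\<close>

lemma gram_\<omega>: "\<exists>\<kappa>. \<forall>z z'. (\<Sum>y\<in>UNIV. \<omega> (gdist E y z) * \<omega> (gdist E y z')) = \<kappa> * \<omega> (gdist E z z')"
proof -
  let ?G = "\<lambda>z z'. \<Sum>y\<in>UNIV. \<omega> (gdist E y z) * \<omega> (gdist E y z')"
  define F where "F h = (\<Sum>i\<le>D. \<Sum>j\<le>D. real (inter_num E h i j) * (\<omega> i * \<omega> j))" for h
  have G: "?G z z' = F (gdist E z z')" for z z'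
  proof -
    have "?G z z' = (\<Sum>y\<in>UNIV. \<Sum>i\<le>D. \<Sum>j\<le>D.
        if gdist E z y = i \<and> gdist E z' y = j then \<omega> i * \<omega> j else 0)"
    proof (intro sum.cong refl)
      fix y
      have "(\<Sum>i\<le>D. \<Sum>j\<le>D. if gdist E z y = i \<and> gdist E z' y = j then \<omega> i * \<omega> j else 0)
        = (\<Sum>i\<le>D. if gdist E z y = i then \<omega> i * \<omega> (gdist E z' y) else 0)"
        using gdist_le_D[of z' y] by (intro sum.cong) auto
      also have "\<dots> = \<omega> (gdist E z y) * \<omega> (gdist E z' y)" using gdist_le_D[of z y] by simp
      finally show "\<omega> (gdist E y z) * \<omega> (gdist E y z')
        = (\<Sum>i\<le>D. \<Sum>j\<le>D. if gdist E z y = i \<and> gdist E z' y = j then \<omega> i * \<omega> j else 0)"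
        by (simp add: gdist_sym[of y])
    qed
    also have "\<dots> = (\<Sum>i\<le>D. \<Sum>j\<le>D. \<Sum>y\<in>UNIV.
        if gdist E z y = i \<and> gdist E z' y = j then \<omega> i * \<omega> j else 0)"
      by (subst sum.swap) (intro sum.cong refl sum.swap)
    also have "\<dots> = F (gdist E z z')"
      unfolding F_def
      by (intro sum.cong refl)
         (use inter_num_eq[OF drg, of z z' "gdist E z z'"] gdist_le_D in \<open>simp add: sum.If_cases\<close>)
    finally show ?thesis .
  qed
  have "Mop F i = th1 * F i" if "i \<le> D" for i
  proof -
    obtain z z' where zz: "gdist E z z' = i" using ex_gdist \<open>i \<le> D\<close> diam by metis
    have "Mop F i = (\<Sum>w | (z, w) \<in> E. ?G w z')"
      unfolding zz[symmetric] sum_nbr_dist[symmetric] G ..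
    also have "\<dots> = (\<Sum>y\<in>UNIV. (\<Sum>w | (z, w) \<in> E. \<omega> (gdist E w y)) * \<omega> (gdist E y z'))"
      by (subst sum.swap) (simp add: sum_distrib_right gdist_sym)
    also have "\<dots> = th1 * ?G z z'"
      unfolding sum_nbr_dist Mop_\<omega> by (simp add: sum_distrib_left gdist_sym[of z] mult.assoc)
    finally show ?thesis unfolding G zz .
  qed
  from Mop_eigen_unique[OF this] have "F i = F 0 / \<omega> 0 * \<omega> i" if "i \<le> D" for i
    using that \<omega>_0 by (simp add: field_simps)
  then have "\<forall>z z'. ?G z z' = F 0 / \<omega> 0 * \<omega> (gdist E z z')" unfolding G using gdist_le_D by blast
  then show ?thesis by blast
qed

text \<open>
  The vanishing of Krein parameters: the hypothesis says that \<open>u\<close> is orthogonal to the first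
  eigenspaces, and the conclusion that the dual adjacency operator keeps it orthogonal to the
  eigenspace of \<open>th1\<close>. The squared norms of the left hand sides of the conclusion, summed over
  all pairs of vertices, give a multiple of the quadratic form of \<open>\<omega>\<^sup>2\<close> at \<open>u\<close>.
\<close>

lemma krein_vanishing:
  assumes "bm (\<lambda>i. \<omega> i * \<omega> i) u = 0"
  shows "(\<Sum>z\<in>UNIV. (\<omega> (gdist E y z) * \<omega> (gdist E y' z)) *\<^sub>R u $ z) = 0"
proof -
  obtain \<kappa> where \<kappa>: "\<And>z z'. (\<Sum>y\<in>UNIV. \<omega> (gdist E y z) * \<omega> (gdist E y z')) = \<kappa> * \<omega> (gdist E z z')"
    using gram_\<omega> by blast
  define t where "t y y' = (\<Sum>z\<in>UNIV. of_real (\<omega> (gdist E y z) * \<omega> (gdist E y' z)) * u $ z)" for y y'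
  have "t y y' * cnj (t y y') = (\<Sum>z\<in>UNIV. \<Sum>z'\<in>UNIV. of_real (\<omega> (gdist E y z) * \<omega> (gdist E y z'))
      * of_real (\<omega> (gdist E y' z) * \<omega> (gdist E y' z')) * (u $ z * cnj (u $ z')))" for y y'
    by (simp add: t_def sum_product mult_ac)
  then have "(\<Sum>y\<in>UNIV. \<Sum>y'\<in>UNIV. t y y' * cnj (t y y'))
      = (\<Sum>z\<in>UNIV. \<Sum>z'\<in>UNIV. \<Sum>y\<in>UNIV. \<Sum>y'\<in>UNIV. of_real (\<omega> (gdist E y z) * \<omega> (gdist E y z'))
      * of_real (\<omega> (gdist E y' z) * \<omega> (gdist E y' z')) * (u $ z * cnj (u $ z')))"
    by (simp only:) (rule sum_swap_pairs)
  \<comment> \<open>The sums over \<open>y\<close> and over \<open>y'\<close> separate, and each is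
    a Gram sum.\<close>
  also have "\<dots> = (\<Sum>z\<in>UNIV. \<Sum>z'\<in>UNIV. of_real (\<kappa> * \<omega> (gdist E z z')) * of_real (\<kappa> * \<omega> (gdist E z z'))
      * (u $ z * cnj (u $ z')))"
  proof -
    have "(\<Sum>y\<in>UNIV. \<Sum>y'\<in>UNIV. of_real (a y) * of_real (b y') * c)
        = of_real (sum a UNIV) * of_real (sum b UNIV) * c" for a b :: "'a \<Rightarrow> real" and c :: complex
      by (simp only: of_real_sum sum_product) (simp only: sum_distrib_right)
    then show ?thesis by (simp only: \<kappa>)
  qed
  also have "\<dots> = of_real (\<kappa>\<^sup>2) * (\<Sum>z'\<in>UNIV. cnj (u $ z') * (bm (\<lambda>i. \<omega> i * \<omega> i) u $ z'))"
  proof -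
    have "(\<Sum>z\<in>UNIV. of_real (\<kappa> * \<omega> (gdist E z z')) * of_real (\<kappa> * \<omega> (gdist E z z'))
        * (u $ z * cnj (u $ z'))) = of_real (\<kappa>\<^sup>2) * (cnj (u $ z') * (bm (\<lambda>i. \<omega> i * \<omega> i) u $ z'))" for z'
    proof -
      have "bm (\<lambda>i. \<omega> i * \<omega> i) u $ z'
          = (\<Sum>z\<in>UNIV. of_real (\<omega> (gdist E z z') * \<omega> (gdist E z z')) * u $ z)"
        by (simp only: bm_def vec_lambda_beta scaleR_conv_of_real gdist_sym[of z'])
      then show ?thesis
        by (simp only: sum_distrib_left) (rule sum.cong, simp_all add: power2_eq_square)
    qed
    then show ?thesis by (subst sum.swap) (simp only: sum_distrib_left)
  qed
  also have "\<dots> = 0" using assms by simp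
  finally have "complex_of_real (\<Sum>y\<in>UNIV. \<Sum>y'\<in>UNIV. (cmod (t y y'))\<^sup>2) = 0"
    by (simp only: of_real_sum complex_norm_square)
  then have "(\<Sum>y\<in>UNIV. \<Sum>y'\<in>UNIV. (cmod (t y y'))\<^sup>2) = 0" using of_real_eq_0_iff by blast
  then have "t y y' = 0" by (simp add: sum_nonneg_eq_0_iff sum_nonneg)
  then show ?thesis by (simp add: t_def scaleR_conv_of_real)
qed

end

section \<open>Local vectors\<close>

locale local_vector = based_drg E D q \<alpha> \<beta> x for E :: "('a::finite) rel" and D q \<alpha> \<beta> x +
  fixes v :: "complex^'a" and \<theta> :: real
  assumes lev_v: "lev (Suc 0) v = v" and sum_v: "(\<Sum>z\<in>UNIV. v $ z) = 0" and v_nonzero: "v \<noteq> 0"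
    and eigen: "lev (Suc 0) (adj v) = (\<theta> - 1) *\<^sub>R v"
begin

text \<open>By the triangle inequality these are the only parts of the vectors
  \<open>act j v\<close> that survive on level \<open>i\<close>.\<close>

definition P :: "nat \<Rightarrow> complex^'a" where "P i = lev i (act (i - 1) v)"
definition M :: "nat \<Rightarrow> complex^'a" where "M i = lev i (act (Suc i) v)"
definition N :: "nat \<Rightarrow> complex^'a" where "N i = lev i (act i v)"

lemma v_nth: "v $ y \<noteq> 0 \<Longrightarrow> gdist E x y = Suc 0"
  using lev_v by (metis lev_nth)

lemma lev_act_far: "Suc j < i \<or> Suc i < j \<Longrightarrow> lev i (act j v) = 0"
proof -
  assume far: "Suc j < i \<or> Suc i < j"
  have "act j v $ z = 0" if "gdist E x z = i" for z
  proof -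
    have "gdist E z y \<noteq> j" if "v $ y \<noteq> 0" for y
      using gdist_step[of x y z] v_nth[OF that] gdist_edge[of x y] gdist_sym[of y z]
        \<open>gdist E x z = i\<close> far by auto
    then have "(if gdist E z y = j then 1 else 0) *\<^sub>R v $ y = 0" for y
      by (cases "v $ y = 0") auto
    then show ?thesis unfolding bm_def vec_lambda_beta by (intro sum.neutral ballI)
  qed
  then show ?thesis by (simp add: vec_eq_iff)
qed

lemma lev_P: "lev i (P i) = P i" and lev_M: "lev i (M i) = M i"
  by (simp_all add: P_def M_def)

lemma P_1: "P (Suc 0) = v" by (simp add: P_def lev_v)

lemma N_0: "N 0 = 0"
  using lev_v by (simp add: N_def) (metis lev_lev zero_neq_one One_nat_def)

lemma M_0: "M 0 = 0"
proof -
  have "adj v $ x = (\<Sum>w\<in>UNIV. v $ w)"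
    unfolding adj_def using v_nth gdist_edge[of x]
    by (simp, intro sum.mono_neutral_left) auto
  then show ?thesis using sum_v by (simp add: M_def act_1 vec_eq_iff)
qed

text \<open>A vertex in the support of \<open>v\<close> is adjacent to \<open>x\<close>, so its
  distance to a vertex of level \<open>Suc i\<close> takes one of three values; together they
  collect the total sum of \<open>v\<close>. Hence \<open>N\<close> can always be
  eliminated.\<close>

lemma P_N_M: "P (Suc i) + N (Suc i) + M (Suc i) = 0"
proof -
  have "act i v $ z + act (Suc i) v $ z + act (Suc (Suc i)) v $ z = 0" if "gdist E x z = Suc i" for z
  proof -
    have "((if gdist E z y = i then 1 else 0) + (if gdist E z y = Suc i then 1 else 0)
        + (if gdist E z y = Suc (Suc i) then 1 else 0)) *\<^sub>R v $ y = v $ y" for y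
    proof (cases "v $ y = 0")
      case False
      have "(x, y) \<in> E" using v_nth[OF False] gdist_edge[of x y] by simp
      then show ?thesis
        using nbr_dist_cases[of x y z] \<open>gdist E x z = Suc i\<close> gdist_sym[of y z] by auto
    qed simp
    then have "(\<Sum>y\<in>UNIV. ((if gdist E z y = i then 1 else 0) + (if gdist E z y = Suc i then 1 else 0)
        + (if gdist E z y = Suc (Suc i) then 1 else 0)) *\<^sub>R v $ y) = 0" using sum_v by simp
    then show ?thesis by (simp add: bm_def sum.distrib scaleR_add_left)
  qed
  then show ?thesis by (auto simp: P_def N_def M_def vec_eq_iff)
qed

text \<open>On its outermost level the recurrence \<open>adj_act\<close> leaves a single term on
  each side. The same happens on the innermost level for \<open>L_M\<close>.\<close>

lemma R_P: "lev (Suc i) (adj (P i)) = cc i *\<^sub>R P (Suc i)" if "1 \<le> i"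
proof -
  obtain k where i: "i = Suc k" using \<open>1 \<le> i\<close> by (cases i) auto
  have "lev (Suc i) (adj (act k v)) = lev (Suc i) (adj (P i))"
    using lev_adj(1)[of i "act k v"] by (simp add: P_def i lev_act_far)
  moreover have "lev (Suc i) (adj (act k v)) = cc i *\<^sub>R P (Suc i)"
    unfolding adj_act by (simp add: i op_linear lev_act_far P_def)
  ultimately show ?thesis by simp
qed

lemma L_M: "lev i (adj (M (Suc i))) = bb (Suc i) *\<^sub>R M i"
proof -
  have "lev i (adj (act (Suc (Suc i)) v)) = lev i (adj (M (Suc i)))"
    by (cases i) (simp_all add: lev_adj(1)[of _ "act _ v"] lev_adj(2)[of "act _ v"] M_def lev_act_far)
  moreover have "lev i (adj (act (Suc (Suc i)) v)) = bb (Suc i) *\<^sub>R M i"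
    unfolding adj_act by (simp add: op_linear lev_act_far M_def)
  ultimately show ?thesis by simp
qed

text \<open>The recurrence at the inner levels, with \<open>N\<close> eliminated. It does not close
  up by itself: here the raising of \<open>M i\<close> remains, and in \<open>F_M\<close> the
  lowering of the next \<open>P\<close>.\<close>

lemma F_P: "lev (Suc i) (adj (P (Suc i))) = (aa i - cc (Suc i) + cc i) *\<^sub>R P (Suc i)
    - cc (Suc i) *\<^sub>R M (Suc i) + lev (Suc i) (adj (M i))"
proof -
  have "lev (Suc i) (adj (act i v)) = lev (Suc i) (adj (N i)) + lev (Suc i) (adj (P (Suc i)))"
    using lev_adj(1)[of i "act i v"] by (simp add: P_def N_def lev_act_far)
  moreover have "lev (Suc i) (adj (act i v)) = cc (Suc i) *\<^sub>R N (Suc i) + aa i *\<^sub>R P (Suc i)"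
    unfolding adj_act by (cases i) (simp_all add: op_linear lev_act_far N_def P_def)
  moreover have "lev (Suc i) (adj (N i)) = - cc i *\<^sub>R P (Suc i) - lev (Suc i) (adj (M i))"
  proof (cases i)
    case (Suc k)
    then have "N i = - P i - M i" using P_N_M[of k] by (simp add: algebra_simps eq_neg_iff_add_eq_0)
    then show ?thesis using R_P[of i] Suc by (simp add: op_linear)
  qed (simp add: N_0 M_0)
  moreover have "N (Suc i) = - P (Suc i) - M (Suc i)"
    using P_N_M[of i] by (simp add: algebra_simps eq_neg_iff_add_eq_0)
  ultimately show ?thesis by (simp add: algebra_simps)
qed

lemma F_M: "lev (Suc i) (adj (M (Suc i))) = (aa (Suc (Suc i)) - bb (Suc i) + bb (Suc (Suc i))) *\<^sub>R M (Suc i)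
    - bb (Suc i) *\<^sub>R P (Suc i) + lev (Suc i) (adj (P (Suc (Suc i))))"
proof -
  have N: "N (Suc k) = - P (Suc k) - M (Suc k)" for k
    using P_N_M[of k] by (simp add: algebra_simps eq_neg_iff_add_eq_0)
  have "lev (Suc i) (adj (act (Suc (Suc i)) v))
      = lev (Suc i) (adj (M (Suc i))) + lev (Suc i) (adj (N (Suc (Suc i))))"
    using lev_adj(1)[of i "act (Suc (Suc i)) v"] by (simp add: M_def N_def lev_act_far)
  moreover have "lev (Suc i) (adj (act (Suc (Suc i)) v))
      = aa (Suc (Suc i)) *\<^sub>R M (Suc i) + bb (Suc i) *\<^sub>R N (Suc i)"
    unfolding adj_act by (simp add: op_linear lev_act_far N_def M_def)
  ultimately show ?thesis unfolding N by (simp add: op_linear L_M algebra_simps)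
qed

lemma M_1: "M (Suc 0) = - \<theta> *\<^sub>R v"
proof -
  have "N (Suc 0) = (\<theta> - 1) *\<^sub>R v" using eigen by (simp add: N_def act_1)
  then show ?thesis using P_N_M[of 0] P_1 by (simp add: algebra_simps eq_neg_iff_add_eq_0)
qed

text \<open>If \<open>M\<close> is a multiple of \<open>P\<close> on one level, then
  \<open>F_P\<close> gives the flat action, and comparing it with \<open>F_M\<close> gives the
  lowering of the next \<open>P\<close>.\<close>

lemma thin_step:
  assumes "M (Suc k) = r *\<^sub>R P (Suc k)" "lev (Suc k) (adj (M k)) = (cc k * s) *\<^sub>R P (Suc k)"
  shows "lev (Suc k) (adj (P (Suc k))) = (aa k - cc (Suc k) + cc k - cc (Suc k) * r + cc k * s) *\<^sub>R P (Suc k)"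
    and "lev (Suc k) (adj (P (Suc (Suc k)))) = (r * (aa k - cc (Suc k) + cc k - cc (Suc k) * r + cc k * s)
       - (aa (Suc (Suc k)) - bb (Suc k) + bb (Suc (Suc k))) * r + bb (Suc k)) *\<^sub>R P (Suc k)"
proof -
  show F: "lev (Suc k) (adj (P (Suc k))) = (aa k - cc (Suc k) + cc k - cc (Suc k) * r + cc k * s) *\<^sub>R P (Suc k)"
    using F_P[of k] assms by (simp add: algebra_simps)
  show "lev (Suc k) (adj (P (Suc (Suc k)))) = (r * (aa k - cc (Suc k) + cc k - cc (Suc k) * r + cc k * s)
       - (aa (Suc (Suc k)) - bb (Suc k) + bb (Suc (Suc k))) * r + bb (Suc k)) *\<^sub>R P (Suc k)"
    using F_M[of k] F unfolding assms(1) by (simp add: op_linear algebra_simps)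
qed

definition l2 :: real where "l2 = bb 1 + \<theta> * (bb 0 - bb 1 + 1 - cc 2) - \<theta>\<^sup>2"

text \<open>On level one the hypotheses of \<open>thin_step\<close> hold by \<open>M_1\<close> and
  \<open>M_0\<close>, so this scalar is known before thinness is used.\<close>

lemma L_P_2: "lev (Suc 0) (adj (P 2)) = l2 *\<^sub>R v"
proof -
  have "lev (Suc 0) (adj (P (Suc (Suc 0)))) = (- \<theta> * (aa 0 - cc (Suc 0) + cc 0 - cc (Suc 0) * (- \<theta>) + cc 0 * 0)
       - (aa (Suc (Suc 0)) - bb (Suc 0) + bb (Suc (Suc 0))) * (- \<theta>) + bb (Suc 0)) *\<^sub>R P (Suc 0)"
    by (rule thin_step) (simp_all add: M_1 P_1 M_0)
  also have "- \<theta> * (aa 0 - cc (Suc 0) + cc 0 - cc (Suc 0) * (- \<theta>) + cc 0 * 0)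
       - (aa (Suc (Suc 0)) - bb (Suc 0) + bb (Suc (Suc 0))) * (- \<theta>) + bb (Suc 0) = l2"
    by (simp add: l2_def aa_def numeral_2_eq_2 algebra_simps power2_eq_square)
  finally show ?thesis by (simp add: P_1 numeral_2_eq_2)
qed

lemma adj_level: "lev i w = w \<Longrightarrow> 1 \<le> i \<Longrightarrow> adj w = lev (i - 1) (adj w) + lev i (adj w) + lev (Suc i) (adj w)"
proof -
  assume w: "lev i w = w" and i: "1 \<le> i"
  have "adj w $ z = 0" if "gdist E x z \<noteq> i - 1" "gdist E x z \<noteq> i" "gdist E x z \<noteq> Suc i" for z
  proof -
    have "lev (gdist E x z) (adj (lev i w)) = 0"
      using that i by (intro lev_adj_far) linarith
    then have "lev (gdist E x z) (adj w) $ z = 0" using w by simp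
    then show ?thesis by simp
  qed
  then show ?thesis using i by (auto simp: vec_eq_iff)
qed

lemma adj_v: "adj v = (\<theta> - 1) *\<^sub>R v + P 2"
proof -
  have "lev 0 (adj v) = 0" using M_0 by (simp add: M_def act_1)
  moreover have "lev 2 (adj v) = P 2" by (simp add: P_def numeral_2_eq_2 act_1)
  ultimately show ?thesis using adj_level[OF lev_v] eigen by (simp add: numeral_2_eq_2)
qed

lemma bm_\<omega>_adj: "bm \<omega> (adj w) = th1 *\<^sub>R bm \<omega> w"
  unfolding bm_adj Mop_\<omega> by (rule bm_fun_scale)

text \<open>The level-one part of \<open>bm \<omega> v\<close> involves only the distances 0, 1, 2
  and is a multiple of \<open>v\<close>, with a factor linear in \<theta>.\<close>

lemma eigenvalue_of_null:
  assumes "bm \<omega> v = 0"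
  shows "\<theta> = - q"
proof -
  have "lev (Suc 0) (bm \<omega> v) = (\<Sum>j\<le>D. \<omega> j *\<^sub>R lev (Suc 0) (act j v))"
  proof -
    have "lev i (\<Sum>j\<in>S. \<omega> j *\<^sub>R act j v) = (\<Sum>j\<in>S. \<omega> j *\<^sub>R lev i (act j v))" if "finite S" for i S
      using that by induction (simp_all add: op_linear)
    then show ?thesis unfolding bm_sum_act[of \<omega>] by simp
  qed
  also have "\<dots> = (\<Sum>j\<in>{0, Suc 0, Suc (Suc 0)}. \<omega> j *\<^sub>R lev (Suc 0) (act j v))"
    using D3 by (intro sum.mono_neutral_right) (auto simp: lev_act_far)
  also have "\<dots> = \<omega> 0 *\<^sub>R v + \<omega> (Suc 0) *\<^sub>R (\<theta> - 1) *\<^sub>R v + \<omega> (Suc (Suc 0)) *\<^sub>R (- \<theta> *\<^sub>R v)"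
    using M_1 eigen by (simp add: lev_v act_1 M_def)
  also have "\<dots> = (\<omega> 0 - \<omega> (Suc 0) + \<theta> * (\<omega> (Suc 0) - \<omega> (Suc (Suc 0)))) *\<^sub>R v"
    by (simp add: algebra_simps)
  finally have "\<omega> 0 - \<omega> (Suc 0) + \<theta> * (\<omega> (Suc 0) - \<omega> (Suc (Suc 0))) = 0"
    using assms v_nonzero by simp
  \<comment> \<open>Consecutive differences of \<omega> are geometric with ratio
    \<open>1 / q\<close>, which places the root at \<open>- q\<close>.\<close>
  moreover have "\<omega> 0 - \<omega> (Suc 0) = (bb 0 - th1) * (1 - 1 / q)"
      "\<omega> (Suc 0) - \<omega> (Suc (Suc 0)) = (bb 0 - th1) * (1 - 1 / q) / q"
    using q2 by (simp_all add: \<omega>_def field_simps)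
  moreover have "a * (1 + \<theta> / q) = a + \<theta> * (a / q)" for a by (simp add: algebra_simps)
  ultimately have "(bb 0 - th1) * (1 - 1 / q) * (1 + \<theta> / q) = 0" by simp
  moreover have "1 - 1 / q \<noteq> 0" using q2 by simp
  ultimately have "1 + \<theta> / q = 0" using bb_0_gt_th1 q2 by auto
  then show ?thesis using q2 by (simp add: field_simps)
qed

text \<open>The factors \<open>adj - th1\<close> and \<open>adj - th2\<close> remove from
  \<open>v\<close> whatever \<open>u1\<close> and \<open>u2\<close> can see, and constants vanish on
  zero-sum vectors. As \<open>\<omega> * \<omega>\<close> lies in the span of these functions,
  \<open>krein_vanishing\<close> applies with \<open>x\<close> as one of its two vertices.\<close>

lemma krein_v:
  defines "u \<equiv> adj (adj v) - (th1 + th2) *\<^sub>R adj v + (th1 * th2) *\<^sub>R v"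
  shows "bm \<omega> (\<chi> z. \<omega> (gdist E x z) *\<^sub>R u $ z) = 0"
proof -
  define w where "w = adj v - th1 *\<^sub>R v"
  have u: "u = adj w - th2 *\<^sub>R w"
    by (simp add: u_def w_def op_linear scaleR_add_left scaleR_diff_right mult.commute)
  have sw: "(\<Sum>z\<in>UNIV. w $ z) = 0"
    using sum_v by (simp add: w_def sum_subtractf sum_adj scaleR_sum_right[symmetric])
  have su: "(\<Sum>z\<in>UNIV. u $ z) = 0"
    using sw by (simp add: u sum_subtractf sum_adj scaleR_sum_right[symmetric])
  have w0: "bm u1 w = 0" using bm_u1_adj[OF sum_v] by (simp add: w_def op_linear)
  have "bm u1 u = 0" using bm_u1_adj[OF sw] w0 by (simp add: u op_linear)
  moreover obtain \<kappa> where "bm u2 (adj w) = th2 *\<^sub>R bm u2 w + \<kappa> *\<^sub>R bm u1 w"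
    using bm_u2_adj[OF sw] .
  then have "bm u2 u = 0" by (simp add: u op_linear w0)
  moreover have "\<omega> i * \<omega> i = (bb 0 - th1)\<^sup>2 * u2 i + (- 2 * (bb 0 - th1) * (bb 0 / q - th1)) * u1 i
      + (bb 0 / q - th1)\<^sup>2" for i
  proof -
    have "(a * t - c) * (a * t - c) = a\<^sup>2 * (t * t) + (- 2 * a * c) * t + c\<^sup>2" for a c t :: real
      by (simp add: power2_eq_square algebra_simps)
    moreover have "u2 i = u1 i * u1 i" by (simp only: mult_2 power_add)
    ultimately show ?thesis unfolding \<omega>_def by (simp only:)
  qed
  ultimately have "bm (\<lambda>i. \<omega> i * \<omega> i) u = 0"
    by (simp only: bm_fun_add bm_fun_scale bm_fun_const[OF su]) simp
  from krein_vanishing[OF this, of _ x] show ?thesis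
    by (simp add: bm_def vec_eq_iff)
qed

end

section \<open>The equation for the local eigenvalues\<close>

lemma scaleR_eq_smult: "r *\<^sub>R v = complex_of_real r *s v"
  by (simp add: vec_eq_iff flip: scaleR_conv_of_real)

text \<open>With \<open>w = (h - 1 - q) / q^2\<close> and
  \<open>z = \<beta> - \<alpha> (1 + q)\<close> as coordinates, \<open>b1\<close>,
  \<open>b2\<close>, \<open>t1\<close>, \<open>t2\<close> become polynomials. The factor
  \<open>l\<close> clears the denominator of \<phi>.\<close>

lemma terwilliger_cubic:
  fixes q w z \<alpha> \<theta> :: real
  defines "b \<equiv> z + \<alpha> * q"
  defines "h \<equiv> 1 + q + q\<^sup>2 * w"
  defines "t1 \<equiv> (1 + q * w) * b - 1" and "t2 \<equiv> w * z - 1 - q"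
  defines "b1 \<equiv> q * (1 + q * w) * b" and "b2 \<equiv> q\<^sup>2 * w * z" and "c2 \<equiv> (1 + q) * (1 + \<alpha>)"
  defines "a1 \<equiv> b + \<alpha> * h - 1"
  defines "l \<equiv> b1 + \<theta> * (a1 + 2 - c2) - \<theta>\<^sup>2"
  defines "e \<equiv> t1 + 1 - \<theta>"
  assumes \<phi>: "l * \<phi> = (a1 - c2 + 1 - \<theta>) * l + c2 * b2 * \<theta>"
  shows "l * (q\<^sup>2 * ((\<theta> - 1)\<^sup>2 + l - (t1 + t2) * (\<theta> - 1) + t1 * t2)
      + q * ((\<theta> - 1 + \<phi> - (t1 + t2)) * e) + ((t1 - \<phi>) * e - l))
    = (q\<^sup>2 - 1) * q * w * z * \<theta> * (\<theta> - \<alpha> * (h - 1)) * (\<theta> - b)"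
proof -
  \<comment> \<open>Collecting \<phi> leaves it only in the product \<open>l * \<phi>\<close>, which
    the hypothesis replaces.\<close>
  have "l * (q\<^sup>2 * ((\<theta> - 1)\<^sup>2 + l - (t1 + t2) * (\<theta> - 1) + t1 * t2)
      + q * ((\<theta> - 1 + \<phi> - (t1 + t2)) * e) + ((t1 - \<phi>) * e - l))
    = l * (q\<^sup>2 * ((\<theta> - 1)\<^sup>2 + l - (t1 + t2) * (\<theta> - 1) + t1 * t2)
      + q * ((\<theta> - 1 - (t1 + t2)) * e) + (t1 * e - l)) + (q - 1) * e * (l * \<phi>)"
    by algebra
  also have "\<dots> = (q\<^sup>2 - 1) * q * w * z * \<theta> * (\<theta> - \<alpha> * (h - 1)) * (\<theta> - b)"
    unfolding \<phi> unfolding l_def e_def a1_def c2_def b1_def b2_def t1_def t2_def h_def b_def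
    by algebra
  finally show ?thesis .
qed

context local_vector
begin

text \<open>Away from \<open>- q\<close> the vector \<open>V\<close> is nonzero. Since
  \<open>bm \<omega>\<close> turns \<open>adj\<close> into the scalar \<open>th1\<close>, the images
  of \<open>P 2\<close> and \<open>P 3\<close> are multiples of \<open>V\<close>, and
  \<open>krein_v\<close> becomes one scalar equation; \<open>l2\<close> times its left hand side is
  the cubic.\<close>

lemma local_eigenvalue:
  assumes thin2: "P 2 \<noteq> 0 \<Longrightarrow> \<exists>\<mu>. M 2 = \<mu> *s P 2"
  shows "\<theta> = 0 \<or> \<theta> = \<alpha> * (g D - 1) \<or> \<theta> = \<beta> - \<alpha> \<or> \<theta> = - q"
proof (rule ccontr)
  assume contr: "\<not> ?thesis"
  define V where "V = bm \<omega> v"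
  have V: "V \<noteq> 0" using eigenvalue_of_null contr by (auto simp: V_def)
  define w where "w = (g D - 1 - q) / q\<^sup>2"
  define z where "z = \<beta> - \<alpha> * (1 + q)"
  define b where "b = z + \<alpha> * q"
  have g2: "g 2 = 1 + q" by (simp add: numeral_2_eq_2 gauss_Suc_left)
  have h: "g D = 1 + q + q\<^sup>2 * w" using q2 by (simp add: w_def)
  have b: "\<beta> - \<alpha> = b" by (simp add: b_def z_def algebra_simps)
  have bb2: "bb 2 = q\<^sup>2 * w * z" using h by (simp add: bb_def g2 z_def)
  have "bb 1 = (g D - 1) * (\<beta> - \<alpha>)" by (simp add: bb_def)
  then have bb1: "bb 1 = q * (1 + q * w) * b" unfolding b h by (simp add: power2_eq_square algebra_simps)
  have cc2: "cc 2 = (1 + q) * (1 + \<alpha>)" by (simp add: cc_def g2)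
  have t1: "th1 = (1 + q * w) * b - 1" using q2 unfolding th1_def bb1 by simp
  have t2: "th2 = w * z - 1 - q" using q2 unfolding th2_def bb2 g2 by simp
  have "aa 1 = (\<beta> - \<alpha>) + \<alpha> * g D - 1" by (simp add: aa_def bb_def algebra_simps)
  then have a1: "aa 1 = b + \<alpha> * g D - 1" unfolding b .
  have l2: "l2 = bb 1 + \<theta> * (aa 1 + 2 - cc 2) - \<theta>\<^sup>2" by (simp add: l2_def aa_def)
  have wz: "0 < w * z" using bb_pos[of 2] D3 q2 by (simp add: bb2 mult.assoc zero_less_mult_iff)
  have BP2: "bm \<omega> (P 2) = (th1 + 1 - \<theta>) *\<^sub>R V"
    using bm_\<omega>_adj[of v] unfolding adj_v V_def[symmetric] by (simp add: op_linear V_def algebra_simps)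
  \<comment> \<open>Otherwise \<open>\<theta> = th1 + 1\<close> would also be a zero of
    \<open>l2\<close>, which the signs of the parameters forbid.\<close>
  have P2: "P 2 \<noteq> 0"
  proof
    assume P2: "P 2 = 0"
    then have eqs: "\<theta> = th1 + 1" "l2 = 0" using BP2 L_P_2 V v_nonzero by simp_all
    have "bb 1 + \<theta> * (aa 1 + 2 - cc 2) - \<theta>\<^sup>2 = 0" using eqs(2) unfolding l2 .
    moreover have "\<theta> = (1 + q * w) * b" using eqs(1) unfolding t1 by simp
    ultimately have "(1 + q * w) * b * (q * (w * z)) = 0"
      unfolding bb1 a1 cc2 h b_def by algebra
    moreover have "(1 + q * w) * b \<noteq> 0" using bb_pos[of 1] D3 unfolding bb1 by auto
    ultimately show False using wz q2 by auto
  qed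
  then obtain \<mu> where \<mu>: "M 2 = \<mu> *s P 2" using thin2 by blast
  \<comment> \<open>Lowering \<open>M 2\<close> both by \<open>L_M\<close> and through
    \<open>P 2\<close> fixes the multiple; it follows that \<open>l2\<close> is nonzero and the
    multiple is real.\<close>
  have "lev (Suc 0) (adj (M 2)) = bb 2 *\<^sub>R M (Suc 0)" using L_M[of "Suc 0"] by (simp add: numeral_2_eq_2)
  then have "(\<mu> * of_real l2) *s v = of_real (- bb 2 * \<theta>) *s v"
    unfolding \<mu> adj_smult lev_smult L_P_2 M_1
    by (simp add: scaleR_eq_smult vector_smult_assoc)
  then have \<mu>l: "\<mu> * of_real l2 = of_real (- bb 2 * \<theta>)"
    using v_nonzero vector_mul_rcancel by blast
  have l2_nz: "l2 \<noteq> 0"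
  proof
    assume "l2 = 0"
    then have "bb 2 * \<theta> = 0" using \<mu>l by simp
    then show False using contr bb_pos[of 2] D3 by simp
  qed
  define m where "m = - bb 2 * \<theta> / l2"
  have "\<mu> = of_real m" using \<mu>l l2_nz by (simp add: m_def field_simps)
  then have M2: "M 2 = m *\<^sub>R P 2" unfolding \<mu> by (simp add: scaleR_eq_smult)
  define \<phi> where "\<phi> = aa 1 - cc 2 + 1 - cc 2 * m - \<theta>"
  have FP2: "lev 2 (adj (P 2)) = \<phi> *\<^sub>R P 2"
  proof -
    have "lev (Suc (Suc 0)) (adj (M (Suc 0))) = - \<theta> *\<^sub>R P 2"
      using R_P[of "Suc 0"] by (simp add: M_1 P_1 op_linear numeral_2_eq_2)
    then have "lev (Suc (Suc 0)) (adj (P (Suc (Suc 0)))) = (aa (Suc 0) - cc (Suc (Suc 0)) + cc (Suc 0)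
        - cc (Suc (Suc 0)) * m + cc (Suc 0) * (- \<theta>)) *\<^sub>R P (Suc (Suc 0))"
      using M2 by (intro thin_step(1)) (simp_all add: numeral_2_eq_2)
    then show ?thesis by (simp add: \<phi>_def numeral_2_eq_2)
  qed
  have \<phi>: "l2 * \<phi> = (aa 1 - cc 2 + 1 - \<theta>) * l2 + cc 2 * bb 2 * \<theta>"
    using l2_nz by (simp add: \<phi>_def m_def field_simps)
  have adj_P2: "adj (P 2) = l2 *\<^sub>R v + \<phi> *\<^sub>R P 2 + cc 2 *\<^sub>R P 3"
    using adj_level[of 2 "P 2"] lev_P[of 2] L_P_2 FP2 R_P[of 2]
    by (simp add: numeral_2_eq_2 numeral_3_eq_3)
  have BP3: "cc 2 *\<^sub>R bm \<omega> (P 3) = ((th1 - \<phi>) * (th1 + 1 - \<theta>) - l2) *\<^sub>R V"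
    using bm_\<omega>_adj[of "P 2"] unfolding adj_P2
    by (simp add: op_linear BP2 V_def[symmetric] algebra_simps)
  define U1 where "U1 = (\<theta> - 1)\<^sup>2 + l2 - (th1 + th2) * (\<theta> - 1) + th1 * th2"
  define U2 where "U2 = \<theta> - 1 + \<phi> - (th1 + th2)"
  define u where "u = adj (adj v) - (th1 + th2) *\<^sub>R adj v + (th1 * th2) *\<^sub>R v"
  have u: "u = U1 *\<^sub>R v + U2 *\<^sub>R P 2 + cc 2 *\<^sub>R P 3"
  proof -
    have "(t *\<^sub>R (t *\<^sub>R a + b) + (l *\<^sub>R a + f *\<^sub>R b + c)) - s *\<^sub>R (t *\<^sub>R a + b) + p *\<^sub>R a
        = (t\<^sup>2 + l - s * t + p) *\<^sub>R a + (t + f - s) *\<^sub>R b + c"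
      for t l f s p :: real and a b c :: "complex^'a"
      by (simp add: algebra_simps power2_eq_square)
    then show ?thesis unfolding u_def adj_v adj_add adj_scaleR adj_P2 U1_def U2_def by (simp only:)
  qed
  \<comment> \<open>The dual adjacency operator acts on level \<open>i\<close> as the scalar
    \<open>\<omega> i\<close>.\<close>
  have *: "(\<chi> z. \<omega> (gdist E x z) *\<^sub>R (r *\<^sub>R y) $ z) = (\<omega> i * r) *\<^sub>R y" if "lev i y = y" for i r y
  proof -
    have "y $ z = 0" if "gdist E x z \<noteq> i" for z using \<open>lev i y = y\<close> that by (metis lev_nth)
    then have "\<omega> (gdist E x z) *\<^sub>R (r *\<^sub>R y) $ z = ((\<omega> i * r) *\<^sub>R y) $ z" for z
      by (cases "gdist E x z = i") simp_all
    then show ?thesis by (simp only: vec_eq_iff vec_lambda_beta) simp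
  qed
  have "(\<chi> z. \<omega> (gdist E x z) *\<^sub>R u $ z)
      = (\<omega> 1 * U1) *\<^sub>R v + (\<omega> 2 * U2) *\<^sub>R P 2 + (\<omega> 3 * cc 2) *\<^sub>R P 3"
  proof -
    have "(\<chi> z. f z *\<^sub>R (a + b + c) $ z) = (\<chi> z. f z *\<^sub>R a $ z) + (\<chi> z. f z *\<^sub>R b $ z) + (\<chi> z. f z *\<^sub>R c $ z)"
      for f and a b c :: "complex^'a" by (simp add: vec_eq_iff scaleR_add_right)
    then show ?thesis
      unfolding u using *[OF lev_v, of U1] *[OF lev_P[of 2], of U2] *[OF lev_P[of 3], of "cc 2"]
      by (simp only: One_nat_def)
  qed
  then have "bm \<omega> ((\<omega> 1 * U1) *\<^sub>R v + (\<omega> 2 * U2) *\<^sub>R P 2 + (\<omega> 3 * cc 2) *\<^sub>R P 3) = 0"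
    using krein_v by (simp add: u_def)
  then have "(\<omega> 1 * U1) *\<^sub>R V + (\<omega> 2 * U2) *\<^sub>R bm \<omega> (P 2) + \<omega> 3 *\<^sub>R (cc 2 *\<^sub>R bm \<omega> (P 3)) = 0"
    by (simp add: op_linear V_def)
  then have "(\<omega> 1 * U1 + \<omega> 2 * (U2 * (th1 + 1 - \<theta>)) + \<omega> 3 * ((th1 - \<phi>) * (th1 + 1 - \<theta>) - l2)) *\<^sub>R V = 0"
    unfolding BP2 BP3 by (simp add: algebra_simps)
  then have eq: "\<omega> 1 * U1 + \<omega> 2 * (U2 * (th1 + 1 - \<theta>)) + \<omega> 3 * ((th1 - \<phi>) * (th1 + 1 - \<theta>) - l2) = 0"
    using V by simp
  \<comment> \<open>The three coefficients add up to zero, so the constant part of \<omega> drops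
    out and only its geometric part counts.\<close>
  have tot: "U1 + U2 * (th1 + 1 - \<theta>) + ((th1 - \<phi>) * (th1 + 1 - \<theta>) - l2) = 0"
    by (simp add: U1_def U2_def power2_eq_square algebra_simps)
  have "q^3 * u1 1 = q\<^sup>2" "q^3 * u1 2 = q" "q^3 * u1 3 = 1"
    using q2 by (simp_all add: field_simps power3_eq_cube power2_eq_square)
  then have "(bb 0 - th1) * (q\<^sup>2 * U1 + q * (U2 * (th1 + 1 - \<theta>)) + ((th1 - \<phi>) * (th1 + 1 - \<theta>) - l2)) = 0"
    using eq tot unfolding \<omega>_def by algebra
  then have fin: "q\<^sup>2 * U1 + q * (U2 * (th1 + 1 - \<theta>)) + ((th1 - \<phi>) * (th1 + 1 - \<theta>) - l2) = 0"
    using bb_0_gt_th1 by simp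
  have "l2 * (q\<^sup>2 * U1 + q * (U2 * (th1 + 1 - \<theta>)) + ((th1 - \<phi>) * (th1 + 1 - \<theta>) - l2))
      = (q\<^sup>2 - 1) * q * w * z * \<theta> * (\<theta> - \<alpha> * (g D - 1)) * (\<theta> - b)"
    using terwilliger_cubic[of q w z \<alpha> \<theta> \<phi>] \<phi>
    unfolding U1_def U2_def l2 a1 cc2 bb1 bb2 t1 t2 h b_def by (simp only:)
  then have "(q\<^sup>2 - 1) * q * w * z * \<theta> * (\<theta> - \<alpha> * (g D - 1)) * (\<theta> - b) = 0" unfolding fin by simp
  moreover have "q\<^sup>2 - 1 \<noteq> 0" using q2 power_increasing[of 1 2 q] by auto
  ultimately show False using contr wz q2 b by auto
qed

end

section \<open>Thin modules of endpoint one\<close>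

context local_vector
begin

text \<open>
  For a thin module, \<open>M i\<close> is a multiple \<open>m i\<close> of \<open>P i\<close>, and \<open>l i\<close> is the scalar by which the
  lowering map sends \<open>P i\<close> to \<open>P (i - 1)\<close>.
\<close>

definition thin_data :: "nat \<Rightarrow> (nat \<Rightarrow> real) \<Rightarrow> (nat \<Rightarrow> real) \<Rightarrow> bool" where
  "thin_data n m l \<longleftrightarrow> n \<le> D \<and> m 1 = - \<theta> \<and>
    (\<forall>i. 1 \<le> i \<and> i \<le> n \<longrightarrow>
      l (Suc i) = m i * (aa (i - 1) - cc i + cc (i - 1) - cc i * m i + cc (i - 1) * m (i - 1))
        - (aa (Suc i) - bb i + bb (Suc i)) * m i + bb i) \<and>
    (\<forall>i. 2 \<le> i \<and> i \<le> n \<longrightarrow> l i \<noteq> 0 \<and> m i * l i = bb i * m (i - 1))"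

definition thin_vector :: bool where
  "thin_vector \<longleftrightarrow> (\<forall>i\<le>D. P i \<noteq> 0 \<longrightarrow> (\<exists>\<mu>. M i = \<mu> *s P i))"

text \<open>Induction over the levels: \<open>l\<close> nonzero keeps \<open>P\<close> nonzero, then
  thinness supplies a multiple, which lowering identifies as \<open>m\<close>. The last scalar
  \<open>l (Suc n)\<close> is also determined, but it may be zero.\<close>

lemma thin_recursion:
  assumes thin: thin_vector and data: "thin_data n m l" and "1 \<le> i" "i \<le> n"
  shows "P i \<noteq> 0 \<and> M i = m i *\<^sub>R P i \<and> lev i (adj (P (Suc i))) = l (Suc i) *\<^sub>R P i"
  using \<open>1 \<le> i\<close> \<open>i \<le> n\<close>
proof (induction i rule: nat_induct_at_least)
  case base
  have "M (Suc 0) = m (Suc 0) *\<^sub>R P (Suc 0)" using data by (simp add: M_1 P_1 thin_data_def)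
  \<comment> \<open>The value \<open>m 0\<close> is arbitrary: it is multiplied by
    \<open>cc 0 = 0\<close>.\<close>
  moreover from this have "lev (Suc 0) (adj (P (Suc (Suc 0)))) = l (Suc (Suc 0)) *\<^sub>R P (Suc 0)"
    using thin_step(2)[of 0 "m (Suc 0)" "m 0"] data base by (simp add: M_0 thin_data_def)
  ultimately show ?case using v_nonzero by (simp add: P_1)
next
  case (Suc i)
  then have IH: "P i \<noteq> 0" "M i = m i *\<^sub>R P i" "lev i (adj (P (Suc i))) = l (Suc i) *\<^sub>R P i" by auto
  have nz: "l (Suc i) \<noteq> 0" "m (Suc i) * l (Suc i) = bb (Suc i) * m i"
    using data Suc.hyps Suc.prems by (auto simp: thin_data_def dest: spec[of _ "Suc i"])
  have P: "P (Suc i) \<noteq> 0" using IH nz by auto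
  then obtain \<mu> where \<mu>: "M (Suc i) = \<mu> *s P (Suc i)"
    using thin data Suc.prems unfolding thin_vector_def thin_data_def by (metis le_trans)
  \<comment> \<open>The lowering of \<open>M (Suc i)\<close>, computed once through
    \<open>P (Suc i)\<close> and once by \<open>L_M\<close>.\<close>
  have "(\<mu> * of_real (l (Suc i))) *s P i = of_real (bb (Suc i) * m i) *s P i"
    using L_M[of i] unfolding \<mu> adj_smult lev_smult IH(2,3)
    by (simp add: scaleR_eq_smult vector_smult_assoc)
  then have "\<mu> * of_real (l (Suc i)) = of_real (m (Suc i) * l (Suc i))"
    unfolding nz(2) using IH(1) vector_mul_rcancel by blast
  then have "\<mu> = of_real (m (Suc i))" using nz(1) by simp
  then have M: "M (Suc i) = m (Suc i) *\<^sub>R P (Suc i)" unfolding \<mu> by (simp add: scaleR_eq_smult)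
  have "lev (Suc i) (adj (M i)) = (cc i * m i) *\<^sub>R P (Suc i)"
    unfolding IH(2) using R_P[OF Suc.hyps] by (simp add: op_linear)
  from thin_step(2)[OF M this] show ?case
    using M P data Suc.hyps Suc.prems by (simp add: thin_data_def)
qed

end

section \<open>Modules of endpoint one in the whole space\<close>

context based_drg
begin

lemma inner_lev: "inner (lev i v) w = inner v (lev i w)"
  unfolding inner_vec_def by (intro sum.cong) auto

lemma inner_adj: "inner (adj v) w = inner v (adj w)"
proof -
  have "inner (adj v) w = (\<Sum>y\<in>UNIV. \<Sum>z\<in>UNIV. if (y, z) \<in> E then inner (v $ z) (w $ y) else 0)"
    by (simp add: inner_vec_def adj_def inner_sum_left sum.If_cases)
  also have "\<dots> = (\<Sum>z\<in>UNIV. \<Sum>y\<in>UNIV. if (z, y) \<in> E then inner (v $ z) (w $ y) else 0)"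
    by (subst sum.swap) (use edge_sym in \<open>auto intro!: sum.cong\<close>)
  also have "\<dots> = inner v (adj w)"
    by (simp add: inner_vec_def adj_def inner_sum_right sum.If_cases)
  finally show ?thesis .
qed

text \<open>\<open>inner\<close> is the real part of the Hermitian product, so a complex scalar
  crosses it as its conjugate; for complex subspaces the orthogonal complement is the same for both
  products.\<close>

lemma inner_smult: "inner (c *s v) w = inner v (cnj c *s w)" for v w :: "complex^'a"
  unfolding inner_vec_def by (intro sum.cong) (simp_all add: inner_complex_def algebra_simps)

lemma T_moduleI:
  assumes "vec.subspace W" "\<And>w. w \<in> W \<Longrightarrow> adj w \<in> W" "\<And>i w. w \<in> W \<Longrightarrow> lev i w \<in> W"
  shows "T_module E x W"
  unfolding T_module_def
proof (intro conjI ballI assms)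
  fix B w assume "B \<in> terwilliger E x" "w \<in> W"
  then show "B *v w \<in> W"
  proof (induction arbitrary: w)
    case adj then show ?case using assms by (simp add: adj_mult)
  next
    case (dual i) then show ?case using assms by (simp add: Estar_mult)
  next
    case (add B C) then show ?case using assms(1)
      by (simp add: matrix_vector_mult_add_rdistrib vec.subspace_add)
  next
    case (scale B c)
    have "mat c ** B *v w = c *s (B *v w)"
      by (simp add: vec_eq_iff matrix_vector_mult_def matrix_matrix_mult_def mat_def
          if_distrib[of "\<lambda>t. t * _"] sum_distrib_left mult.assoc cong: if_cong)
    then show ?case using scale assms(1) by (simp add: vec.subspace_scale)
  next
    case (mult B C) then show ?case by (simp add: matrix_vector_mul_assoc[symmetric])
  qed
qed

lemma T_moduleD:
  assumes "T_module E x W"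
  shows "vec.subspace W" "\<And>w. w \<in> W \<Longrightarrow> adj w \<in> W" "\<And>i w. w \<in> W \<Longrightarrow> lev i w \<in> W"
    "\<And>r w. w \<in> W \<Longrightarrow> r *\<^sub>R w \<in> W"
proof -
  show s: "vec.subspace W" using assms by (simp add: T_module_def)
  show "adj w \<in> W" if "w \<in> W" for w
    using assms that terwilliger.adj[of E x] unfolding T_module_def by (metis adj_mult)
  show "lev i w \<in> W" if "w \<in> W" for i w
  proof (cases "i \<le> D")
    case True
    then have "Estar E x i \<in> terwilliger E x" using terwilliger.dual diam by metis
    then show ?thesis using assms that unfolding T_module_def by (metis Estar_mult)
  next
    case False
    then show ?thesis using lev_gt_D vec.subspace_0[OF s] by simp
  qed
  show "r *\<^sub>R w \<in> W" if "w \<in> W" for r w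
  proof -
    show ?thesis using vec.subspace_scale[OF s that] by (simp add: scaleR_eq_smult)
  qed
qed

lemma T_module_real_subspace: "T_module E x W \<Longrightarrow> subspace W"
  using T_moduleD[of W] by (auto simp: subspace_def vec.subspace_0 vec.subspace_add)

text \<open>The three-term recurrence can be solved for the next distance matrix because
  \<open>cc j\<close> is positive up to \<open>D\<close>.\<close>

lemma T_module_act:
  assumes W: "T_module E x W" and w: "w \<in> W"
  shows "act j w \<in> W"
proof (induction j rule: less_induct)
  case (less j)
  note mem = T_moduleD[OF W]
  show ?case
  proof (cases j)
    case (Suc k)
    show ?thesis
    proof (cases "j \<le> D")
      case True
      let ?r = "adj (act k w) - aa k *\<^sub>R act k w - (if k = 0 then 0 else bb (k - 1) *\<^sub>R act (k - 1) w)"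
      have "cc j *\<^sub>R act j w = ?r" unfolding Suc adj_act by simp
      then have "act j w = inverse (cc j) *\<^sub>R ?r"
        using cc_pos[of j] True Suc by (simp flip: \<open>_ = ?r\<close>)
      moreover have "?r \<in> W"
        using less Suc mem vec.subspace_0[OF mem(1)] by (intro vec.subspace_diff[OF mem(1)]) auto
      ultimately show ?thesis using mem(4) by simp
    qed (simp add: act_gt_D vec.subspace_0[OF mem(1)])
  qed (simp add: w)
qed

definition module_1 :: "(complex^'a) set \<Rightarrow> bool" where
  "module_1 W \<longleftrightarrow> irreducible_T_module E x W \<and> endpoint E x W = 1"

lemma lev_image: "(\<lambda>w. Estar E x i *v w) ` W = lev i ` W"
  by (simp add: Estar_mult)

lemma module_1D:
  assumes "module_1 W"
  shows "T_module E x W" "\<And>w. w \<in> W \<Longrightarrow> lev 0 w = 0"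
proof -
  show W: "T_module E x W" using assms by (simp add: module_1_def irreducible_T_module_def)
  have "\<not> lev 0 ` W \<noteq> {0}"
    using assms not_less_Least[of 0 "\<lambda>i. lev i ` W \<noteq> {0}"]
    by (simp add: module_1_def endpoint_def lev_image)
  then show "lev 0 w = 0" if "w \<in> W" for w using that by auto
qed

lemma module_1I:
  assumes "irreducible_T_module E x W" "\<And>w. w \<in> W \<Longrightarrow> lev 0 w = 0" "w \<in> W" "lev (Suc 0) w \<noteq> 0"
  shows "module_1 W"
proof -
  have "(LEAST i. lev i ` W \<noteq> {0}) = 1"
  proof (rule Least_equality)
    show "lev 1 ` W \<noteq> {0}" using assms by auto
    show "1 \<le> i" if "lev i ` W \<noteq> {0}" for i
      using that assms(2,3) by (cases i) auto
  qed
  then show ?thesis using assms(1) by (simp add: module_1_def endpoint_def lev_image)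
qed

definition good :: "complex^'a \<Rightarrow> bool" where
  "good v \<longleftrightarrow> v \<noteq> 0 \<and> lev (Suc 0) v = v \<and> (\<exists>W. module_1 W \<and> v \<in> W)"

text \<open>\<open>Z\<close> is the orthogonal complement of the spheres around \<open>x\<close>,
  that is, of the module generated by \<open>x\<close>, and of all modules of endpoint one. If it
  contained a vector with a level-one part, it would contain a module of endpoint one, which would
  be orthogonal to itself.\<close>

lemma orthogonal_good_eq_0:
  assumes u: "lev (Suc 0) u = u" "(\<Sum>z\<in>UNIV. u $ z) = 0" and orth: "\<And>v. good v \<Longrightarrow> inner u v = 0"
  shows "u = 0"
proof (rule ccontr)
  assume "u \<noteq> 0"
  define Z where "Z = {w. (\<forall>j. act j w $ x = 0) \<and> (\<forall>W v. module_1 W \<longrightarrow> v \<in> W \<longrightarrow> inner w v = 0)}"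
  have Z: "T_module E x Z"
  proof (rule T_moduleI)
    show "vec.subspace Z"
      unfolding vec.subspace_def
    proof (intro conjI ballI allI)
      show "0 \<in> Z" by (simp add: Z_def)
      show "w + w' \<in> Z" if "w \<in> Z" "w' \<in> Z" for w w'
        using that by (simp add: Z_def op_linear inner_add_left)
      show "c *s w \<in> Z" if "w \<in> Z" for c w
        using that T_moduleD(1)[OF module_1D(1)]
        by (auto simp: Z_def bm_smult inner_smult vec.subspace_scale)
    qed
    show "adj w \<in> Z" if w: "w \<in> Z" for w
    proof -
      have "act j (adj w) $ x = 0" for j
      proof -
        have "act j (adj w) = adj (act j w)" by (simp only: adj_bm bm_adj)
        then show ?thesis using w by (simp add: adj_act Z_def)
      qed
      then show ?thesis using w module_1D(1)[THEN T_moduleD(2)] by (auto simp: Z_def inner_adj)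
    qed
    show "lev i w \<in> Z" if w: "w \<in> Z" for i w
    proof -
      have "act j (lev i w) $ x = (if i = j then act j w $ x else 0)" for j
        unfolding bm_def vec_lambda_beta
        by (auto intro!: sum.neutral sum.cong)
      then show ?thesis using w module_1D(1)[THEN T_moduleD(3)] by (auto simp: Z_def inner_lev)
    qed
  qed
  have "u \<in> Z"
  proof -
    have "act j u $ x = 0" for j
    proof -
      have "act j u $ x = (if j = Suc 0 then 1 else 0) *\<^sub>R (\<Sum>z\<in>UNIV. u $ z)"
        unfolding bm_def vec_lambda_beta scaleR_sum_right
      proof (intro sum.cong refl)
        fix z show "(if gdist E x z = j then 1 else 0) *\<^sub>R u $ z = (if j = Suc 0 then 1 else 0) *\<^sub>R u $ z"
        proof (cases "u $ z = 0")
          case False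
          then have "gdist E x z = Suc 0" using u(1) by (metis lev_nth)
          then show ?thesis by auto
        qed simp
      qed
      then show ?thesis using u(2) by simp
    qed
    moreover have "inner u w = 0" if W: "module_1 W" "w \<in> W" for W w
    proof -
      have "good (lev (Suc 0) w)" if "lev (Suc 0) w \<noteq> 0"
        using that W T_moduleD(3)[OF module_1D(1)[OF W(1)]] by (auto simp: good_def)
      then have "inner u (lev (Suc 0) w) = 0" using orth by fastforce
      then show ?thesis using u(1) inner_lev by metis
    qed
    ultimately show ?thesis by (auto simp: Z_def)
  qed
  \<comment> \<open>Minimality is taken among submodules with a level-one part, not among all
    nonzero ones; this forces the endpoint to be one.\<close>
  define Q where "Q N \<longleftrightarrow> T_module E x N \<and> N \<subseteq> Z \<and> (\<exists>w\<in>N. lev (Suc 0) w \<noteq> 0)" for N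
  have "Q Z" using Z \<open>u \<in> Z\<close> u(1) \<open>u \<noteq> 0\<close> by (auto simp: Q_def intro!: bexI[of _ u])
  then obtain N where N: "Q N" and min: "\<And>N'. Q N' \<Longrightarrow> dim N \<le> dim N'"
    using ex_has_least_nat[of Q Z dim] by blast
  have NT: "T_module E x N" and NZ: "N \<subseteq> Z" using N by (auto simp: Q_def)
  obtain w where w: "w \<in> N" "lev (Suc 0) w \<noteq> 0" using N by (auto simp: Q_def)
  have "irreducible_T_module E x N"
    unfolding irreducible_T_module_def
  proof (intro conjI allI impI NT)
    show "N \<noteq> {0}" using w by auto
    fix N1 assume N1: "T_module E x N1 \<and> N1 \<subseteq> N"
    show "N1 = {0} \<or> N1 = N"
    proof (rule ccontr)
      assume neq: "\<not> ?thesis"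
      \<comment> \<open>By minimality, proper submodules have no level-one part. Both
        \<open>N1\<close> and its complement in \<open>N\<close> are proper, so their sum would have
        none either.\<close>
      define N2 where "N2 = {w \<in> N. \<forall>v\<in>N1. inner w v = 0}"
      have N2: "T_module E x N2"
      proof (rule T_moduleI)
        have s: "vec.subspace N" "vec.subspace N1" using NT N1 T_moduleD(1) by auto
        show "vec.subspace N2"
          unfolding vec.subspace_def N2_def
          using s by (auto simp: vec.subspace_0 vec.subspace_add vec.subspace_scale inner_add_left inner_smult)
        show "adj w \<in> N2" if "w \<in> N2" for w
          using that T_moduleD(2) NT N1 by (auto simp: N2_def inner_adj)
        show "lev i w \<in> N2" if "w \<in> N2" for i w
          using that T_moduleD(3) NT N1 by (auto simp: N2_def inner_lev)
      qed
      have small: "lev (Suc 0) w = 0" if "T_module E x N'" "N' \<subseteq> N" "N' \<noteq> N" "w \<in> N'" for N' w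
      proof (rule ccontr)
        assume "lev (Suc 0) w \<noteq> 0"
        then have "Q N'" using that NZ by (auto simp: Q_def)
        then have "dim N \<le> dim N'" by (rule min)
        then have "N' = N"
          using subspace_dim_equal[OF T_module_real_subspace[OF that(1)] T_module_real_subspace[OF NT] that(2)]
          by simp
        then show False using that(3) by simp
      qed
      have "N2 \<noteq> N"
      proof
        assume "N2 = N"
        then have "v = 0" if "v \<in> N1" for v
        proof -
          have "v \<in> N2" using that N1 \<open>N2 = N\<close> by auto
          then have "inner v v = 0" using that unfolding N2_def by blast
          then show ?thesis by simp
        qed
        then show False using neq N1 T_moduleD(1) vec.subspace_0 by blast
      qed
      obtain a b where ab: "a \<in> span N1" "\<And>v. v \<in> span N1 \<Longrightarrow> orthogonal b v" "w = a + b"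
        using orthogonal_subspace_decomp_exists[of N1 w] by metis
      have a: "a \<in> N1" using ab(1) N1 T_module_real_subspace span_eq_iff by blast
      then have "b \<in> N" using ab(3) w(1) N1 vec.subspace_diff[OF T_moduleD(1)[OF NT], of w a] by auto
      then have "b \<in> N2" using ab(2) span_superset by (auto simp: N2_def orthogonal_def)
      then have "lev (Suc 0) b = 0" using small[OF N2] \<open>N2 \<noteq> N\<close> by (auto simp: N2_def)
      moreover have "lev (Suc 0) a = 0" using small[of N1 a] a N1 neq by auto
      ultimately show False using w(2) ab(3) by (simp add: op_linear)
    qed
  qed
  moreover have "lev 0 w = 0" if "w \<in> N" for w
  proof -
    have "act 0 w $ x = 0" using that NZ unfolding Z_def by blast
    then show ?thesis by (auto simp: vec_eq_iff)
  qed
  ultimately have "module_1 N" using w by (rule module_1I)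
  then have "inner w w = 0" using w(1) NZ unfolding Z_def by blast
  then show False using w(2) by simp
qed

lemma thin_multiple:
  assumes "vec.dim (lev i ` W) \<le> 1" "u \<in> lev i ` W" "w \<in> lev i ` W" "u \<noteq> 0"
  shows "\<exists>c. w = c *s u"
proof (rule ccontr)
  assume no: "\<nexists>c. w = c *s u"
  then have "w \<notin> vec.span {u}" by (auto simp: vec.span_singleton)
  then have "vec.independent {w, u}" using assms(4) by (simp add: vec.independent_insert)
  moreover have "w \<noteq> u" using no by (metis vector_smult_lid)
  ultimately have "2 \<le> vec.dim (lev i ` W)"
    using vec.independent_card_le_dim[of "{w, u}" "lev i ` W"] assms by simp
  then show False using assms(1) by simp
qed

text \<open>Thinness on level one makes \<open>v\<close> a local eigenvector, self-adjointness makes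
  the eigenvalue real, and the vanishing of level 0 makes the coordinates of \<open>v\<close> sum to
  zero.\<close>

lemma good_local_vector:
  assumes good: "good v" and thin1: "\<And>W. module_1 W \<Longrightarrow> thin E x W"
  obtains \<theta> where "local_vector E D q \<alpha> \<beta> x v \<theta>" "local_vector.thin_vector E D x v"
proof -
  obtain W where W: "module_1 W" "v \<in> W" and v: "v \<noteq> 0" "lev (Suc 0) v = v"
    using good by (auto simp: good_def)
  note mem = T_moduleD[OF module_1D(1)[OF W(1)]]
  have mult: "\<exists>c. w' = c *s w" if "w \<in> W" "w' \<in> W" "lev i w = w" "lev i w' = w'" "w \<noteq> 0" "i \<le> D" for i w w'
  proof (rule thin_multiple)
    show "vec.dim (lev i ` W) \<le> 1"
      using thin1[OF W(1)] \<open>i \<le> D\<close> unfolding thin_def lev_image diam by blast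
    show "w \<in> lev i ` W" "w' \<in> lev i ` W" using that by (metis imageI)+
  qed fact
  obtain c where c: "lev (Suc 0) (adj v) = c *s v"
    using mult[of v "lev (Suc 0) (adj v)" "Suc 0"] W mem v D3 by auto
  \<comment> \<open>Pairing with the imaginary unit times \<open>v\<close> detects the imaginary
    part of \<open>c\<close>, which the real inner product with \<open>v\<close> would miss.\<close>
  have "inner (c *s v) (\<i> *s v) = inner v (\<i> *s (c *s v))"
    using inner_lev[of "Suc 0" "adj v" "\<i> *s v"] inner_adj[of v "\<i> *s v"]
      inner_lev[of "Suc 0" v "adj (\<i> *s v)"]
    by (simp add: c lev_smult adj_smult v(2))
  then have "(\<Sum>z\<in>UNIV. Im c * (cmod (v $ z))\<^sup>2) = (\<Sum>z\<in>UNIV. - Im c * (cmod (v $ z))\<^sup>2)"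
    unfolding inner_vec_def inner_complex_def cmod_power2
    by (simp add: power2_eq_square algebra_simps)
  then have "Im c * (\<Sum>z\<in>UNIV. (cmod (v $ z))\<^sup>2) = 0" by (simp add: sum_negf sum_distrib_left)
  moreover have "(\<Sum>z\<in>UNIV. (cmod (v $ z))\<^sup>2) \<noteq> 0"
    using v(1) by (auto simp: sum_nonneg_eq_0_iff vec_eq_iff)
  ultimately have "c = of_real (Re c)" by (simp add: complex_eq_iff)
  then have eigen: "lev (Suc 0) (adj v) = (Re c + 1 - 1) *\<^sub>R v"
    unfolding c by (simp add: scaleR_eq_smult)
  have "(\<Sum>z\<in>UNIV. v $ z) = adj v $ x"
  proof -
    have "gdist E x z = Suc 0" if "v $ z \<noteq> 0" for z using v(2) that by (metis lev_nth)
    then show ?thesis unfolding adj_def using gdist_edge[of x]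
      by (simp, intro sum.mono_neutral_right) auto
  qed
  also have "\<dots> = lev 0 (adj v) $ x" by simp
  also have "\<dots> = 0" using module_1D(2)[OF W(1)] mem W(2) by simp
  finally have sum: "(\<Sum>z\<in>UNIV. v $ z) = 0" .
  interpret local_vector E D q \<alpha> \<beta> x v "Re c + 1"
    by unfold_locales (use v sum eigen in auto)
  have thin_vector
    unfolding thin_vector_def
  proof (intro allI impI)
    fix i assume "i \<le> D" "P i \<noteq> 0"
    moreover have "P i \<in> W" "M i \<in> W"
      unfolding P_def M_def using mem T_module_act[OF module_1D(1)[OF W(1)] W(2)] by auto
    ultimately show "\<exists>\<mu>. M i = \<mu> *s P i" using mult[of "P i" "M i" i] lev_P lev_M by blast
  qed
  then show ?thesis using that local_vector_axioms by blast
qed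

end

section \<open>Uniform structures\<close>

lemma det_on_identical_columns:
  assumes S: "finite S" and jk: "j \<in> S" "k \<in> S" "j \<noteq> k" and eq: "\<And>i. i \<in> S \<Longrightarrow> M i j = M i k"
  shows "det_on S M = 0"
proof -
  let ?t = "Transposition.transpose j k"
  have t: "?t permutes S" using jk by (simp add: permutes_swap_id)
  have "det_on S M = (\<Sum>p | p permutes S. of_int (sign (?t \<circ> p)) * (\<Prod>i\<in>S. M i ((?t \<circ> p) i)))"
    unfolding det_on_def by (subst setum_permutations_compose_left[OF t]) simp
  also have "\<dots> = (\<Sum>p | p permutes S. - (of_int (sign p) * (\<Prod>i\<in>S. M i (p i))))"
  proof (rule sum.cong)
    fix p assume "p \<in> {p. p permutes S}"
    then have p: "p permutes S" by simp
    have "sign (?t \<circ> p) = - sign p"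
      using sign_compose[of ?t p] permutation_permutes S t p jk by (auto simp: sign_swap_id)
    moreover have "(\<Prod>i\<in>S. M i ((?t \<circ> p) i)) = (\<Prod>i\<in>S. M i (p i))"
      using eq by (intro prod.cong) (auto simp: Transposition.transpose_def)
    ultimately show "of_int (sign (?t \<circ> p)) * (\<Prod>i\<in>S. M i ((?t \<circ> p) i))
        = - (of_int (sign p) * (\<Prod>i\<in>S. M i (p i)))" by simp
  qed simp
  also have "\<dots> = - det_on S M" by (simp add: det_on_def sum_negf)
  finally show ?thesis by simp
qed

text \<open>Cramer's rule: replacing column \<open>k\<close> by the combination of columns with
  coefficients \<open>d\<close> multiplies the determinant by \<open>d k\<close>, as the other
  summands have two equal columns. The new column is zero.\<close>

lemma det_on_kernel:
  assumes S: "finite S" and kernel: "\<And>i. i \<in> S \<Longrightarrow> (\<Sum>j\<in>S. M i j * d j) = 0" and k: "k \<in> S" "d k \<noteq> 0"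
  shows "det_on S M = 0"
proof -
  let ?N = "\<lambda>j i l. if l = k then M i j else M i l"
  have "det_on S (?N j) = (if j = k then det_on S M else 0)" if "j \<in> S" for j
  proof (cases "j = k")
    case True
    then have "?N j = M" by (intro ext) simp
    then show ?thesis using True by simp
  next
    case False
    then show ?thesis using that k S by (auto intro: det_on_identical_columns[of S j k])
  qed
  then have "d k * det_on S M = (\<Sum>j\<in>S. d j * det_on S (?N j))"
    using S k by (simp add: if_distrib[of "\<lambda>t. _ * t"] cong: if_cong)
  also have "\<dots> = (\<Sum>p | p permutes S. of_int (sign p) * (\<Sum>j\<in>S. d j * (\<Prod>i\<in>S. ?N j i (p i))))"
    unfolding det_on_def sum_distrib_left by (subst sum.swap) (simp add: mult_ac)
  also have "\<dots> = 0"
  proof (rule sum.neutral, clarify)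
    fix p assume p: "p permutes S"
    obtain i0 where i0: "i0 \<in> S" "p i0 = k" using permutes_image[OF p] k(1) by (metis imageE)
    have "(\<Prod>i\<in>S. ?N j i (p i)) = M i0 j * (\<Prod>i\<in>S - {i0}. M i (p i))" for j
    proof -
      have "(\<Prod>i\<in>S. ?N j i (p i)) = ?N j i0 (p i0) * (\<Prod>i\<in>S - {i0}. ?N j i (p i))"
        using S i0 by (intro prod.remove)
      also have "(\<Prod>i\<in>S - {i0}. ?N j i (p i)) = (\<Prod>i\<in>S - {i0}. M i (p i))"
        using permutes_inj[OF p] i0(2) by (intro prod.cong) (auto dest: injD)
      finally show ?thesis using i0(2) by simp
    qed
    then have "(\<Sum>j\<in>S. d j * (\<Prod>i\<in>S. ?N j i (p i)))
        = (\<Sum>j\<in>S. M i0 j * d j) * (\<Prod>i\<in>S - {i0}. M i (p i))"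
      by (simp add: sum_distrib_right mult_ac)
    then show "of_int (sign p) * (\<Sum>j\<in>S. d j * (\<Prod>i\<in>S. ?N j i (p i))) = 0"
      using kernel[OF i0(1)] by simp
  qed
  finally show ?thesis using k(2) by simp
qed

context based_drg
begin

lemma lev_level: "lev i w = w \<Longrightarrow> lev j w = (if j = i then w else 0)"
  using lev_lev[of j i w] by (simp split: if_splits)

lemma lower_mult:
  assumes w: "lev i w = w" and i: "1 \<le> i" "i \<le> D"
  shows "lower_mat E x *v w = lev (i - 1) (adj w)"
proof -
  have sum: "(\<Sum>j\<in>S. B j) *v w = (\<Sum>j\<in>S. B j *v w)" if "finite S" for S :: "nat set" and B :: "nat \<Rightarrow> complex^'a^'a"
    using that by induction (simp_all add: matrix_vector_mult_add_rdistrib)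
  have "lower_mat E x *v w = (\<Sum>j=1..D. lev (j - 1) (adj (lev j w)))"
    unfolding lower_mat_def diam
    by (simp add: sum matrix_vector_mul_assoc[symmetric] Estar_mult adj_mult)
  also have "\<dots> = (\<Sum>j=1..D. if j = i then lev (i - 1) (adj w) else 0)"
    by (intro sum.cong refl) (auto simp: lev_level[OF w])
  finally show ?thesis using i by simp
qed

lemma raise_mult:
  assumes w: "lev i w = w"
  shows "raise_mat E x *v w = lev (Suc i) (adj w)"
proof -
  have sum: "(\<Sum>j\<in>S. B j) *v w = (\<Sum>j\<in>S. B j *v w)" if "finite S" for S :: "nat set" and B :: "nat \<Rightarrow> complex^'a^'a"
    using that by induction (simp_all add: matrix_vector_mult_add_rdistrib)
  have "raise_mat E x *v w = (\<Sum>j<D. lev (Suc j) (adj (lev j w)))"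
    unfolding raise_mat_def diam
    by (simp add: sum matrix_vector_mul_assoc[symmetric] Estar_mult adj_mult)
  also have "\<dots> = (\<Sum>j<D. if j = i then lev (Suc i) (adj w) else 0)"
    by (intro sum.cong refl) (auto simp: lev_level[OF w])
  finally show ?thesis by (simp add: lev_gt_D)
qed

end

context local_vector
begin

text \<open>Applied to \<open>P i\<close>, every term of the uniform relation is a multiple of
  \<open>P (i - 1)\<close> and contains \<open>l i\<close>. Dividing by it leaves a relation that is
  linear in the scalars \<open>l\<close>.\<close>

lemma uniform_relation:
  assumes thin: thin_vector and data: "thin_data n m l" and i: "2 \<le> i" "i \<le> n"
    and uniform: "\<And>w. lev i w = w \<Longrightarrow>
      e_minus e i *s ((raise_mat E x ** lower_mat E x ** lower_mat E x) *v w)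
        + (lower_mat E x ** raise_mat E x ** lower_mat E x) *v w
        + e_plus D e i *s ((lower_mat E x ** lower_mat E x ** raise_mat E x) *v w)
      = f i *s (lower_mat E x *v w)"
  shows "e_minus e i * of_real (cc (i - 2) * l (i - 1)) + of_real (cc (i - 1) * l i)
      + e_plus D e i * of_real (cc i * l (Suc i)) = f i"
proof -
  obtain k where k: "i = Suc (Suc k)" using i by (intro that[of "i - 2"]) linarith
  have nD: "n \<le> D" and li: "l i \<noteq> 0" using data i by (auto simp: thin_data_def)
  note rec = thin_recursion[OF thin data]
  let ?L = "\<lambda>w. lower_mat E x *v w" and ?R = "\<lambda>w. raise_mat E x *v w"
  have L: "?L (r *\<^sub>R P (Suc j)) = (r * l (Suc j)) *\<^sub>R P j" if "1 \<le> j" "j \<le> n" "Suc j \<le> D" for r j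
    using lower_mult[of "Suc j" "r *\<^sub>R P (Suc j)"] rec[of j] that by (simp add: op_linear lev_P)
  have R: "?R (r *\<^sub>R P (Suc j)) = (r * cc (Suc j)) *\<^sub>R P (Suc (Suc j))" for r j
    using raise_mult[of "Suc j" "r *\<^sub>R P (Suc j)"] R_P[of "Suc j"] by (simp add: op_linear lev_P)
  have LP: "?L (P i) = l i *\<^sub>R P (Suc k)" using L[of "Suc k" 1] i nD k by simp
  have 1: "?R (?L (?L (P i))) = (cc k * l (Suc k) * l i) *\<^sub>R P (Suc k)"
  proof (cases k)
    case 0
    have "?L (l i *\<^sub>R P (Suc 0)) = 0"
      using lower_mult[of "Suc 0" "l i *\<^sub>R P (Suc 0)"] M_0 D3
      by (simp add: op_linear lev_P P_1 lev_v M_def act_1)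
    then show ?thesis unfolding LP using 0 by simp
  next
    case (Suc k')
    then show ?thesis unfolding LP using L[of k "l i"] R[of _ k'] i nD k by (simp add: mult_ac)
  qed
  have 2: "?L (?R (?L (P i))) = (l i * cc (Suc k) * l i) *\<^sub>R P (Suc k)"
    unfolding LP using R[of "l i" k] L[of "Suc k"] i nD k by simp
  have 3: "e_plus D e i *s ?L (?L (?R (P i))) = e_plus D e i *s ((cc i * l (Suc i) * l i) *\<^sub>R P (Suc k))"
  \<comment> \<open>For \<open>i = D\<close> the coefficient \<open>e_plus\<close> is zero by
    convention, so the next level need not be examined.\<close>
  proof (cases "i = D")
    case False
    then have "?L (?L (?R (P i))) = (cc i * l (Suc i) * l i) *\<^sub>R P (Suc k)"
      using R[of 1 "Suc k"] L[of i "cc i"] L[of "Suc k"] i nD k by simp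
    then show ?thesis by simp
  qed (simp add: e_plus_def)
  have "e_minus e i *s ((cc k * l (Suc k) * l i) *\<^sub>R P (Suc k)) + (l i * cc (Suc k) * l i) *\<^sub>R P (Suc k)
      + e_plus D e i *s ((cc i * l (Suc i) * l i) *\<^sub>R P (Suc k)) = f i *s (l i *\<^sub>R P (Suc k))"
    using uniform[OF lev_P] unfolding matrix_vector_mul_assoc[symmetric] 1 2 3 unfolding LP .
  then have "(e_minus e i * of_real (cc k * l (Suc k) * l i) + of_real (l i * cc (Suc k) * l i)
      + e_plus D e i * of_real (cc i * l (Suc i) * l i)) *s P (Suc k) = (f i * of_real (l i)) *s P (Suc k)"
    by (simp only: scaleR_eq_smult vector_smult_assoc vector_sadd_rdistrib)
  moreover have "P (Suc k) \<noteq> 0" using rec[of "Suc k"] i k by simp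
  ultimately have "e_minus e i * of_real (cc k * l (Suc k) * l i) + of_real (l i * cc (Suc k) * l i)
      + e_plus D e i * of_real (cc i * l (Suc i) * l i) = f i * of_real (l i)"
    using vector_mul_rcancel by blast
  then have "(e_minus e i * of_real (cc k * l (Suc k)) + of_real (cc (Suc k) * l i)
      + e_plus D e i * of_real (cc i * l (Suc i))) * of_real (l i) = f i * of_real (l i)"
    unfolding of_real_mult by algebra
  then show ?thesis using li k by simp
qed

end

context based_drg
begin

text \<open>
  The difference of the data of two modules lies in the kernel of a principal submatrix of the
  parameter matrix.
\<close>

lemma uniform_pair:
  assumes uniform: "supports_uniform_structure E x"
    and v: "local_vector E D q \<alpha> \<beta> x v \<theta>" "local_vector.thin_vector E D x v"
      "local_vector.thin_data D q \<alpha> \<beta> \<theta> n m l"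
    and v': "local_vector E D q \<alpha> \<beta> x v' \<theta>'" "local_vector.thin_vector E D x v'"
      "local_vector.thin_data D q \<alpha> \<beta> \<theta>' n m' l'"
    and last: "n = D \<or> l (Suc n) = l' (Suc n)" and i: "2 \<le> i" "i \<le> n"
  shows "l i = l' i"
proof (rule ccontr)
  assume neq: "l i \<noteq> l' i"
  obtain e f where e: "parameter_matrix D e" and rel:
    "\<And>i w. i \<in> {1..D} \<Longrightarrow> lev i w = w \<Longrightarrow>
      e_minus e i *s ((raise_mat E x ** lower_mat E x ** lower_mat E x) *v w)
        + (lower_mat E x ** raise_mat E x ** lower_mat E x) *v w
        + e_plus D e i *s ((lower_mat E x ** lower_mat E x ** raise_mat E x) *v w)
      = f i *s (lower_mat E x *v w)"
    using uniform unfolding supports_uniform_structure_def diam Let_def Estar_mult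
    by (metis rangeI)
  have nD: "n \<le> D" using v(1,3) by (simp add: local_vector.thin_data_def)
  \<comment> \<open>The weight \<open>cc (j - 1)\<close> is the one carried by \<open>l j\<close> in
    \<open>uniform_relation\<close>. It gives \<open>\<delta> 1 = 0\<close>, and the hypothesis on
    the last level removes the term beyond \<open>n\<close>, so exactly the block on
    \<open>{2..n}\<close> acts.\<close>
  define \<delta> where "\<delta> j = complex_of_real (cc (j - 1) * (l j - l' j))" for j
  have "(\<Sum>j\<in>{2..n}. e k j * \<delta> j) = 0" if k: "k \<in> {2..n}" for k
  proof -
    have kD: "k \<in> {1..D}" using k nD by auto
    have r: "e_minus e k * of_real (cc (k - 2) * l (k - 1)) + of_real (cc (k - 1) * l k)
        + e_plus D e k * of_real (cc k * l (Suc k)) = f k"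
      by (rule local_vector.uniform_relation[OF v]) (use k in simp, use k in simp, rule rel[OF kD])
    have r': "e_minus e k * of_real (cc (k - 2) * l' (k - 1)) + of_real (cc (k - 1) * l' k)
        + e_plus D e k * of_real (cc k * l' (Suc k)) = f k"
      by (rule local_vector.uniform_relation[OF v']) (use k in simp, use k in simp, rule rel[OF kD])
    have "e_minus e k * \<delta> (k - 1) + \<delta> k + e_plus D e k * \<delta> (Suc k)
      = (e_minus e k * of_real (cc (k - 2) * l (k - 1)) + of_real (cc (k - 1) * l k)
          + e_plus D e k * of_real (cc k * l (Suc k)))
        - (e_minus e k * of_real (cc (k - 2) * l' (k - 1)) + of_real (cc (k - 1) * l' k)
          + e_plus D e k * of_real (cc k * l' (Suc k)))"
      using k by (simp add: \<delta>_def algebra_simps numeral_2_eq_2)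
    also have "\<dots> = 0" unfolding r r' by simp
    finally have sum0: "e_minus e k * \<delta> (k - 1) + \<delta> k + e_plus D e k * \<delta> (Suc k) = 0" .
    have "(\<Sum>j\<in>{2..n}. e k j * \<delta> j) = (\<Sum>j\<in>{k - 1, k, Suc k} \<inter> {2..n}. e k j * \<delta> j)"
    proof (rule sum.mono_neutral_right)
      show "\<forall>j\<in>{2..n} - {k - 1, k, Suc k} \<inter> {2..n}. e k j * \<delta> j = 0"
      proof
        fix j assume j: "j \<in> {2..n} - {k - 1, k, Suc k} \<inter> {2..n}"
        then have "k + 1 < j \<or> j + 1 < k" by auto
        moreover have "j \<in> {1..D}" using j nD by auto
        ultimately have "e k j = 0" using e kD unfolding parameter_matrix_def by blast
        then show "e k j * \<delta> j = 0" by simp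
      qed
    qed auto
    also have "\<dots> = (\<Sum>j\<in>{k - 1, k, Suc k}. if j \<in> {2..n} then e k j * \<delta> j else 0)"
      by (subst sum.inter_restrict) auto
    also have "\<dots> = (if k - 1 \<in> {2..n} then e k (k - 1) * \<delta> (k - 1) else 0) + e k k * \<delta> k
        + (if Suc k \<in> {2..n} then e k (Suc k) * \<delta> (Suc k) else 0)"
      using k by (cases k) (simp_all add: add.assoc)
    also have "(if k - 1 \<in> {2..n} then e k (k - 1) * \<delta> (k - 1) else 0) = e_minus e k * \<delta> (k - 1)"
    proof (cases "k = 2")
      case True then show ?thesis by (simp add: \<delta>_def)
    next
      case False then show ?thesis using k by (auto simp: e_minus_def)
    qed
    also have "e k k = 1" using e k nD by (auto simp: parameter_matrix_def)
    also have "(if Suc k \<in> {2..n} then e k (Suc k) * \<delta> (Suc k) else 0) = e_plus D e k * \<delta> (Suc k)"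
      using k last nD by (cases "k = n") (auto simp: e_plus_def \<delta>_def)
    finally show ?thesis using sum0 by simp
  qed
  moreover have "0 < cc (i - 1)" by (rule cc_pos) (use i nD in linarith)+
  then have "\<delta> i \<noteq> 0" using neq by (simp add: \<delta>_def)
  ultimately have "det_on {2..n} e = 0" using det_on_kernel[of "{2..n}" e \<delta> i] i by auto
  moreover have "det_on {2..n} e \<noteq> 0" using e i nD unfolding parameter_matrix_def by auto
  ultimately show False by simp
qed

end

section \<open>Explicit data for the four roots\<close>

context classical_drg
begin

text \<open>The value \<open>- 1 / q\<close> takes the place of \<open>g (k - 1)\<close> when \<open>k = 0\<close>.\<close>

lemma cc_param: "\<exists>\<delta>. g k = 1 + q * \<delta> \<and> cc k = (1 + q * \<delta>) * (1 + \<alpha> * \<delta>)"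
proof (cases k)
  case 0 then show ?thesis using q2 by (intro exI[of _ "- 1 / q"]) simp
next
  case (Suc j) then show ?thesis by (intro exI[of _ "g j"]) (simp add: cc_def gauss_Suc_left)
qed

lemma g_inj: "i < D \<Longrightarrow> g i \<noteq> g D"
  using g_strict[of i D] by simp

end

context local_vector
begin

text \<open>The data stop at \<open>D - 1\<close> because \<open>bb D = 0\<close> violates the
  nonvanishing condition at \<open>D\<close>.\<close>

lemma thin_data_neg_q:
  assumes "\<theta> = - q"
  shows "thin_data (D - 1) (\<lambda>_. q) bb"
  unfolding thin_data_def
proof (intro conjI allI impI)
  fix i assume i: "1 \<le> i \<and> i \<le> D - 1"
  then obtain k where k: "i = Suc k" by (cases i) auto
  obtain \<delta> where \<delta>: "g k = 1 + q * \<delta>" "cc k = (1 + q * \<delta>) * (1 + \<alpha> * \<delta>)" using cc_param by blast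
  show "bb (Suc i) = q * (aa (i - 1) - cc i + cc (i - 1) - cc i * q + cc (i - 1) * q)
        - (aa (Suc i) - bb i + bb (Suc i)) * q + bb i"
    unfolding k aa_def diff_Suc_1 \<delta>(2) unfolding cc_def bb_def diff_Suc_1 gauss_Suc_left \<delta>(1) by algebra
next
  show "bb i \<noteq> 0" if "2 \<le> i \<and> i \<le> D - 1" for i
  proof -
    have "i < D" using that D3 by linarith
    then show ?thesis using bb_pos by fastforce
  qed
qed (use assms in auto)

lemma thin_data_0:
  assumes "\<theta> = 0"
  shows "thin_data D (\<lambda>_. 0) (\<lambda>i. bb (i - 1))"
  unfolding thin_data_def
proof (intro conjI allI impI)
  show "bb (i - 1) \<noteq> 0" if "2 \<le> i \<and> i \<le> D" for i
  proof -
    have "i - 1 < D" using that by linarith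
    then show ?thesis using bb_pos by fastforce
  qed
qed (use assms in auto)

text \<open>The hypothesis on \<beta> is the nonvanishing of the factor
  \<open>\<beta> - \<alpha> * g i\<close> at \<open>i = D\<close>; below \<open>D\<close> positivity
  provides it.\<close>

lemma thin_data_t:
  assumes \<theta>: "\<theta> = \<alpha> * (g D - 1)" and neq: "\<beta> \<noteq> \<alpha> * g D"
  shows "thin_data D (\<lambda>i. - \<alpha> * (g D - g i) / (1 + \<alpha> * g (i - 1)))
    (\<lambda>i. (1 + \<alpha> * g (i - 1)) * (g D - g (i - 1)) * (\<beta> - \<alpha> * g i) / (1 + \<alpha> * g (i - 2)))" (is "thin_data D ?m ?l")
  unfolding thin_data_def
proof (intro conjI allI impI)
  \<comment> \<open>Multiplication by \<open>cc i\<close> cancels the denominator of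
    \<open>m i\<close>, so the bracket \<open>r\<close> below is polynomial and one division by
    \<open>A\<close> remains.\<close>
  have cm: "cc i * ?m i = - \<alpha> * (g D - g i) * g i" if "i \<le> D" for i
    using cc_factor_pos[of "i - 1"] that D3 by (cases i) (auto simp: cc_def)
  fix i assume i: "1 \<le> i \<and> i \<le> D"
  then obtain k where k: "i = Suc k" by (cases i) auto
  obtain \<delta> where \<delta>: "g k = 1 + q * \<delta>" "cc k = (1 + q * \<delta>) * (1 + \<alpha> * \<delta>)" using cc_param by blast
  define A where "A = 1 + \<alpha> * g k"
  have "k < D" using i k D3 by linarith
  then have A: "A \<noteq> 0" using cc_factor_pos[of k] by (simp add: A_def)
  define r where "r = aa k - cc i + cc k + \<alpha> * (g D - g i) * g i - \<alpha> * (g D - g k) * g k"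
  have r: "aa (i - 1) - cc i + cc (i - 1) - cc i * ?m i + cc (i - 1) * ?m (i - 1) = r"
    using cm[of i] cm[of k] i k by (simp add: r_def)
  have "(1 + \<alpha> * g i) * (g D - g i) * (\<beta> - \<alpha> * g (Suc i)) = - \<alpha> * (g D - g i) * (r - (aa (Suc i) - bb i + bb (Suc i))) + bb i * A"
    unfolding r_def k aa_def A_def diff_Suc_1 \<delta>(2) unfolding cc_def bb_def diff_Suc_1 gauss_Suc_left \<delta>(1) by algebra
  then have eq: "(1 + \<alpha> * g i) * (g D - g i) * (\<beta> - \<alpha> * g (Suc i)) / A = - \<alpha> * (g D - g i) / A * (r - (aa (Suc i) - bb i + bb (Suc i))) + bb i"
    using A by (simp add: field_simps)
  have l: "?l (Suc i) = (1 + \<alpha> * g i) * (g D - g i) * (\<beta> - \<alpha> * g (Suc i)) / A" and m: "?m i = - \<alpha> * (g D - g i) / A" by (simp_all add: A_def k)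
  have dist: "a * b - c * a + d = a * (b - c) + d" for a b c d :: real by algebra
  show "?l (Suc i) = ?m i * (aa (i - 1) - cc i + cc (i - 1) - cc i * ?m i + cc (i - 1) * ?m (i - 1))
        - (aa (Suc i) - bb i + bb (Suc i)) * ?m i + bb i"
    unfolding r unfolding l m eq dist ..
next
  fix i assume i: "2 \<le> i \<and> i \<le> D"
  obtain k where k: "i = Suc (Suc k)" using i by (intro that[of "i - 2"]) linarith
  have nz: "1 + \<alpha> * g (Suc k) \<noteq> 0" "1 + \<alpha> * g k \<noteq> 0" "g D - g (Suc k) \<noteq> 0"
    using cc_factor_pos[of "Suc k"] cc_factor_pos[of k] D3 g_inj[of "Suc k"] i k by auto
  have "\<beta> - \<alpha> * g i \<noteq> 0"
    using neq bb_factor_pos[of i] i by (cases "i = D") auto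
  then show "?l i \<noteq> 0" using nz k by simp
  show "?m i * ?l i = bb i * ?m (i - 1)" using nz k by (simp add: bb_def)
qed (use \<theta> in simp_all)

text \<open>The product \<open>\<alpha> * bb i\<close> is symmetric in \<open>\<alpha> * g D\<close>
  and \<beta>, and exchanging these two turns the data of \<open>thin_data_t\<close> into the
  present ones. The lowering scalar now vanishes at \<open>D\<close>.\<close>

lemma thin_data_b:
  assumes \<theta>: "\<theta> = \<beta> - \<alpha>"
  shows "thin_data (D - 1) (\<lambda>i. - (\<beta> - \<alpha> * g i) / (1 + \<alpha> * g (i - 1)))
    (\<lambda>i. (1 + \<alpha> * g (i - 1)) * (g D - g i) * (\<beta> - \<alpha> * g (i - 1)) / (1 + \<alpha> * g (i - 2)))" (is "thin_data _ ?m ?l")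
  unfolding thin_data_def
proof (intro conjI allI impI)
  have cm: "cc i * ?m i = - (\<beta> - \<alpha> * g i) * g i" if "i \<le> D" for i
    using cc_factor_pos[of "i - 1"] that D3 by (cases i) (auto simp: cc_def)
  fix i assume i: "1 \<le> i \<and> i \<le> D - 1"
  then obtain k where k: "i = Suc k" by (cases i) auto
  obtain \<delta> where \<delta>: "g k = 1 + q * \<delta>" "cc k = (1 + q * \<delta>) * (1 + \<alpha> * \<delta>)" using cc_param by blast
  define A where "A = 1 + \<alpha> * g k"
  have "k < D" using i k D3 by linarith
  then have A: "A \<noteq> 0" using cc_factor_pos[of k] by (simp add: A_def)
  define r where "r = aa k - cc i + cc k + (\<beta> - \<alpha> * g i) * g i - (\<beta> - \<alpha> * g k) * g k"
  have r: "aa (i - 1) - cc i + cc (i - 1) - cc i * ?m i + cc (i - 1) * ?m (i - 1) = r"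
  proof -
    have "i \<le> D" "k \<le> D" using i k by linarith+
    then show ?thesis using cm[of i] cm[of k] k by (simp add: r_def algebra_simps)
  qed
  have "(1 + \<alpha> * g i) * (g D - g (Suc i)) * (\<beta> - \<alpha> * g i) = - (\<beta> - \<alpha> * g i) * (r - (aa (Suc i) - bb i + bb (Suc i))) + bb i * A"
    unfolding r_def k aa_def A_def diff_Suc_1 \<delta>(2) unfolding cc_def bb_def diff_Suc_1 gauss_Suc_left \<delta>(1) by algebra
  then have eq: "(1 + \<alpha> * g i) * (g D - g (Suc i)) * (\<beta> - \<alpha> * g i) / A = - (\<beta> - \<alpha> * g i) / A * (r - (aa (Suc i) - bb i + bb (Suc i))) + bb i"
    using A by (simp add: field_simps)
  have l: "?l (Suc i) = (1 + \<alpha> * g i) * (g D - g (Suc i)) * (\<beta> - \<alpha> * g i) / A" and m: "?m i = - (\<beta> - \<alpha> * g i) / A" by (simp_all add: A_def k)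
  have dist: "a * b - c * a + d = a * (b - c) + d" for a b c d :: real by algebra
  show "?l (Suc i) = ?m i * (aa (i - 1) - cc i + cc (i - 1) - cc i * ?m i + cc (i - 1) * ?m (i - 1))
        - (aa (Suc i) - bb i + bb (Suc i)) * ?m i + bb i"
    unfolding r unfolding l m eq dist ..
next
  fix i assume i: "2 \<le> i \<and> i \<le> D - 1"
  obtain k where k: "i = Suc (Suc k)" using i by (intro that[of "i - 2"]) linarith
  have "Suc (Suc k) < D" using i k D3 by linarith
  then have nz: "1 + \<alpha> * g (Suc k) \<noteq> 0" "1 + \<alpha> * g k \<noteq> 0" "g D - g i \<noteq> 0" "\<beta> - \<alpha> * g (Suc k) \<noteq> 0"
    using cc_factor_pos[of "Suc k"] cc_factor_pos[of k] D3 g_inj[of i] bb_factor_pos[of "Suc k"] k by auto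
  then show "?l i \<noteq> 0" using k by simp
  show "?m i * ?l i = bb i * ?m (i - 1)" using nz k by (simp add: bb_def) (simp add: algebra_simps)
qed (use \<theta> in simp_all)

end

section \<open>Excluded pairs of roots\<close>

context based_drg
begin

text \<open>Both lowering scalars vanish at level \<open>D\<close>, so the data are comparable.
  Level two already forces \<open>q + \<beta> - \<alpha> = 0\<close>, whereas
  \<open>\<beta> - \<alpha>\<close> is positive.\<close>

lemma no_pair_neg_q_b:
  assumes uniform: "supports_uniform_structure E x" and \<alpha>: "\<alpha> \<noteq> 0"
    and v: "local_vector E D q \<alpha> \<beta> x v (- q)" "local_vector.thin_vector E D x v"
    and v': "local_vector E D q \<alpha> \<beta> x v' (\<beta> - \<alpha>)" "local_vector.thin_vector E D x v'"
  shows False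
proof -
  let ?l = "\<lambda>i. (1 + \<alpha> * g (i - 1)) * (g D - g i) * (\<beta> - \<alpha> * g (i - 1)) / (1 + \<alpha> * g (i - 2))"
  have "bb 2 = ?l 2"
    by (rule uniform_pair[OF uniform v local_vector.thin_data_neg_q[OF v(1) refl]
          v' local_vector.thin_data_b[OF v'(1) refl]]) (use D3 in auto)
  then have "(g D - g 2) * (\<beta> - \<alpha> * g 2) = (g D - g 2) * ((1 + \<alpha>) * (\<beta> - \<alpha>))"
    by (simp add: bb_def)
  then have "\<beta> - \<alpha> * g 2 = (1 + \<alpha>) * (\<beta> - \<alpha>)" using g_inj[of 2] D3 by simp
  moreover have "g 2 = 1 + q" by (simp add: numeral_2_eq_2 gauss_Suc_left)
  ultimately have "\<alpha> * (q + (\<beta> - \<alpha>)) = 0" by algebra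
  then show False using \<alpha> q2 bb_factor_pos[of 1] D3 by simp
qed

text \<open>Level two alone only yields \<open>\<beta> = \<alpha> (1 + q) + q\<close>; with this
  value level three leaves \<open>\<alpha>^2 q (1 + q) = 0\<close>.\<close>

lemma no_pair_0_t:
  assumes uniform: "supports_uniform_structure E x" and \<alpha>: "\<alpha> \<noteq> 0" and neq: "\<beta> \<noteq> \<alpha> * g D"
    and v: "local_vector E D q \<alpha> \<beta> x v 0" "local_vector.thin_vector E D x v"
    and v': "local_vector E D q \<alpha> \<beta> x v' (\<alpha> * (g D - 1))" "local_vector.thin_vector E D x v'"
  shows False
proof -
  let ?l = "\<lambda>i. (1 + \<alpha> * g (i - 1)) * (g D - g (i - 1)) * (\<beta> - \<alpha> * g i) / (1 + \<alpha> * g (i - 2))"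
  have l: "bb (i - 1) = ?l i" if "2 \<le> i" "i \<le> D" for i
    by (rule uniform_pair[OF uniform v local_vector.thin_data_0[OF v(1) refl]
          v' local_vector.thin_data_t[OF v'(1) refl neq]]) (use that in auto)
  have g: "g 2 = 1 + q" "g 3 = 1 + q + q\<^sup>2"
    by (simp_all add: numeral_2_eq_2 numeral_3_eq_3 gauss_Suc_left power2_eq_square algebra_simps)
  have "(g D - 1) * (\<beta> - \<alpha>) = (g D - 1) * ((1 + \<alpha>) * (\<beta> - \<alpha> * g 2))"
    using l[of 2] D3 by (simp add: bb_def)
  then have 2: "\<beta> - \<alpha> = (1 + \<alpha>) * (\<beta> - \<alpha> * g 2)" using g_inj[of 1] D3 by simp
  have "(g D - g 2) * (\<beta> - \<alpha> * g 2) * (1 + \<alpha>) = (g D - g 2) * ((1 + \<alpha> * g 2) * (\<beta> - \<alpha> * g 3))"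
    using l[of 3] D3 cc_factor_pos[of 1] by (simp add: bb_def field_simps)
  then have 3: "(1 + \<alpha>) * (\<beta> - \<alpha> * g 2) = (1 + \<alpha> * g 2) * (\<beta> - \<alpha> * g 3)"
    using g_inj[of 2] D3 by (simp add: mult.assoc mult.commute)
  have "\<alpha> * (\<beta> - \<alpha> * (1 + q) - q) = 0" using 2 unfolding g by algebra
  then have "\<beta> = \<alpha> * (1 + q) + q" using \<alpha> by simp
  then have "\<alpha>\<^sup>2 * (q * (1 + q)) = 0" using 3 unfolding g by algebra
  then show False using \<alpha> q2 by simp
qed

end

section \<open>The local graph\<close>

context based_drg
begin

text \<open>The shift by the identity turns the local eigenvalue \<open>\<theta> - 1\<close> into \<open>\<theta>\<close>.\<close>

definition Nop :: "complex^'a \<Rightarrow> complex^'a" where "Nop w = lev (Suc 0) (adj w) + w"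

text \<open>The product \<open>(N - r) (N - s)\<close>, where \<open>N\<close> is the local
  adjacency matrix plus the identity.\<close>

definition Gop :: "real \<Rightarrow> real \<Rightarrow> complex^'a \<Rightarrow> complex^'a" where
  "Gop r s w = Nop (Nop w) - (r + s) *\<^sub>R Nop w + (r * s) *\<^sub>R w"

lemma Nop_linear: "Nop (v + w) = Nop v + Nop w" "Nop (v - w) = Nop v - Nop w"
  "Nop (a *\<^sub>R w) = a *\<^sub>R Nop w" "Nop (c *s w) = c *s Nop w"
  by (simp_all add: Nop_def op_linear lev_smult adj_smult vector_add_ldistrib algebra_simps)

lemma Gop_diff: "Gop r s (v - w) = Gop r s v - Gop r s w"
  by (simp add: Gop_def Nop_linear algebra_simps)

lemma lev_Nop: "lev (Suc 0) w = w \<Longrightarrow> lev (Suc 0) (Nop w) = Nop w"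
  by (simp add: Nop_def op_linear)

lemma lev_Gop: "lev (Suc 0) w = w \<Longrightarrow> lev (Suc 0) (Gop r s w) = Gop r s w"
  by (simp add: Gop_def op_linear lev_Nop)

lemma inner_Gop:
  assumes "lev (Suc 0) v = v" "lev (Suc 0) w = w"
  shows "inner (Gop r s v) w = inner v (Gop r s w)"
proof -
  have "inner (Nop v) w = inner v (Nop w)" if "lev (Suc 0) v = v" "lev (Suc 0) w = w" for v w
    using that inner_lev[of "Suc 0" "adj v" w] inner_adj[of v w] inner_lev[of "Suc 0" v "adj w"]
    by (simp add: Nop_def inner_add_left inner_add_right)
  then show ?thesis using assms lev_Nop
    by (simp add: Gop_def inner_add_left inner_add_right inner_diff_left inner_diff_right)
qed

text \<open>Summing over the neighbours of \<open>x\<close> is evaluating \<open>act (Suc 0)\<close>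
  at \<open>x\<close>, and this commutes with \<open>adj\<close>.\<close>

lemma sum_Nop:
  assumes w: "lev (Suc 0) w = w"
  shows "(\<Sum>z\<in>UNIV. Nop w $ z) = (aa 1 + 1) *\<^sub>R (\<Sum>z\<in>UNIV. w $ z)"
proof -
  have w0: "w $ z = 0" if "gdist E x z \<noteq> Suc 0" for z using w that by (metis lev_nth)
  have act: "act j w $ x = (if j = Suc 0 then \<Sum>z\<in>UNIV. w $ z else 0)" for j
  proof -
    have "(if gdist E x z = j then 1 else 0) *\<^sub>R w $ z = (if j = Suc 0 then w $ z else 0)" for z
      using w0[of z] by (cases "gdist E x z = Suc 0") auto
    then show ?thesis by (simp add: bm_def)
  qed
  have "(\<Sum>z\<in>UNIV. lev (Suc 0) (adj w) $ z) = act (Suc 0) (adj w) $ x"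
    unfolding bm_def vec_lambda_beta by (intro sum.cong) auto
  also have "act (Suc 0) (adj w) = adj (act (Suc 0) w)" by (simp only: adj_bm bm_adj)
  also have "\<dots> $ x = aa 1 *\<^sub>R (\<Sum>z\<in>UNIV. w $ z)"
    unfolding adj_act using act act[of 0] by simp
  finally show ?thesis by (simp add: Nop_def sum.distrib scaleR_add_left)
qed

lemma sum_Gop:
  assumes w: "lev (Suc 0) w = w"
  shows "(\<Sum>z\<in>UNIV. Gop r s w $ z) = ((aa 1 + 1 - r) * (aa 1 + 1 - s)) *\<^sub>R (\<Sum>z\<in>UNIV. w $ z)"
proof -
  have "(\<Sum>z\<in>UNIV. Gop r s w $ z) = (\<Sum>z\<in>UNIV. Nop (Nop w) $ z) - (r + s) *\<^sub>R (\<Sum>z\<in>UNIV. Nop w $ z)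
      + (r * s) *\<^sub>R (\<Sum>z\<in>UNIV. w $ z)"
    by (simp add: Gop_def sum.distrib sum_subtractf scaleR_sum_right)
  also have "\<dots> = ((aa 1 + 1 - r) * (aa 1 + 1 - s)) *\<^sub>R (\<Sum>z\<in>UNIV. w $ z)"
  proof -
    have "a *\<^sub>R a *\<^sub>R S - (r + s) *\<^sub>R a *\<^sub>R S + (r * s) *\<^sub>R S = ((a - r) * (a - s)) *\<^sub>R S"
      for a :: real and S :: complex by (simp add: algebra_simps)
    then show ?thesis unfolding sum_Nop[OF lev_Nop[OF w]] sum_Nop[OF w] by (simp only:)
  qed
  finally show ?thesis .
qed

definition local_roots :: "real \<Rightarrow> real \<Rightarrow> bool" where
  "local_roots r s \<longleftrightarrow> (\<forall>v. good v \<longrightarrow> (\<exists>\<theta>\<in>{r, s}. lev (Suc 0) (adj v) = (\<theta> - 1) *\<^sub>R v))"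

text \<open>\<open>Gop r s\<close> is self-adjoint and kills all good vectors, so the image of
  \<open>f\<close> is orthogonal to them; it again has sum zero.\<close>

lemma Gop_eq_0:
  assumes roots: "local_roots r s" and f: "lev (Suc 0) f = f" "(\<Sum>z\<in>UNIV. f $ z) = 0"
  shows "Gop r s f = 0"
proof (rule orthogonal_good_eq_0)
  show "lev (Suc 0) (Gop r s f) = Gop r s f" using f by (simp add: lev_Gop)
  show "(\<Sum>z\<in>UNIV. Gop r s f $ z) = 0" unfolding sum_Gop[OF f(1)] f(2) by simp
  fix v assume v: "good v"
  then obtain \<theta> where \<theta>: "\<theta> \<in> {r, s}" "lev (Suc 0) (adj v) = (\<theta> - 1) *\<^sub>R v"
    using roots unfolding local_roots_def by blast
  have "Nop v = \<theta> *\<^sub>R v" by (simp add: Nop_def \<theta>(2) algebra_simps)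
  then have "Gop r s v = ((\<theta> - r) * (\<theta> - s)) *\<^sub>R v"
    by (simp add: Gop_def Nop_linear algebra_simps)
  then have "Gop r s v = 0" using \<theta>(1) by auto
  then show "inner (Gop r s f) v = 0" using inner_Gop[OF f(1)] v by (simp add: good_def)
qed

lemma Nop_nth: "Nop w $ u = (if gdist E x u = Suc 0 then \<Sum>t | (u, t) \<in> E. w $ t else 0) + w $ u"
  by (simp add: Nop_def adj_def)

lemma lev_axis: "gdist E x y = Suc 0 \<Longrightarrow> lev (Suc 0) (axis y 1) = axis y 1"
  by (simp add: vec_eq_iff axis_def)

abbreviation common :: "'a \<Rightarrow> 'a \<Rightarrow> 'a set" where
  "common u y \<equiv> {t. (u, t) \<in> E \<and> gdist E x t = Suc 0 \<and> (t, y) \<in> E}"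

lemma Nop_axis:
  assumes "gdist E x u = Suc 0"
  shows "Nop (axis y 1) $ u = (if (u, y) \<in> E then 1 else 0) + (if u = y then 1 else 0)"
  using assms by (simp add: Nop_nth axis_def sum.If_cases Int_def conj_commute) 

lemma Gop_axis:
  assumes u: "gdist E x u = Suc 0" and y: "gdist E x y = Suc 0"
  shows "Gop r s (axis y 1) $ u = of_real (real (card (common u y)) + (2 - (r + s)) * (if (u, y) \<in> E then 1 else 0)
     + (1 - (r + s) + r * s) * (if u = y then 1 else 0))"
proof -
  have "Nop (axis y 1) $ t = (if gdist E x t = Suc 0 \<and> (t, y) \<in> E then 1 else 0) + (if t = y then 1 else 0)" for t
  proof (cases "gdist E x t = Suc 0")
    case True then show ?thesis using Nop_axis[of t y] by simp
  next
    case False then show ?thesis using y by (auto simp: Nop_nth axis_def)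
  qed
  then have "(\<Sum>t | (u, t) \<in> E. Nop (axis y 1) $ t) = of_nat (card (common u y)) + (if (u, y) \<in> E then 1 else 0)"
    by (simp add: sum.distrib sum.If_cases Int_def)
  then have NN: "Nop (Nop (axis y 1)) $ u
      = of_nat (card (common u y)) + (if (u, y) \<in> E then 1 else 0) + Nop (axis y 1) $ u"
    using u by (simp add: Nop_nth[of "Nop _"])
  have G: "Gop r s w $ u = Nop (Nop w) $ u - of_real (r + s) * Nop w $ u + of_real (r * s) * w $ u" for w
    unfolding Gop_def vector_add_component vector_minus_component vector_scaleR_component
    by (simp only: scaleR_conv_of_real)
  have ax: "(axis y 1 :: complex^'a) $ u = (if u = y then 1 else 0)" by (simp add: axis_def)
  show ?thesis
    unfolding G NN ax Nop_axis[OF u] using edge_irrefl[of y] by (auto simp: algebra_simps)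
qed

lemma common_self:
  assumes "gdist E x y = Suc 0"
  shows "real (card (common y y)) = aa 1"
proof -
  have "common y y = {w. (y, w) \<in> E \<and> gdist E w x = Suc 0}" using edge_sym gdist_sym[of x] by auto
  then show ?thesis using card_nbr_a[of y x "Suc 0"] assms gdist_sym[of x] by simp
qed

lemma card_local: "real (card {z. gdist E x z = Suc 0}) = bb 0"
proof -
  have "{z. gdist E x z = Suc 0} = {z. (x, z) \<in> E}" using gdist_edge[of x] by auto
  then show ?thesis using card_nbr by simp
qed

lemma ex_local: "\<exists>y. gdist E x y = Suc 0"
proof (rule ccontr)
  assume "\<not> ?thesis"
  then have "{z. gdist E x z = Suc 0} = {}" by auto
  then have "bb 0 = 0" using card_local by simp
  then show False using bb_pos[of 0] D3 by simp
qed

text \<open>All columns of \<open>Gop r s\<close> agree, so every entry equals the diagonal entry of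
  its row, which is \<open>c\<close>. Column sums give the first claim, off-diagonal entries the
  second.\<close>

lemma local_quadratic:
  assumes roots: "local_roots r s"
  defines "c \<equiv> aa 1 + 1 - (r + s) + r * s"
  shows "bb 0 * c = (aa 1 + 1 - r) * (aa 1 + 1 - s)"
    and "\<And>u y. gdist E x u = Suc 0 \<Longrightarrow> gdist E x y = Suc 0 \<Longrightarrow> u \<noteq> y \<Longrightarrow>
      real (card (common u y)) = (if (u, y) \<in> E then r + s - 2 else 0) + c"
proof -
  have const: "Gop r s (axis y 1) $ u = of_real c"
    if u: "gdist E x u = Suc 0" and y: "gdist E x y = Suc 0" for u y
  proof -
    \<comment> \<open>A difference of two basis vectors is the simplest zero-sum vector, and
      \<open>Gop r s\<close> annihilates it.\<close>
    have "(\<Sum>z\<in>UNIV. (axis y 1 - axis u 1 :: complex^'a) $ z) = 0"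
      by (simp add: sum_subtractf axis_def)
    then have "Gop r s (axis y 1 - axis u 1) = 0"
      by (intro Gop_eq_0[OF roots]) (simp_all add: lev_diff lev_axis u y)
    then have "Gop r s (axis y 1) $ u = Gop r s (axis u 1) $ u" by (simp add: Gop_diff)
    also have "\<dots> = of_real c"
      using Gop_axis[OF u u] common_self[OF u] edge_irrefl[of u] by (simp add: c_def)
    finally show ?thesis .
  qed
  show "real (card (common u y)) = (if (u, y) \<in> E then r + s - 2 else 0) + c"
    if "gdist E x u = Suc 0" "gdist E x y = Suc 0" "u \<noteq> y" for u y
  proof -
    have "complex_of_real (real (card (common u y)) + (2 - (r + s)) * (if (u, y) \<in> E then 1 else 0)) = of_real c"
      using const[OF that(1,2)] Gop_axis[OF that(1,2), of r s] \<open>u \<noteq> y\<close> by simp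
    then have "real (card (common u y)) + (2 - (r + s)) * (if (u, y) \<in> E then 1 else 0) = c"
      by (simp only: of_real_eq_iff)
    then show ?thesis by (auto simp: algebra_simps)
  qed
  obtain y where y: "gdist E x y = Suc 0" using ex_local by blast
  have "(\<Sum>z\<in>UNIV. Gop r s (axis y 1) $ z) = (\<Sum>z | gdist E x z = Suc 0. of_real c)"
  proof -
    have "Gop r s (axis y 1) $ z = (if gdist E x z = Suc 0 then of_real c else 0)" for z
      using lev_Gop[OF lev_axis[OF y], of r s] const[OF _ y, of z] by (metis lev_nth)
    then show ?thesis by (simp add: sum.If_cases)
  qed
  also have "\<dots> = of_real (real (card {z. gdist E x z = Suc 0}) * c)" by simp
  also have "\<dots> = of_real (bb 0 * c)" unfolding card_local ..
  finally have "complex_of_real (bb 0 * c) = of_real ((aa 1 + 1 - r) * (aa 1 + 1 - s))"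
    unfolding sum_Gop[OF lev_axis[OF y]] by (simp add: axis_def scaleR_conv_of_real)
  then show "bb 0 * c = (aa 1 + 1 - r) * (aa 1 + 1 - s)" by (simp only: of_real_eq_iff)
qed

lemma local_roots_sym: "local_roots r s \<Longrightarrow> local_roots s r"
  unfolding local_roots_def by blast

lemma aa_1: "aa 1 + 1 = \<beta> + \<alpha> * (g D - 1)"
  by (simp add: aa_def bb_def algebra_simps)

lemma \<beta>_pos: "0 < \<beta>" and g_D: "1 < g D"
  using bb_factor_pos[of 0] g_strict[of 1 D] D3 by simp_all

text \<open>The common factor \<open>\<alpha> * g D\<close> cancels, which leaves
  \<open>bb 0 = aa 1 + 1\<close>, that is, \<open>bb 1 = 0\<close>.\<close>

lemma no_roots_0_b:
  assumes roots: "local_roots 0 (\<beta> - \<alpha>)" and "\<alpha> \<noteq> 0"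
  shows False
proof -
  have "bb 0 * (\<alpha> * g D) = (\<beta> + \<alpha> * (g D - 1)) * (\<alpha> * g D)"
    using local_quadratic(1)[OF roots] unfolding aa_1 by (simp add: algebra_simps)
  then have "bb 0 = \<beta> + \<alpha> * (g D - 1)" using \<open>\<alpha> \<noteq> 0\<close> g_D by simp
  moreover have "0 < bb 1" using bb_pos[of 1] D3 by simp
  ultimately show False using aa_1 by (simp add: aa_def)
qed

text \<open>The equation reduces to the vanishing of the product of the two roots, and neither is
  zero.\<close>

lemma no_roots_b_t:
  assumes roots: "local_roots (\<beta> - \<alpha>) (\<alpha> * (g D - 1))" and "\<alpha> \<noteq> 0"
  shows False
proof -
  let ?b = "\<beta> - \<alpha>" and ?t = "\<alpha> * (g D - 1)"
  have "g D * \<beta> * (\<alpha> + ?b * ?t) = \<beta> * (\<alpha> * g D)"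
    using local_quadratic(1)[OF roots] unfolding aa_1 by (simp add: bb_def algebra_simps)
  then have "g D * \<beta> * (?b * ?t) = 0" by (simp add: algebra_simps)
  moreover have "0 < ?b" using bb_factor_pos[of 1] D3 by simp
  ultimately show False using \<open>\<alpha> \<noteq> 0\<close> g_D \<beta>_pos by simp
qed

lemma no_roots_neg_q_0:
  assumes roots: "local_roots (- q) 0"
  shows False
proof -
  have "bb 0 * (aa 1 + 1 + q) = (aa 1 + 1) * (aa 1 + 1 + q)"
    using local_quadratic(1)[OF roots] by (simp add: algebra_simps)
  moreover have "0 < aa 1 + 1 + q" using aa_nonneg[of 1] D3 q2 by simp
  ultimately have "bb 0 = aa 1 + 1" by simp
  then show False using bb_pos[of 1] D3 by (simp add: aa_def)
qed

text \<open>The excluded pairs leave at most two roots in every case, so the quadratic equation can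
  decide.\<close>

lemma local_roots_uniform:
  assumes thin1: "\<And>W. module_1 W \<Longrightarrow> thin E x W"
    and uniform: "supports_uniform_structure E x" and \<alpha>: "\<alpha> \<noteq> 0"
  shows "local_roots (- q) (\<alpha> * (g D - 1))"
proof -
  define S where "S \<theta> \<longleftrightarrow> (\<exists>v. local_vector E D q \<alpha> \<beta> x v \<theta> \<and> local_vector.thin_vector E D x v)" for \<theta>
  let ?t = "\<alpha> * (g D - 1)" and ?b = "\<beta> - \<alpha>"
  have S4: "\<theta> = 0 \<or> \<theta> = ?t \<or> \<theta> = ?b \<or> \<theta> = - q" if S: "S \<theta>" for \<theta>
  proof -
    obtain v where v: "local_vector E D q \<alpha> \<beta> x v \<theta>" "local_vector.thin_vector E D x v"
      using S S_def by blast
    interpret local_vector E D q \<alpha> \<beta> x v \<theta> by (rule v(1))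
    have "\<exists>\<mu>. M 2 = \<mu> *s P 2" if "P 2 \<noteq> 0" using v(2) that D3 unfolding thin_vector_def by simp
    then show ?thesis by (rule local_eigenvalue)
  qed
  have roots: "local_roots r s" if rs: "\<And>\<theta>. S \<theta> \<Longrightarrow> \<theta> = r \<or> \<theta> = s" for r s
    unfolding local_roots_def
  proof (intro allI impI)
    fix v assume "good v"
    then obtain \<theta> where v: "local_vector E D q \<alpha> \<beta> x v \<theta>" "local_vector.thin_vector E D x v"
      using good_local_vector thin1 by blast
    then have "\<theta> \<in> {r, s}" using rs S_def by auto
    then show "\<exists>\<theta>\<in>{r, s}. lev (Suc 0) (adj v) = (\<theta> - 1) *\<^sub>R v"
      using local_vector.eigen[OF v(1)] by blast
  qed
  have qb: "\<not> (S (- q) \<and> S ?b)" using no_pair_neg_q_b[OF uniform \<alpha>] unfolding S_def by blast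
  have t0: "\<not> (S 0 \<and> S ?t)" if "?t \<noteq> ?b"
  proof -
    have "\<beta> \<noteq> \<alpha> * g D" using that by (auto simp: algebra_simps)
    then show ?thesis using no_pair_0_t[OF uniform \<alpha>] unfolding S_def by blast
  qed
  have nb: "\<not> S ?b"
  proof
    assume b: "S ?b"
    then have nq: "\<not> S (- q)" using qb by blast
    \<comment> \<open>If \<open>?t = ?b\<close>, the pair with root 0 is not excluded, but the two
      coinciding values count as one root.\<close>
    consider "\<not> S 0" | "?t = ?b" | "\<not> S ?t" using t0 by blast
    then show False
    proof cases
      case 1
      then have "local_roots ?b ?t" using S4 nq by (intro roots) blast
      then show ?thesis using no_roots_b_t \<alpha> by blast
    next
      case 2
      then have "local_roots 0 ?b" using S4 nq by (intro roots) metis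
      then show ?thesis using no_roots_0_b \<alpha> by blast
    next
      case 3
      then have "local_roots 0 ?b" using S4 nq by (intro roots) metis
      then show ?thesis using no_roots_0_b \<alpha> by blast
    qed
  qed
  show ?thesis
  proof (cases "S 0")
    case True
    then have "\<not> S ?t" using t0 nb by metis
    then have "local_roots (- q) 0" using S4 nb by (intro roots) metis
    then show ?thesis using no_roots_neg_q_0 by blast
  next
    case False
    then show ?thesis using S4 nb by (intro roots) metis
  qed
qed

section \<open>Consequences of the surviving pair of roots\<close>

context
  assumes roots: "local_roots (- q) (\<alpha> * (g D - 1))" and \<alpha>: "\<alpha> \<noteq> 0"
begin

text \<open>As \<open>bb 0 = g D * \<beta>\<close>, the equation is divisible by \<beta>; what
  remains has the nonzero factor \<open>g D - 1\<close> and is otherwise linear in \<beta>.\<close>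

lemma \<beta>_eq: "\<beta> = \<alpha> * (1 + q * g D) - q"
proof -
  have "\<beta> * (g D * (\<beta> + q - q * (\<alpha> * (g D - 1)))) = \<beta> * (\<beta> + \<alpha> * (g D - 1) + q)"
    using local_quadratic(1)[OF roots] unfolding aa_1 by (simp add: bb_def algebra_simps)
  then have "g D * (\<beta> + q - q * (\<alpha> * (g D - 1))) = \<beta> + \<alpha> * (g D - 1) + q"
    using \<beta>_pos by simp
  then have "(g D - 1) * (\<beta> + q - \<alpha> * (1 + q * g D)) = 0" by algebra
  then show ?thesis using g_D by simp
qed

lemma card_common:
  assumes "gdist E x u = Suc 0" "gdist E x y = Suc 0" "u \<noteq> y"
  shows "real (card (common u y)) = (if (u, y) \<in> E then \<alpha> * (g D - 1) - q - 2 else 0) + \<alpha> * (1 + q)"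
proof -
  have "aa 1 + 1 - (- q + \<alpha> * (g D - 1)) + - q * (\<alpha> * (g D - 1)) = \<alpha> * (1 + q)"
    unfolding aa_1 by (subst \<beta>_eq) (simp add: algebra_simps)
  then show ?thesis using local_quadratic(2)[OF roots assms] by (simp only:) simp
qed

text \<open>The local graph is neither complete nor empty: \<open>bb 1 > 0\<close> gives a
  non-neighbour, and the nonzero number of common neighbours then gives a neighbour.\<close>

lemma ex_local_triple:
  obtains y z z' where "gdist E x y = Suc 0" "gdist E x z = Suc 0" "gdist E x z' = Suc 0"
    "(y, z) \<in> E" "(y, z') \<notin> E" "y \<noteq> z'"
proof -
  obtain y where y: "gdist E x y = Suc 0" using ex_local by blast
  let ?G = "{z. gdist E x z = Suc 0}"
  have "real (card (insert y (common y y))) = aa 1 + 1"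
    using common_self[OF y] edge_irrefl[of y] by simp
  moreover have "0 < bb 1" using bb_pos[of 1] D3 by simp
  ultimately have "card (insert y (common y y)) < card ?G"
    using card_local by (simp add: aa_def flip: of_nat_less_iff)
  then have "\<not> ?G \<subseteq> insert y (common y y)" using card_mono[of "insert y (common y y)" ?G] by auto
  then obtain z' where z': "gdist E x z' = Suc 0" "(y, z') \<notin> E" "y \<noteq> z'" using edge_sym by auto
  have "\<alpha> * (1 + q) \<noteq> 0" using \<alpha> q2 by simp
  then have "real (card (common y z')) \<noteq> 0" using card_common[OF y z'(1,3)] z'(2) by simp
  then have "common y z' \<noteq> {}" by (intro notI) (simp only: card.empty of_nat_0)
  then obtain z where "(y, z) \<in> E" "gdist E x z = Suc 0" by blast
  then show ?thesis using that y z' by blast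
qed

end

subsection \<open>Spectrum and parameters\<close>

lemma local_verts_iff: "y \<in> local_verts E x \<longleftrightarrow> gdist E x y = Suc 0"
  using gdist_edge[of x y] by (simp add: local_verts_def)

lemma local_edges_iff:
  "(y, z) \<in> local_edges E x \<longleftrightarrow> (y, z) \<in> E \<and> gdist E x y = Suc 0 \<and> gdist E x z = Suc 0"
  by (auto simp: local_edges_def local_verts_iff)

lemma local_nbrs:
  assumes "gdist E x y = Suc 0"
  shows "{w \<in> local_verts E x. (y, w) \<in> local_edges E x} = common y y"
  using assms edge_sym by (auto simp: local_verts_iff local_edges_iff)

lemma local_common_nbrs:
  assumes "gdist E x y = Suc 0" "gdist E x z = Suc 0"
  shows "{w \<in> local_verts E x. (y, w) \<in> local_edges E x \<and> (z, w) \<in> local_edges E x} = common y z"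
  using assms edge_sym by (auto simp: local_verts_iff local_edges_iff)

lemma local_eigenvalue_iff:
  "\<mu> \<in> graph_eigenvalues (local_verts E x) (local_edges E x) \<longleftrightarrow>
    (\<exists>f. f \<noteq> 0 \<and> lev (Suc 0) f = f \<and> Nop f = (\<mu> + 1) *s f)"
proof -
  have sum: "(\<Sum>z\<in>local_verts E x. (if (y, z) \<in> local_edges E x then 1 else 0) * v z)
      = (\<Sum>t | (y, t) \<in> E. f $ t)"
    if y: "gdist E x y = Suc 0" and f: "\<And>z. f $ z = (if gdist E x z = Suc 0 then v z else 0)"
    for y v and f :: "complex^'a"
  proof -
    have "(\<Sum>z\<in>local_verts E x. (if (y, z) \<in> local_edges E x then 1 else 0) * v z)
        = (\<Sum>z\<in>local_verts E x. if (y, z) \<in> E then f $ z else 0)"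
      using y f by (intro sum.cong) (auto simp: local_edges_iff local_verts_iff)
    also have "\<dots> = (\<Sum>z\<in>UNIV. if (y, z) \<in> E then f $ z else 0)"
      using f by (intro sum.mono_neutral_left) (auto simp: local_verts_iff)
    also have "\<dots> = (\<Sum>t | (y, t) \<in> E. f $ t)" by (simp add: sum.If_cases)
    finally show ?thesis .
  qed
  show ?thesis
  proof
    assume "\<mu> \<in> graph_eigenvalues (local_verts E x) (local_edges E x)"
    then obtain v y where v: "y \<in> local_verts E x" "v y \<noteq> 0"
      "\<And>y. y \<in> local_verts E x \<Longrightarrow>
        (\<Sum>z\<in>local_verts E x. (if (y, z) \<in> local_edges E x then 1 else 0) * v z) = \<mu> * v y"
      by (auto simp: graph_eigenvalues_def)
    define f :: "complex^'a" where "f = (\<chi> z. if gdist E x z = Suc 0 then v z else 0)"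
    have f: "f $ z = (if gdist E x z = Suc 0 then v z else 0)" for z by (simp add: f_def)
    have "Nop f $ u = ((\<mu> + 1) *s f) $ u" for u
      using v(3)[of u] sum[of u f v] f by (simp add: Nop_nth local_verts_iff distrib_right)
    then have "Nop f = (\<mu> + 1) *s f" by (simp only: vec_eq_iff) simp
    moreover have "f \<noteq> 0" using v(1,2) f by (metis local_verts_iff zero_index)
    moreover have "lev (Suc 0) f = f" by (simp add: vec_eq_iff f)
    ultimately show "\<exists>f. f \<noteq> 0 \<and> lev (Suc 0) f = f \<and> Nop f = (\<mu> + 1) *s f" by blast
  next
    assume "\<exists>f. f \<noteq> 0 \<and> lev (Suc 0) f = f \<and> Nop f = (\<mu> + 1) *s f"
    then obtain f where f: "f \<noteq> 0" "lev (Suc 0) f = f" "Nop f = (\<mu> + 1) *s f" by blast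
    have f0: "f $ z = (if gdist E x z = Suc 0 then f $ z else 0)" for z using f(2) by (metis lev_nth)
    obtain y where y: "f $ y \<noteq> 0" using f(1) by (auto simp: vec_eq_iff)
    have "y \<in> local_verts E x" using f0[of y] y by (auto simp: local_verts_iff split: if_splits)
    moreover have "(\<Sum>z\<in>local_verts E x. (if (u, z) \<in> local_edges E x then 1 else 0) * f $ z) = \<mu> * f $ u"
      if "u \<in> local_verts E x" for u
    proof -
      have u: "gdist E x u = Suc 0" using that by (simp add: local_verts_iff)
      have "(\<Sum>t | (u, t) \<in> E. f $ t) + f $ u = (\<mu> + 1) * f $ u"
        using arg_cong[OF f(3), of "\<lambda>w. w $ u"] u by (simp add: Nop_nth distrib_right)
      then show ?thesis using sum[OF u f0] by (simp add: algebra_simps)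
    qed
    ultimately show "\<mu> \<in> graph_eigenvalues (local_verts E x) (local_edges E x)"
      using y unfolding graph_eigenvalues_def by blast
  qed
qed

lemma aa_1_eigenvalue: "of_real (aa 1) \<in> graph_eigenvalues (local_verts E x) (local_edges E x)"
proof -
  define f :: "complex^'a" where "f = (\<chi> z. if gdist E x z = Suc 0 then 1 else 0)"
  have f: "f $ z = (if gdist E x z = Suc 0 then 1 else 0)" for z by (simp add: f_def)
  have "Nop f $ u = ((of_real (aa 1) + 1) *s f) $ u" for u
  proof (cases "gdist E x u = Suc 0")
    case True
    have "(\<Sum>t | (u, t) \<in> E. f $ t) = of_nat (card {t. (u, t) \<in> E \<and> gdist E t x = Suc 0})"
      by (simp add: f sum.If_cases Int_def gdist_sym[of x])
    also have "\<dots> = of_real (aa 1)"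
    proof -
      have "gdist E u x = Suc 0" using True gdist_sym by metis
      then show ?thesis unfolding One_nat_def by (simp flip: card_nbr_a)
    qed
    finally show ?thesis using True by (simp add: Nop_nth f)
  qed (simp add: Nop_nth f)
  then have "Nop f = (of_real (aa 1) + 1) *s f" by (simp only: vec_eq_iff) simp
  moreover obtain y where "gdist E x y = Suc 0" using ex_local by blast
  then have "f \<noteq> 0" using f by (metis zero_index zero_neq_one)
  moreover have "lev (Suc 0) f = f" by (simp add: vec_eq_iff f)
  ultimately show ?thesis unfolding local_eigenvalue_iff by blast
qed

context
  assumes roots: "local_roots (- q) (\<alpha> * (g D - 1))" and \<alpha>: "\<alpha> \<noteq> 0"
begin

text \<open>For a zero-sum \<open>w\<close>, the vector \<open>(N - r) w\<close> lies in the kernel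
  of \<open>N - s\<close>. The choice of \<open>w\<close> makes it nonzero at \<open>y\<close>,
  which is adjacent to \<open>z\<close> but not to \<open>z'\<close>.\<close>

lemma root_eigenvalue:
  assumes rs: "local_roots r s"
  shows "of_real (s - 1) \<in> graph_eigenvalues (local_verts E x) (local_edges E x)"
proof -
  obtain y z z' where yz: "gdist E x y = Suc 0" "gdist E x z = Suc 0" "gdist E x z' = Suc 0"
    "(y, z) \<in> E" "(y, z') \<notin> E" "y \<noteq> z'" using ex_local_triple[OF roots \<alpha>] .
  define w :: "complex^'a" where "w = axis z 1 - axis z' 1"
  define f where "f = Nop w - r *\<^sub>R w"
  have w: "lev (Suc 0) w = w" "(\<Sum>z\<in>UNIV. w $ z) = 0"
    by (simp add: w_def lev_diff lev_axis yz) (simp add: w_def sum_subtractf axis_def)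
  have "Nop f - s *\<^sub>R f = Gop r s w" by (simp add: f_def Gop_def Nop_linear algebra_simps)
  then have "Nop f = s *\<^sub>R f" using Gop_eq_0[OF rs w] by simp
  then have "Nop f = (of_real (s - 1) + 1) *s f" by (simp add: scaleR_eq_smult)
  moreover have "lev (Suc 0) f = f" using w lev_Nop by (simp add: f_def op_linear)
  moreover have "f $ y = 1"
  proof -
    have "y \<noteq> z" using yz edge_irrefl by auto
    then have "w $ y = 0" using yz by (simp add: w_def axis_def)
    moreover have "Nop w $ y = 1"
      unfolding w_def Nop_linear vector_minus_component Nop_axis[OF yz(1)] using yz \<open>y \<noteq> z\<close> by simp
    ultimately show ?thesis by (simp add: f_def)
  qed
  then have "f \<noteq> 0" by auto
  ultimately show ?thesis unfolding local_eigenvalue_iff by blast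
qed

lemma eigenvalues_local:
  "graph_eigenvalues (local_verts E x) (local_edges E x)
    = {of_real (aa 1), of_real (\<alpha> * (g D - 1) - 1), of_real (- q - 1)}" (is "?ev = _")
proof (intro equalityI subsetI)
  fix \<mu> assume "\<mu> \<in> ?ev"
  then obtain f where f: "f \<noteq> 0" "lev (Suc 0) f = f" "Nop f = (\<mu> + 1) *s f"
    unfolding local_eigenvalue_iff by blast
  show "\<mu> \<in> {of_real (aa 1), of_real (\<alpha> * (g D - 1) - 1), of_real (- q - 1)}"
  \<comment> \<open>Summing the eigenvalue equation gives the valency unless the sum is zero, and
    zero-sum vectors obey the quadratic equation.\<close>
  proof (cases "(\<Sum>z\<in>UNIV. f $ z) = 0")
    case False
    have "(\<mu> + 1) * (\<Sum>z\<in>UNIV. f $ z) = of_real (aa 1 + 1) * (\<Sum>z\<in>UNIV. f $ z)"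
      using sum_Nop[OF f(2)] unfolding f(3)
      by (simp only: vector_smult_component sum_distrib_left[symmetric] scaleR_conv_of_real)
    then show ?thesis using False by simp
  next
    case True
    define r s where "r = - q" and "s = \<alpha> * (g D - 1)"
    have "Gop r s f = ((\<mu> + 1) * (\<mu> + 1) - of_real (r + s) * (\<mu> + 1) + of_real (r * s)) *s f"
      unfolding Gop_def f(3) Nop_linear scaleR_eq_smult
      by (simp add: vec_eq_iff algebra_simps)
    then have "((\<mu> + 1) * (\<mu> + 1) - of_real (r + s) * (\<mu> + 1) + of_real (r * s)) *s f = 0"
      using Gop_eq_0[OF roots f(2) True] by (simp add: r_def s_def)
    then have "(\<mu> + 1) * (\<mu> + 1) - of_real (r + s) * (\<mu> + 1) + of_real (r * s) = 0"
      using f(1) vector_mul_eq_0 by blast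
    then have "(\<mu> + 1 - of_real r) * (\<mu> + 1 - of_real s) = 0"
      unfolding of_real_add of_real_mult by algebra
    then have "\<mu> + 1 - of_real r = 0 \<or> \<mu> + 1 - of_real s = 0" by (simp only: mult_eq_0_iff)
    then have "\<mu> = of_real (r - 1) \<or> \<mu> = of_real (s - 1)" by (auto simp: algebra_simps)
    then show ?thesis by (auto simp: r_def s_def)
  qed
next
  fix \<mu> :: complex assume "\<mu> \<in> {of_real (aa 1), of_real (\<alpha> * (g D - 1) - 1), of_real (- q - 1)}"
  then show "\<mu> \<in> ?ev"
    using aa_1_eigenvalue root_eigenvalue[OF roots] root_eigenvalue[OF local_roots_sym[OF roots]] by blast
qed

lemma strongly_regular_local:
  "\<exists>l m. strongly_regular (local_verts E x) (local_edges E x) (b_num E 0) (a_num E 1) l m \<and>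
    real l = \<alpha> * (g D - 1) - q - 2 + \<alpha> * (1 + q) \<and> real m = \<alpha> * (1 + q)"
proof -
  obtain y z z' where yz: "gdist E x y = Suc 0" "gdist E x z = Suc 0" "gdist E x z' = Suc 0"
    "(y, z) \<in> E" "(y, z') \<notin> E" "y \<noteq> z'" using ex_local_triple[OF roots \<alpha>] .
  \<comment> \<open>The triple realises both kinds of pairs, so the real formulas are values of
    actual cardinalities.\<close>
  define l m where "l = card (common y z)" and "m = card (common y z')"
  have ne: "u \<noteq> t" if "(u, t) \<in> E" for u t using that edge_irrefl by auto
  have l: "real l = \<alpha> * (g D - 1) - q - 2 + \<alpha> * (1 + q)"
    using card_common[OF roots \<alpha> yz(1,2) ne[OF yz(4)]] yz(4) by (simp add: l_def)
  have m: "real m = \<alpha> * (1 + q)"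
    using card_common[OF roots \<alpha> yz(1,3,6)] yz(5) by (simp add: m_def)
  have "strongly_regular (local_verts E x) (local_edges E x) (b_num E 0) (a_num E 1) l m"
    unfolding strongly_regular_def
  proof (intro conjI ballI impI)
    show "simple_graph (local_verts E x) (local_edges E x)"
      using edge_sym edge_irrefl
      by (auto simp: simple_graph_def local_edges_def sym_def irrefl_def)
    have "real (card (local_verts E x)) = real (b_num E 0)"
      using card_local classical D3
      by (simp add: local_verts_iff[symmetric] classical_parameters_def bb_def)
    then show "card (local_verts E x) = b_num E 0" by simp
  next
    fix u assume "u \<in> local_verts E x"
    then have u: "gdist E x u = Suc 0" by (simp add: local_verts_iff)
    have "common u u = {w. gdist E x w = 1 \<and> gdist E u w = 1}"
      using gdist_edge[of u] edge_sym by auto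
    then have "card (common u u) = a_num E 1"
      unfolding a_num_def using inter_num_eq[OF drg, of x u 1 1 1] u D3 by simp
    then show "card {w \<in> local_verts E x. (u, w) \<in> local_edges E x} = a_num E 1"
      using local_nbrs[OF u] by simp
  next
    fix u t assume "u \<in> local_verts E x" "t \<in> local_verts E x" "(u, t) \<in> local_edges E x"
    then have ut: "gdist E x u = Suc 0" "gdist E x t = Suc 0" "(u, t) \<in> E"
      by (simp_all add: local_verts_iff local_edges_iff)
    have "real (card (common u t)) = real l"
      using card_common[OF roots \<alpha> ut(1,2) ne[OF ut(3)]] ut(3) l by simp
    then show "card {w \<in> local_verts E x. (u, w) \<in> local_edges E x \<and> (t, w) \<in> local_edges E x} = l"
      using local_common_nbrs[OF ut(1,2)] by simp
  next
    fix u t assume "u \<in> local_verts E x" "t \<in> local_verts E x" and n: "u \<noteq> t \<and> (u, t) \<notin> local_edges E x"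
    then have ut: "gdist E x u = Suc 0" "gdist E x t = Suc 0" "(u, t) \<notin> E"
      by (auto simp: local_verts_iff local_edges_iff)
    have "real (card (common u t)) = real m"
      using card_common[OF roots \<alpha> ut(1,2)] n ut(3) m by simp
    then show "card {w \<in> local_verts E x. (u, w) \<in> local_edges E x \<and> (t, w) \<in> local_edges E x} = m"
      using local_common_nbrs[OF ut(1,2)] by simp
  qed
  then show ?thesis using l m by blast
qed

text \<open>Distinct nonadjacent vertices have \<open>\<alpha> (1 + q)\<close> common neighbours,
  which is nonzero, so paths of length two suffice.\<close>

lemma connected_local: "connected_graph (local_verts E x) (local_edges E x)"
  unfolding connected_graph_def
proof (intro conjI ballI)
  show "local_verts E x \<noteq> {}" using ex_local local_verts_iff by blast
  fix u t assume "u \<in> local_verts E x" "t \<in> local_verts E x"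
  then have ut: "gdist E x u = Suc 0" "gdist E x t = Suc 0" by (simp_all add: local_verts_iff)
  show "(u, t) \<in> (local_edges E x)\<^sup>*"
  proof (cases "u = t \<or> (u, t) \<in> E")
    case True
    then show ?thesis using ut by (auto simp: local_edges_iff intro: r_into_rtrancl)
  next
    case False
    have "\<alpha> * (1 + q) \<noteq> 0" using \<alpha> q2 by simp
    then have "real (card (common u t)) \<noteq> 0" using card_common[OF roots \<alpha> ut] False by simp
    then have "common u t \<noteq> {}" by (intro notI) (simp only: card.empty of_nat_0)
    then obtain w where "(u, w) \<in> local_edges E x" "(w, t) \<in> local_edges E x"
      using ut by (auto simp: local_edges_iff)
    then show ?thesis by (meson converse_rtrancl_into_rtrancl r_into_rtrancl)
  qed
qed

end

end

theorem theorem6p3: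
  fixes E :: "('a::finite) rel" and x :: 'a and D :: nat and q \<alpha> \<beta> :: real
  assumes classical: "classical_parameters E D q \<alpha> \<beta>"
    and "D \<ge> 4" and "q \<ge> 2"
    and nonbip: "\<not> bipartite_graph UNIV E"
    and thin1: "\<And>W. irreducible_T_module E x W \<Longrightarrow> endpoint E x W = 1 \<Longrightarrow> thin E x W"
    and uniform: "supports_uniform_structure E x"
    and "\<alpha> \<noteq> 0"
  shows "connected_graph (local_verts E x) (local_edges E x) \<and>
    graph_eigenvalues (local_verts E x) (local_edges E x) =
      {of_nat (a_num E 1),
       of_real (\<alpha> * q * ((q ^ (D - 1) - 1) / (q - 1)) - 1),
       of_real (- q - 1)} \<and>
    \<beta> = \<alpha> * ((q ^ (D + 1) - 1) / (q - 1)) - q \<and>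
    (\<exists>l m. strongly_regular (local_verts E x) (local_edges E x) (b_num E 0) (a_num E 1) l m \<and>
      real (b_num E 0) = (q ^ D - 1) * (\<alpha> * q ^ (D + 1) - q\<^sup>2 + q - \<alpha>) / (q - 1)\<^sup>2 \<and>
      real (a_num E 1) = (q + 1) * (\<alpha> * q ^ D - q - \<alpha> + 1) / (q - 1) \<and>
      real l = (\<alpha> * q ^ D + \<alpha> * q\<^sup>2 - q\<^sup>2 - \<alpha> * q - q - \<alpha> + 2) / (q - 1) \<and>
      real m = \<alpha> * (q + 1))"
proof -
  interpret based_drg E D q \<alpha> \<beta> x
    using assms by unfold_locales (auto simp: classical_parameters_def distance_regular_def)
  have roots: "local_roots (- q) (\<alpha> * (g D - 1))"
    by (rule local_roots_uniform) (use thin1 uniform \<open>\<alpha> \<noteq> 0\<close> module_1_def in auto)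
  note local = roots \<open>\<alpha> \<noteq> 0\<close>
  have q1: "q - 1 \<noteq> 0" using q2 by simp
  have g: "g i = (q ^ i - 1) / (q - 1)" for i using q1 power_gauss[of q i] by (simp add: field_simps)
  have gD: "g D - 1 = q * g (D - 1)" using gauss_Suc_left[of q "D - 1"] D3 by simp
  have gD1: "g (D + 1) = 1 + q * g D" by (simp add: gauss_Suc_left)
  have b0: "real (b_num E 0) = bb 0"
    using classical D3 by (simp add: classical_parameters_def bb_def)
  have a1: "real (a_num E 1) = aa 1"
  proof -
    obtain y where y: "gdist E x y = Suc 0" using ex_local by blast
    have "common y y = {w. gdist E x w = 1 \<and> gdist E y w = 1}"
      using gdist_edge[of y] edge_sym by auto
    then show ?thesis
      unfolding a_num_def using inter_num_eq[OF drg, of x y 1 1 1] y D3 common_self[OF y] by simp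
  qed
  \<comment> \<open>With \<open>q ^ D\<close> written through \<open>G\<close>, the required closed
    forms become polynomial identities in \<open>q\<close>, \<alpha> and \<open>G\<close>.\<close>
  define G where "G = g D"
  have G: "q ^ D = 1 + (q - 1) * G" unfolding G_def by (rule power_gauss)
  have \<beta>: "\<beta> = \<alpha> * (1 + q * G) - q" using \<beta>_eq[OF local] by (simp add: G_def)
  have "bb 0 = G * \<beta>" by (simp add: bb_def G_def)
  then have bb0: "bb 0 = G * (\<alpha> * (1 + q * G) - q)" using \<beta> by simp
  have "bb 0 * (q - 1)\<^sup>2 = (q ^ D - 1) * (\<alpha> * (q * q ^ D) - q\<^sup>2 + q - \<alpha>)"
    unfolding bb0 G by algebra
  then have n: "bb 0 = (q ^ D - 1) * (\<alpha> * q ^ (D + 1) - q\<^sup>2 + q - \<alpha>) / (q - 1)\<^sup>2"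
    using q1 by (simp add: field_simps)
  have "aa 1 = \<beta> + \<alpha> * (G - 1) - 1" using aa_1 by (simp add: G_def)
  then have "aa 1 * (q - 1) = (q + 1) * (\<alpha> * q ^ D - q - \<alpha> + 1)" using \<beta> unfolding G by algebra
  then have k: "aa 1 = (q + 1) * (\<alpha> * q ^ D - q - \<alpha> + 1) / (q - 1)"
    using q1 by (simp add: field_simps)
  have "(\<alpha> * (G - 1) - q - 2 + \<alpha> * (1 + q)) * (q - 1)
      = \<alpha> * q ^ D + \<alpha> * q\<^sup>2 - q\<^sup>2 - \<alpha> * q - q - \<alpha> + 2"
    unfolding G by algebra
  then have l: "\<alpha> * (g D - 1) - q - 2 + \<alpha> * (1 + q)
      = (\<alpha> * q ^ D + \<alpha> * q\<^sup>2 - q\<^sup>2 - \<alpha> * q - q - \<alpha> + 2) / (q - 1)"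
    using q1 by (simp add: G_def field_simps)
  have ev: "graph_eigenvalues (local_verts E x) (local_edges E x) =
      {of_nat (a_num E 1), of_real (\<alpha> * q * ((q ^ (D - 1) - 1) / (q - 1)) - 1), of_real (- q - 1)}"
    using eigenvalues_local[OF local] unfolding gD g[symmetric] a1[symmetric] by (simp add: mult.assoc)
  have \<beta>': "\<beta> = \<alpha> * ((q ^ (D + 1) - 1) / (q - 1)) - q"
    using \<beta>_eq[OF local] unfolding g[symmetric] gD1 .
  obtain l' m' where "strongly_regular (local_verts E x) (local_edges E x) (b_num E 0) (a_num E 1) l' m'"
    "real l' = \<alpha> * (g D - 1) - q - 2 + \<alpha> * (1 + q)" "real m' = \<alpha> * (q + 1)"
    using strongly_regular_local[OF local] by (auto simp: add.commute)
  then show ?thesis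
    using connected_local[OF local] ev \<beta>' n k unfolding l b0 a1 by blast
qed

end
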